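(* Assume that conditions (B1)--(B5) hold and that either (A1) or (A2) holds (all stated in the context). Choose three scalars $\alpha,\beta>0$ and $\gamma\ge0$ satisfying $$\gamma>1-\tfrac{1}{2\kappa}+\beta+\tfrac{\alpha}{\kappa}\ \text{ if }\kappa>0,\qquad\qquad \alpha\in\left(0,\tfrac12\right)\text{ and }\beta>0\ \text{ if }\kappa=0.$$ There is a finite constant $R>0$, depending only on the constants in the assumptions and on $\alpha,\beta$, such that the following holds. Let $(f_J:J\subset[p],|J|\le q)$ be prior densities, $f_J$ on $\mathbb{R}^J$, for which there are constants $0<F_1,F_2,F_3<\infty$ (not depending on $n$) such that, uniformly for all $|J|\le q$: (i) $\sup_{\phi_J}f_J(\phi_J)\le F_1$; (ii) $\inf_{\|\phi_J\|_2\le R+1}f_J(\phi_J)\ge F_2$; (iii) $\sup_{\|\phi_J\|_2\le R+1}\|\nabla f_J(\phi_J)\|_2\le F_3$. Then, for sufficiently large $n$, with probability at least $1-n^{-\alpha}p^{-\beta}$ under (A1), or at least $1-4K^{K+1}n^{-\frac{K-2\kappa}{2}}-n^{-\alpha}p^{-\beta}$ under (A2), $$\mathrm{Bayes}_\gamma(J^* )>\max_{J\ne J^*,|J|\le q}\mathrm{Bayes}_\gamma(J).$$ In particular, Bayesian model selection is consistent whenever $\gamma>1-\frac1{2\kappa}$ (and $\gamma\ge 0$), i.e. the probability that $J^*$ is the unique maximizer of $\mathrm{Bayes}_\gamma(J)$ over $|J|\le q$ tends to one as $n\to\infty$.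
   Context: **Model.** Consider a univariate exponential family with densities $p_\theta(y)\propto\exp\{y\theta-\mathbf b(\theta)\}$, $\theta\in\mathbb{R}$, with respect to some measure on $\mathbb{R}$ ($\mathbf b$ is the cumulant generating function). For each sample size $n$ there are $p=p_n$ covariates. The covariate vectors $X_{1\bullet},\dots,X_{n\bullet}\in\mathbb{R}^p$, $X_{i\bullet}=(X_{i1},\dots,X_{ip})$, are i.i.d. random vectors. Given the covariates, the responses $Y_1,\dots,Y_n$ are independent, $Y_i\sim p_{\theta_i}$ with $\theta_i=X_{i\bullet}^T\phi^*$, where $\phi^*\in\mathbb{R}^p$ (which may depend on $n$) is the true parameter, with support $J^*=\{j:\phi^*_j\ne0\}$ (the smallest true model). Write $[p]=\{1,\dots,p\}$ and $X_{iJ}=(X_{ij})_{j\in J}$ for $J\subset[p]$. Vectors $\phi_J\in\mathbb{R}^J$ are identified with vectors in $\mathbb{R}^p$ by extending by zero. **Likelihood and Bayes.** $L_{[n]}(\phi)=\exp\{\sum_{i=1}^n (Y_i X_{i\bullet}^T\phi-\mathbf b(X_{i\bullet}^T\phi))\}$. For $J\subset[p]$, with prior densities $f_J$ on $\mathbb{R}^J$ and $\gamma\ge0$, the unnormalized posterior probability is $\mathrm{Bayes}_\gamma(J)=\binom{p}{|J|}^{-\gamma}\mathbf 1\{|J|\le q\}\cdot\int_{\mathbb{R}^J}L_{[n]}(\phi_J)f_J(\phi_J)\,d\phi_J$. **Assumptions.** Asymptotics are $n\to\infty$ with $p=p_n$; $\kappa_n=\log_n(p_n)$ and $\kappa=\limsup\kappa_n\in[0,\infty]$,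 with conventions $1/\infty=0$ and $1-\frac1{2\cdot 0}=-\infty$. All named constants do not depend on $n$. - (A1) There is a constant $A<\infty$ with $|X_{1j}|\le A$ (with probability one) for $j=1,\dots,p$. - (A2) There is an even integer $K>2\kappa$ (in particular $\kappa<\infty$) with $\mathbb{E}[|X_{1j}|^{6K}]\le A_K<\infty$ for $j=1,\dots,p$; moreover, for all $t>0$, $B_K(t):=\sup_j\mathbb{E}\big[\sup_{|\theta|\le t|X_{1j}|}|\mathbf b'''(\theta)|^{2K}\big]<\infty$. - (B1) $\log(p)=o(n)$. - (B2) $|J^*|\le q$ for a fixed integer $q\in\mathbb{N}$. - (B3) For fixed finite constants $a_1,a_2>0$, $a_1\mathbf I_J\preceq\mathbb{E}[X_{1J}X_{1J}^T]\preceq a_2\mathbf I_J$ for all $|J|\le2q$. - (B4) $\|\phi^*\|_2\le a_3$ for a fixed constant $0<a_3<\infty$. - (B5) $\sqrt{\log(np)/n}=o(\min\{|\phi_j^*|:j\in J^*\})$.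
   Formalization: In the finite-n probability bounds the condition on α, β, γ is required at liminf κ_n as well as at κ = limsup κ_n (automatic if κ_n converges or α < 1/2); without it they fail for oscillating κ_n. The family is assumed non-degenerate. The consistency claim has no liminf condition. *)

theory Defs
  imports "HOL-Probability.Probability" "HOL-Library.Landau_Symbols"
begin

(* A vector indexed by a finite set J of naturals is a function nat => real that is read on J
   only; [p] is {1..p}.  The space R^J is the carrier {f. f extensional on J} of PiM J lborel,
   and its Euclidean norm is the library's L2_set _ J. *)

abbreviation lebesgue_on_coords :: "nat set \<Rightarrow> (nat \<Rightarrow> real) measure" where
  "lebesgue_on_coords J \<equiv> PiM J (\<lambda>_. lborel)"

definition zero_ext :: "nat set \<Rightarrow> (nat \<Rightarrow> real) \<Rightarrow> nat \<Rightarrow> real" where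
  "zero_ext J \<phi> j = (if j \<in> J then \<phi> j else 0)"

definition dot :: "nat \<Rightarrow> (nat \<Rightarrow> real) \<Rightarrow> (nat \<Rightarrow> real) \<Rightarrow> real" where
  "dot p x \<phi> = (\<Sum>j\<in>{1..p}. x j * \<phi> j)"

definition loewner_le :: "nat set \<Rightarrow> (nat \<Rightarrow> nat \<Rightarrow> real) \<Rightarrow> (nat \<Rightarrow> nat \<Rightarrow> real) \<Rightarrow> bool" where
  "loewner_le J S T \<longleftrightarrow>
     (\<forall>v. (\<Sum>j\<in>J. \<Sum>k\<in>J. v j * S j k * v k) \<le> (\<Sum>j\<in>J. \<Sum>k\<in>J. v j * T j k * v k))"

(* Frechet differentiability on R^J at \<phi>, with gradient g; restated for coordinate functions
   because nat => real carries no norm. *)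
definition has_gradient_on_coords ::
  "nat set \<Rightarrow> ((nat \<Rightarrow> real) \<Rightarrow> real) \<Rightarrow> (nat \<Rightarrow> real) \<Rightarrow> (nat \<Rightarrow> real) \<Rightarrow> bool" where
  "has_gradient_on_coords J f \<phi> g \<longleftrightarrow>
     (\<forall>e>0. \<exists>d>0. \<forall>\<psi>\<in>space (lebesgue_on_coords J). L2_set (\<lambda>j. \<psi> j - \<phi> j) J < d \<longrightarrow>
        \<bar>f \<psi> - f \<phi> - (\<Sum>j\<in>J. g j * (\<psi> j - \<phi> j))\<bar> \<le> e * L2_set (\<lambda>j. \<psi> j - \<phi> j) J)"

(* The natural parameter space is all of R.  The last assumption is the standard convention that
   the family is not degenerate: for a base measure concentrated at one point all p_\<theta> coincide
   and no coefficient is identifiable.  It also excludes the zero measure. *)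
locale exponential_family =
  fixes \<mu> :: "real measure"
  assumes sets_base: "sets \<mu> = sets borel"
    and exp_integrable: "\<And>\<theta>. integrable \<mu> (\<lambda>y. exp (y * \<theta>))"
    and nondegenerate: "\<not> (\<exists>c. AE y in \<mu>. y = c)"

(* With this choice of additive constant exp (y * \<theta> - cgf \<mu> \<theta>) integrates to one. *)
definition cgf :: "real measure \<Rightarrow> real \<Rightarrow> real" where
  "cgf \<mu> \<theta> = ln (\<integral>y. exp (y * \<theta>) \<partial>\<mu>)"

definition expfam :: "real measure \<Rightarrow> real \<Rightarrow> real measure" where
  "expfam \<mu> \<theta> = density \<mu> (\<lambda>y. ennreal (exp (y * \<theta> - cgf \<mu> \<theta>)))"

definition covariate_row ::
  "(nat \<Rightarrow> nat \<Rightarrow> nat \<Rightarrow> 'w \<Rightarrow> real) \<Rightarrow> (nat \<Rightarrow> nat) \<Rightarrow> nat \<Rightarrow> nat \<Rightarrow> 'w \<Rightarrow> nat \<Rightarrow> real" where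
  "covariate_row X p n i \<omega> = (\<lambda>j\<in>{1..p n}. X n i j \<omega>)"

definition covariate_algebra ::
  "(nat \<Rightarrow> 'w measure) \<Rightarrow> (nat \<Rightarrow> nat \<Rightarrow> nat \<Rightarrow> 'w \<Rightarrow> real) \<Rightarrow> (nat \<Rightarrow> nat) \<Rightarrow> nat \<Rightarrow> 'w measure" where
  "covariate_algebra M X p n =
     vimage_algebra (space (M n)) (\<lambda>\<omega>. \<lambda>i\<in>{1..n}. covariate_row X p n i \<omega>)
       (PiM {1..n} (\<lambda>_. PiM {1..p n} (\<lambda>_. borel)))"

(* M n carries the data of sample size n: X n i j is the j-th covariate and Y n i the response of
   observation i.  The last assumption is the conditional law of (Y_1,...,Y_n) given all
   covariates: a product of members of the family. *)
locale glm_sequence = exponential_family \<mu>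
  for \<mu> :: "real measure" +
  fixes M :: "nat \<Rightarrow> 'w measure"
    and X :: "nat \<Rightarrow> nat \<Rightarrow> nat \<Rightarrow> 'w \<Rightarrow> real"
    and Y :: "nat \<Rightarrow> nat \<Rightarrow> 'w \<Rightarrow> real"
    and p :: "nat \<Rightarrow> nat"
    and \<phi>s :: "nat \<Rightarrow> nat \<Rightarrow> real"
  assumes prob: "n \<ge> 1 \<Longrightarrow> prob_space (M n)"
    and p_pos: "n \<ge> 1 \<Longrightarrow> p n \<ge> 1"
    and rows_indep: "n \<ge> 1 \<Longrightarrow>
      prob_space.indep_vars (M n) (\<lambda>_. PiM {1..p n} (\<lambda>_. borel)) (covariate_row X p n) {1..n}"
    and rows_ident: "n \<ge> 1 \<Longrightarrow> i \<in> {1..n} \<Longrightarrow>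
      distr (M n) (PiM {1..p n} (\<lambda>_. borel)) (covariate_row X p n i) =
      distr (M n) (PiM {1..p n} (\<lambda>_. borel)) (covariate_row X p n 1)"
    and Y_measurable: "n \<ge> 1 \<Longrightarrow> i \<in> {1..n} \<Longrightarrow> Y n i \<in> borel_measurable (M n)"
    and Y_conditional_law: "n \<ge> 1 \<Longrightarrow> (\<And>i. i \<in> {1..n} \<Longrightarrow> S i \<in> sets borel) \<Longrightarrow>
      AE \<omega> in M n.
        real_cond_exp (M n) (covariate_algebra M X p n)
          (indicat_real {\<omega> \<in> space (M n). \<forall>i\<in>{1..n}. Y n i \<omega> \<in> S i}) \<omega>
        = (\<Prod>i\<in>{1..n}. measure (expfam \<mu> (dot (p n) (\<lambda>j. X n i j \<omega>) (\<phi>s n))) (S i))"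

definition true_support :: "(nat \<Rightarrow> nat) \<Rightarrow> (nat \<Rightarrow> nat \<Rightarrow> real) \<Rightarrow> nat \<Rightarrow> nat set" where
  "true_support p \<phi>s n = {j \<in> {1..p n}. \<phi>s n j \<noteq> 0}"

definition growth_rate :: "(nat \<Rightarrow> nat) \<Rightarrow> nat \<Rightarrow> ereal" where
  "growth_rate p n = ereal (log (real n) (real (p n)))"

definition bounded_covariates ::
  "(nat \<Rightarrow> 'w measure) \<Rightarrow> (nat \<Rightarrow> nat \<Rightarrow> nat \<Rightarrow> 'w \<Rightarrow> real) \<Rightarrow> (nat \<Rightarrow> nat) \<Rightarrow> real \<Rightarrow> bool" where
  "bounded_covariates M X p A \<longleftrightarrow>
     (\<forall>n\<ge>1. \<forall>j\<in>{1..p n}. AE \<omega> in M n. \<bar>X n 1 j \<omega>\<bar> \<le> A)"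

(* AK and B t are the finite bounds for the moments, common to all n and j. *)
definition moment_covariates ::
  "real measure \<Rightarrow> (nat \<Rightarrow> 'w measure) \<Rightarrow> (nat \<Rightarrow> nat \<Rightarrow> nat \<Rightarrow> 'w \<Rightarrow> real) \<Rightarrow> (nat \<Rightarrow> nat) \<Rightarrow>
   nat \<Rightarrow> real \<Rightarrow> (real \<Rightarrow> real) \<Rightarrow> bool" where
  "moment_covariates \<mu> M X p K AK B \<longleftrightarrow>
     even K \<and> ereal (real K) > 2 * limsup (growth_rate p) \<and>
     (\<forall>n\<ge>1. \<forall>j\<in>{1..p n}.
        (\<integral>\<^sup>+\<omega>. ennreal (\<bar>X n 1 j \<omega>\<bar> ^ (6 * K)) \<partial>M n) \<le> ennreal AK \<and>
        (\<forall>t>0. (\<integral>\<^sup>+\<omega>. (SUP \<theta>\<in>{\<theta>. \<bar>\<theta>\<bar> \<le> t * \<bar>X n 1 j \<omega>\<bar>}.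
                   ennreal (\<bar>(deriv ^^ 3) (cgf \<mu>) \<theta>\<bar> ^ (2 * K))) \<partial>M n) \<le> ennreal (B t)))"

(* The last clause unfolds sqrt (log (n p) / n) = o(min |\<phi>_j|), the minimum over an empty support
   being infinite. *)
definition sparse_regression_regime ::
  "(nat \<Rightarrow> 'w measure) \<Rightarrow> (nat \<Rightarrow> nat \<Rightarrow> nat \<Rightarrow> 'w \<Rightarrow> real) \<Rightarrow> (nat \<Rightarrow> nat) \<Rightarrow> (nat \<Rightarrow> nat \<Rightarrow> real) \<Rightarrow>
   nat \<Rightarrow> real \<Rightarrow> real \<Rightarrow> real \<Rightarrow> bool" where
  "sparse_regression_regime M X p \<phi>s q a1 a2 a3 \<longleftrightarrow>
     (\<lambda>n. ln (real (p n))) \<in> o(\<lambda>n. real n) \<and>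
     (\<forall>n\<ge>1. card (true_support p \<phi>s n) \<le> q) \<and>
     (\<forall>n\<ge>1. \<forall>J. J \<subseteq> {1..p n} \<and> card J \<le> 2 * q \<longrightarrow>
        loewner_le J (\<lambda>j k. if j = k then a1 else 0) (\<lambda>j k. \<integral>\<omega>. X n 1 j \<omega> * X n 1 k \<omega> \<partial>M n) \<and>
        loewner_le J (\<lambda>j k. \<integral>\<omega>. X n 1 j \<omega> * X n 1 k \<omega> \<partial>M n) (\<lambda>j k. if j = k then a2 else 0)) \<and>
     (\<forall>n\<ge>1. L2_set (\<phi>s n) {1..p n} \<le> a3) \<and>
     (\<forall>c>0. \<forall>\<^sub>F n in sequentially. \<forall>j\<in>true_support p \<phi>s n.
        sqrt (ln (real n * real (p n)) / real n) \<le> c * \<bar>\<phi>s n j\<bar>)"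

definition prior_conditions ::
  "(nat \<Rightarrow> nat) \<Rightarrow> nat \<Rightarrow> real \<Rightarrow> (nat \<Rightarrow> nat set \<Rightarrow> (nat \<Rightarrow> real) \<Rightarrow> real) \<Rightarrow>
   real \<Rightarrow> real \<Rightarrow> real \<Rightarrow> bool" where
  "prior_conditions p q R f F1 F2 F3 \<longleftrightarrow>
     0 < F1 \<and> 0 < F2 \<and> 0 < F3 \<and>
     (\<forall>n\<ge>1. \<forall>J. J \<subseteq> {1..p n} \<and> card J \<le> q \<longrightarrow>
        f n J \<in> borel_measurable (lebesgue_on_coords J) \<and>
        (\<forall>\<phi>\<in>space (lebesgue_on_coords J). 0 \<le> f n J \<phi>) \<and>
        (\<integral>\<^sup>+\<phi>. ennreal (f n J \<phi>) \<partial>lebesgue_on_coords J) = 1 \<and>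
        (\<forall>\<phi>\<in>space (lebesgue_on_coords J). f n J \<phi> \<le> F1) \<and>
        (\<forall>\<phi>\<in>space (lebesgue_on_coords J). L2_set \<phi> J \<le> R + 1 \<longrightarrow>
           F2 \<le> f n J \<phi> \<and>
           (\<exists>g. has_gradient_on_coords J (f n J) \<phi> g \<and> L2_set g J \<le> F3)))"

definition likelihood ::
  "(real \<Rightarrow> real) \<Rightarrow> nat \<Rightarrow> nat \<Rightarrow> (nat \<Rightarrow> nat \<Rightarrow> real) \<Rightarrow> (nat \<Rightarrow> real) \<Rightarrow> (nat \<Rightarrow> real) \<Rightarrow> real" where
  "likelihood b n p x y \<phi> = exp (\<Sum>i\<in>{1..n}. y i * dot p (x i) \<phi> - b (dot p (x i) \<phi>))"

(* Valued in ennreal, so that the integral of the nonnegative integrand always has its true value. *)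
definition bayes_score ::
  "(real \<Rightarrow> real) \<Rightarrow> nat \<Rightarrow> nat \<Rightarrow> nat \<Rightarrow> real \<Rightarrow> (nat set \<Rightarrow> (nat \<Rightarrow> real) \<Rightarrow> real) \<Rightarrow>
   (nat \<Rightarrow> nat \<Rightarrow> real) \<Rightarrow> (nat \<Rightarrow> real) \<Rightarrow> nat set \<Rightarrow> ennreal" where
  "bayes_score b n p q \<gamma> f x y J =
     ennreal (real (p choose card J) powr (- \<gamma>)) * (if card J \<le> q then 1 else 0) *
     (\<integral>\<^sup>+\<phi>. ennreal (likelihood b n p x y (zero_ext J \<phi>) * f J \<phi>) \<partial>lebesgue_on_coords J)"

definition bayes_selects_truth ::
  "real measure \<Rightarrow> (nat \<Rightarrow> 'w measure) \<Rightarrow> (nat \<Rightarrow> nat \<Rightarrow> nat \<Rightarrow> 'w \<Rightarrow> real) \<Rightarrow>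
   (nat \<Rightarrow> nat \<Rightarrow> 'w \<Rightarrow> real) \<Rightarrow> (nat \<Rightarrow> nat) \<Rightarrow> (nat \<Rightarrow> nat \<Rightarrow> real) \<Rightarrow> nat \<Rightarrow> real \<Rightarrow>
   (nat \<Rightarrow> nat set \<Rightarrow> (nat \<Rightarrow> real) \<Rightarrow> real) \<Rightarrow> nat \<Rightarrow> 'w set" where
  "bayes_selects_truth \<mu> M X Y p \<phi>s q \<gamma> f n =
     {\<omega> \<in> space (M n).
        let score = bayes_score (cgf \<mu>) n (p n) q \<gamma> (f n) (\<lambda>i j. X n i j \<omega>) (\<lambda>i. Y n i \<omega>)
        in \<forall>J. J \<subseteq> {1..p n} \<and> J \<noteq> true_support p \<phi>s n \<and> card J \<le> q \<longrightarrow>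
             score J < score (true_support p \<phi>s n)}"

definition admissible_scalars :: "real \<Rightarrow> real \<Rightarrow> real \<Rightarrow> ereal \<Rightarrow> bool" where
  "admissible_scalars \<alpha> \<beta> \<gamma> \<kappa> \<longleftrightarrow>
     (if \<kappa> = 0 then \<alpha> < 1 / 2
      else ereal \<gamma> > 1 - 1 / (2 * \<kappa>) + ereal \<beta> + ereal \<alpha> / \<kappa>)"

(* Division in ereal realises the conventions 1 / \<infinity> = 0 and 1 - 1 / (2 * 0) = - \<infinity>. *)
lemma ereal_convention_infinity: "1 - 1 / (2 * (\<infinity>::ereal)) = 1"
  by (simp add: one_ereal_def)

lemma ereal_convention_zero: "1 - 1 / (2 * (0::ereal)) = - \<infinity>"
  by (simp add: divide_ereal_def one_ereal_def)

(* For \<alpha> < 1/2, admissibility at the limsup of the growth rate implies admissibility at every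
   smaller value, in particular at the liminf; so requiring it at the liminf as well is void if
   \<alpha> < 1/2 or if the growth rate converges.  For \<alpha> \<ge> 1/2 it cannot be dropped: where p stays
   bounded along a subsequence, one superfluous covariate is selected with probability of order
   n powr (- 1/2) up to logarithms, which exceeds n powr (- \<alpha>) * p powr (- \<beta>). *)
lemma admissible_scalars_mono:
  assumes "admissible_scalars \<alpha> \<beta> \<gamma> \<kappa>" "0 \<le> \<kappa>'" "\<kappa>' \<le> \<kappa>" "\<alpha> < 1 / 2"
  shows "admissible_scalars \<alpha> \<beta> \<gamma> \<kappa>'"
proof (cases "\<kappa>' = 0")
  case True
  then show ?thesis using assms(4) by (simp add: admissible_scalars_def)
next
  case False
  with assms(2) have pos': "0 < \<kappa>'" by simp
  with assms(3) have "\<kappa> \<noteq> 0" by auto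
  with assms(1) have hyp: "ereal \<gamma> > 1 - 1 / (2 * \<kappa>) + ereal \<beta> + ereal \<alpha> / \<kappa>"
    by (simp add: admissible_scalars_def)
  have "ereal \<gamma> > 1 - 1 / (2 * \<kappa>') + ereal \<beta> + ereal \<alpha> / \<kappa>'"
  proof (cases "\<kappa>'")
    case PInf
    with assms(3) hyp show ?thesis by simp
  next
    case MInf
    with pos' show ?thesis by simp
  next
    case (real k')
    with pos' have k': "0 < k'" by simp
    have "\<gamma> - 1 - \<beta> > (\<alpha> - 1 / 2) / k'"
    proof (cases \<kappa>)
      case PInf
      with hyp have "\<gamma> > 1 + \<beta>" by (simp add: one_ereal_def)
      moreover have "(\<alpha> - 1 / 2) / k' < 0" using assms(4) k' by (simp add: divide_neg_pos)
      ultimately show ?thesis by linarith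
    next
      case MInf
      with assms(3) real show ?thesis by simp
    next
      case (real k)
      with assms(3) \<open>\<kappa>' = ereal k'\<close> have kk: "k' \<le> k" by simp
      with k' have k: "0 < k" by linarith
      have "\<gamma> > 1 - 1 / (2 * k) + \<beta> + \<alpha> / k"
        using hyp real k by (simp add: one_ereal_def)
      then have "\<gamma> - 1 - \<beta> > (\<alpha> - 1 / 2) / k" by (simp add: diff_divide_distrib)
      moreover have "(\<alpha> - 1 / 2) / k' \<le> (\<alpha> - 1 / 2) / k"
        using assms(4) k' kk k by (intro divide_left_mono_neg) auto
      ultimately show ?thesis by linarith
    qed
    then have "\<gamma> > 1 - 1 / (2 * k') + \<beta> + \<alpha> / k'" by (simp add: diff_divide_distrib)
    with real k' show ?thesis by (simp add: one_ereal_def)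
  qed
  with False show ?thesis by (simp add: admissible_scalars_def)
qed

end

theory Submission
  imports Defs
begin

text \<open>The ratio L(phi) / L(phi*) of likelihoods has expectation one for every fixed phi. By Tonelli and
  Markov, the part of the marginal likelihood of a model J that comes from parameters within distance
  of order r = sqrt (log (n p) / n) of the truth is therefore at most F1 (2 r)^|J| / u except with
  probability u; up to logarithms this is the Laplace approximation together with the sharp tail of
  the likelihood ratio statistic, and it gives the threshold for gamma after a union bound over
  supersets of the true support. Parameters farther away contribute a negligible amount, because the
  log-likelihood is concave and on the sphere of radius r its linear term (the score) is dominated by
  its curvature. A lower bound for the true model needs no control of the score: averaging over the
  reflection of a small cube at the truth cancels the linear term.\<close>

section \<open>Cumulant generating functions of exponential families\<close>

text \<open>The threshold comes from this count. Let k be the size of the true model. The near part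
  of a superset with r extra covariates has mean of order n^(-(k + r)/2) up to logarithms, while
  after the penalties it overtakes the true model only above p^(\<gamma> r) n^(-k/2). Markov gives
  n^(-r/2) p^(-\<gamma> r), there are at most p^r such supersets, and r = 1 dominates: n^(-1/2) p^(1
  - \<gamma>) must stay below n^(-\<alpha>) p^(-\<beta>). In logarithms this is the admissibility
  inequality, and its strictness absorbs the powers of log (n p). The conclusion is a rate, so every
  other failure must be rarer still. For the score this is a matter of constants, since its tail is
  any prescribed power of 1 / (n p); for the empirical Hessian it follows from log p = o(n). Without
  bounded covariates the linear predictors are unbounded, and so is the curvature of a single
  observation. It is then bounded below by discarding rows with large entries, and above by
  truncated sums on a covariate event whose failure probability is the additional error
  term.\<close>

lemma power_le_fact_exp: "x ^ k \<le> fact k * exp x" if "0 \<le> x" for x :: real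
proof -
  have "(\<Sum>i\<in>{k}. x ^ i /\<^sub>R fact i) \<le> exp x"
    unfolding exp_def
    using summable_exp_generic[of x] that by (intro sum_le_suminf) auto
  then show ?thesis by (simp add: field_simps)
qed

text \<open>Majorant for the difference quotient of an exponential, needed for dominated convergence
  in \<open>has_derivative_moment\<close>. For x \<ge> 0 it amounts to exp x * (1 - x) \<le> 1,
  which is 1 - x \<le> exp (- x) multiplied by exp x.\<close>

lemma abs_exp_minus_one_le: "\<bar>exp x - 1\<bar> \<le> \<bar>x\<bar> * exp \<bar>x\<bar>" for x :: real
proof -
  have "1 + x \<le> exp x" "1 - x \<le> exp (- x)"
    using exp_ge_add_one_self[of x] exp_ge_add_one_self[of "- x"] by auto
  moreover have "exp x * (1 - x) \<le> 1"
    using mult_left_mono[OF \<open>1 - x \<le> exp (- x)\<close>, of "exp x"] by (simp add: exp_minus)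
  ultimately show ?thesis
  proof (cases "x \<ge> 0")
    case True
    then show ?thesis using \<open>exp x * (1 - x) \<le> 1\<close> by (simp add: algebra_simps)
  next
    case False
    have "1 - exp x \<le> - x" using \<open>1 + x \<le> exp x\<close> by linarith
    also have "\<dots> \<le> - x * exp (- x)"
      using False mult_left_mono[of 1 "exp (- x)" "- x"] by simp
    finally show ?thesis using False by simp
  qed
qed

section \<open>Moments, derivatives and convexity of the cumulant generating function\<close>

context exponential_family
begin

text \<open>Unnormalised: \<open>moment 0\<close> is the Laplace transform of the base measure and
  \<open>moment k\<close> its k-th derivative, so the derivatives of \<open>cgf\<close> are rational
  in these functions.\<close>

definition moment :: "nat \<Rightarrow> real \<Rightarrow> real" where
  "moment k \<theta> = (\<integral>y. y ^ k * exp (y * \<theta>) \<partial>\<mu>)"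

lemma sets_base_cong [measurable_cong]: "sets \<mu> = sets borel" by (rule sets_base)

lemma space_base [simp]: "space \<mu> = UNIV"
  using sets_eq_imp_space_eq[OF sets_base] by simp

lemma finite_measure_base: "finite_measure \<mu>"
proof -
  have "integrable \<mu> (\<lambda>y. 1 :: real)" using exp_integrable[of 0] by simp
  then have "(\<integral>\<^sup>+y. 1 \<partial>\<mu>) < \<infinity>" by (simp add: integrable_iff_bounded)
  then show ?thesis by (intro finite_measureI) (simp add: less_top)
qed

text \<open>The factor exp (r * |y|) absorbs a shift of \<theta> by at most r, so one integrable
  function dominates all difference quotients near \<theta>. In the majorant the parameter moves by
  1 + |r| in both directions; the 1 pays for the power of y.\<close>

lemma integrable_moment_abs: "integrable \<mu> (\<lambda>y. \<bar>y\<bar> ^ k * exp (r * \<bar>y\<bar>) * exp (y * \<theta>))"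
proof (rule Bochner_Integration.integrable_bound)
  show "integrable \<mu> (\<lambda>y. fact k * (exp (y * (\<theta> + (1 + \<bar>r\<bar>))) + exp (y * (\<theta> - (1 + \<bar>r\<bar>)))))"
    by (intro integrable_mult_right Bochner_Integration.integrable_add exp_integrable)
  have "\<bar>y\<bar> ^ k * exp (r * \<bar>y\<bar>) * exp (y * \<theta>) \<le>
        fact k * (exp (y * (\<theta> + (1 + \<bar>r\<bar>))) + exp (y * (\<theta> - (1 + \<bar>r\<bar>))))" for y
  proof -
    have "\<bar>y\<bar> ^ k * exp (r * \<bar>y\<bar>) * exp (y * \<theta>) \<le> (fact k * exp \<bar>y\<bar>) * exp (\<bar>r\<bar> * \<bar>y\<bar>) * exp (y * \<theta>)"
      by (intro mult_mono power_le_fact_exp) (auto intro: mult_right_mono)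
    also have "\<dots> = fact k * exp (y * \<theta> + (1 + \<bar>r\<bar>) * \<bar>y\<bar>)"
      by (simp add: exp_add[symmetric] mult.assoc) (simp add: algebra_simps)
    also have "\<dots> \<le> fact k * (exp (y * (\<theta> + (1 + \<bar>r\<bar>))) + exp (y * (\<theta> - (1 + \<bar>r\<bar>))))"
      by (intro mult_left_mono) (cases "y \<ge> 0"; simp add: algebra_simps)+
    finally show ?thesis .
  qed
  then show "AE y in \<mu>. norm (\<bar>y\<bar> ^ k * exp (r * \<bar>y\<bar>) * exp (y * \<theta>)) \<le>
        norm (fact k * (exp (y * (\<theta> + (1 + \<bar>r\<bar>))) + exp (y * (\<theta> - (1 + \<bar>r\<bar>)))))"
    by (intro AE_I2) (simp add: abs_mult add_pos_pos abs_of_pos)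
qed measurable

lemma integrable_moment: "integrable \<mu> (\<lambda>y. y ^ k * exp (y * \<theta>))"
  by (rule Bochner_Integration.integrable_bound[OF integrable_moment_abs[of k 0 \<theta>]])
     (auto simp: power_abs abs_mult)

lemma has_derivative_moment: "(moment k has_real_derivative moment (Suc k) \<theta>) (at \<theta>)"
  unfolding DERIV_def
proof (rule iffD2[OF tendsto_at_iff_sequentially], intro allI impI)
  fix h :: "nat \<Rightarrow> real"
  assume h: "\<forall>i. h i \<in> UNIV - {0}" and lim: "h \<longlonglongrightarrow> 0"
  let ?g = "\<lambda>i y. (y ^ k * exp (y * (\<theta> + h i)) - y ^ k * exp (y * \<theta>)) / h i"
  have ev: "\<forall>\<^sub>F i in sequentially. \<bar>h i\<bar> < 1"
    using lim[THEN tendstoD, of 1] by (simp add: dist_real_def)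
  then obtain N where N: "\<And>i. i \<ge> N \<Longrightarrow> \<bar>h i\<bar> < 1"
    by (auto simp: eventually_sequentially)
  \<comment> \<open>The majorant is valid only once |h i| < 1, hence the shift by N.\<close>
  have "(\<lambda>i. \<integral>y. ?g (i + N) y \<partial>\<mu>) \<longlonglongrightarrow> (\<integral>y. y ^ Suc k * exp (y * \<theta>) \<partial>\<mu>)"
  proof (rule integral_dominated_convergence)
    show "integrable \<mu> (\<lambda>y. \<bar>y\<bar> ^ Suc k * exp (1 * \<bar>y\<bar>) * exp (y * \<theta>))"
      by (rule integrable_moment_abs)
    show "AE y in \<mu>. (\<lambda>i. ?g (i + N) y) \<longlonglongrightarrow> y ^ Suc k * exp (y * \<theta>)"
    proof (rule AE_I2)
      fix y
      have "((\<lambda>t. y ^ k * exp (y * t)) has_real_derivative y ^ Suc k * exp (y * \<theta>)) (at \<theta>)"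
        by (auto intro!: derivative_eq_intros)
      then have "(\<lambda>i. ?g i y) \<longlonglongrightarrow> y ^ Suc k * exp (y * \<theta>)"
        unfolding DERIV_def tendsto_at_iff_sequentially using h lim by (auto simp: o_def)
      then show "(\<lambda>i. ?g (i + N) y) \<longlonglongrightarrow> y ^ Suc k * exp (y * \<theta>)"
        by (rule LIMSEQ_ignore_initial_segment)
    qed
    show "AE y in \<mu>. norm (?g (i + N) y) \<le> \<bar>y\<bar> ^ Suc k * exp (1 * \<bar>y\<bar>) * exp (y * \<theta>)" for i
    proof (rule AE_I2)
      fix y
      have h0: "h (i + N) \<noteq> 0" and h1: "\<bar>h (i + N)\<bar> < 1" using h N[of "i + N"] by auto
      have "?g (i + N) y = y ^ k * exp (y * \<theta>) * (exp (y * h (i + N)) - 1) / h (i + N)"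
        by (simp add: distrib_left exp_add right_diff_distrib mult.assoc)
      then have "norm (?g (i + N) y) = \<bar>y\<bar> ^ k * exp (y * \<theta>) * \<bar>exp (y * h (i + N)) - 1\<bar> / \<bar>h (i + N)\<bar>"
        by (simp only: real_norm_def abs_mult abs_divide power_abs abs_exp_cancel)
      also have "\<dots> \<le> \<bar>y\<bar> ^ k * exp (y * \<theta>) * (\<bar>y * h (i + N)\<bar> * exp \<bar>y * h (i + N)\<bar>) / \<bar>h (i + N)\<bar>"
        by (intro divide_right_mono mult_left_mono abs_exp_minus_one_le) auto
      also have "\<dots> = \<bar>y\<bar> ^ Suc k * exp (y * \<theta>) * exp \<bar>y * h (i + N)\<bar>"
        using h0 by (simp add: abs_mult field_simps)
      also have "\<dots> \<le> \<bar>y\<bar> ^ Suc k * exp (y * \<theta>) * exp (1 * \<bar>y\<bar>)"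
      proof -
        have "\<bar>y * h (i + N)\<bar> \<le> \<bar>y\<bar> * 1"
          unfolding abs_mult using h1 by (intro mult_left_mono) auto
        then show ?thesis by (intro mult_left_mono) auto
      qed
      finally show "norm (?g (i + N) y) \<le> \<bar>y\<bar> ^ Suc k * exp (1 * \<bar>y\<bar>) * exp (y * \<theta>)"
        by (simp add: mult_ac)
    qed
  qed measurable
  then have "(\<lambda>i. \<integral>y. ?g i y \<partial>\<mu>) \<longlonglongrightarrow> moment (Suc k) \<theta>"
    unfolding moment_def by (rule LIMSEQ_offset)
  moreover have "(\<integral>y. ?g i y \<partial>\<mu>) = (moment k (\<theta> + h i) - moment k \<theta>) / h i" for i
    unfolding moment_def using integrable_moment by (subst Bochner_Integration.integral_diff[symmetric]) auto
  ultimately show "((\<lambda>h. (moment k (\<theta> + h) - moment k \<theta>) / h) \<circ> h) \<longlonglongrightarrow> moment (Suc k) \<theta>"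
    by (simp only: o_def)
qed

lemmas has_derivative_moment' [derivative_intros] = DERIV_chain2[OF has_derivative_moment]

text \<open>The exponential never vanishes, so only the null measure could give 0; for that measure
  y = 0 holds almost everywhere, against \<open>nondegenerate\<close>.\<close>

lemma moment_0_pos: "moment 0 \<theta> > 0"
proof -
  have "\<not> (AE y in \<mu>. exp (y * \<theta>) = 0)"
  proof
    assume "AE y in \<mu>. exp (y * \<theta>) = 0"
    then have "AE y in \<mu>. y = 0" by (rule AE_mp) auto
    then show False using nondegenerate by blast
  qed
  then have "moment 0 \<theta> \<noteq> 0"
    unfolding moment_def using integral_nonneg_eq_0_iff_AE[of \<mu> "\<lambda>y. exp (y * \<theta>)"] exp_integrable
    by simp
  moreover have "moment 0 \<theta> \<ge> 0" unfolding moment_def by (intro integral_nonneg_AE) auto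
  ultimately show ?thesis by simp
qed

lemma cgf_moment: "cgf \<mu> = (\<lambda>\<theta>. ln (moment 0 \<theta>))"
  by (auto simp: cgf_def moment_def)

lemma exp_cgf: "exp (cgf \<mu> \<theta>) = moment 0 \<theta>"
  using moment_0_pos by (simp add: cgf_moment)

text \<open>\<open>cgf'\<close> and \<open>cgf''\<close> are the mean and the variance of the family
  member with parameter \<theta>.\<close>

definition cgf' :: "real \<Rightarrow> real" where
  "cgf' \<theta> = moment 1 \<theta> / moment 0 \<theta>"

definition cgf'' :: "real \<Rightarrow> real" where
  "cgf'' \<theta> = (moment 2 \<theta> * moment 0 \<theta> - (moment 1 \<theta>)\<^sup>2) / (moment 0 \<theta>)\<^sup>2"

abbreviation cgf''' :: "real \<Rightarrow> real" where
  "cgf''' \<equiv> (deriv ^^ 3) (cgf \<mu>)"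

lemma has_derivative_cgf: "(cgf \<mu> has_real_derivative cgf' \<theta>) (at \<theta>)"
  unfolding cgf_moment cgf'_def using moment_0_pos[of \<theta>]
  by (auto intro!: derivative_eq_intros)

lemma has_derivative_cgf': "(cgf' has_real_derivative cgf'' \<theta>) (at \<theta>)"
  unfolding cgf'_def [abs_def] cgf''_def using moment_0_pos[of \<theta>]
  by (auto intro!: derivative_eq_intros simp: numeral_2_eq_2)

text \<open>Later only existence and continuity of the third derivative matter. Its quotient-rule
  formula stays inside this proof, and the witness is identified with the iterated
  \<open>deriv\<close> afterwards.\<close>

lemma has_derivative_cgf''_ex:
  "\<exists>d3. (\<forall>\<theta>. (cgf'' has_real_derivative d3 \<theta>) (at \<theta>)) \<and> continuous_on UNIV d3"
proof -
  have cont: "continuous_on UNIV (moment k)" for k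
    using has_derivative_moment DERIV_isCont by (blast intro: continuous_at_imp_continuous_on)
  have "(cgf'' has_real_derivative
     ((moment 3 \<theta> * moment 0 \<theta> + moment 1 \<theta> * moment 2 \<theta> - 2 * (moment 1 \<theta> * moment 2 \<theta>)) * (moment 0 \<theta>)\<^sup>2
      - (moment 2 \<theta> * moment 0 \<theta> - (moment 1 \<theta>)\<^sup>2) * (2 * (moment 0 \<theta> * moment 1 \<theta>)))
      / ((moment 0 \<theta>)\<^sup>2 * (moment 0 \<theta>)\<^sup>2)) (at \<theta>)" for \<theta>
    unfolding cgf''_def [abs_def] using moment_0_pos[of \<theta>]
    by (rule_tac derivative_eq_intros | simp add: numeral_2_eq_2 numeral_3_eq_3)+
  moreover have "moment 0 \<theta> \<noteq> 0" for \<theta> using moment_0_pos[of \<theta>] by simp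
  ultimately show ?thesis by (intro exI conjI allI) (assumption, intro continuous_intros cont, auto)
qed

lemma deriv_cgf: "deriv (cgf \<mu>) = cgf'" "deriv cgf' = cgf''"
  using has_derivative_cgf has_derivative_cgf' by (auto intro!: DERIV_imp_deriv)

lemma cgf'''_eq: "cgf''' = deriv cgf''"
  by (simp add: numeral_3_eq_3 deriv_cgf)

lemma has_derivative_cgf'': "(cgf'' has_real_derivative cgf''' \<theta>) (at \<theta>)"
  and continuous_cgf''': "continuous_on UNIV cgf'''"
proof -
  obtain d3 where d3: "\<And>\<theta>. (cgf'' has_real_derivative d3 \<theta>) (at \<theta>)" "continuous_on UNIV d3"
    using has_derivative_cgf''_ex by blast
  then have "cgf''' = d3" unfolding cgf'''_eq by (auto intro!: DERIV_imp_deriv)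
  then show "(cgf'' has_real_derivative cgf''' \<theta>) (at \<theta>)" "continuous_on UNIV cgf'''"
    using d3 by auto
qed

lemma continuous_cgf'': "continuous_on A cgf''"
  using has_derivative_cgf'' DERIV_isCont by (blast intro: continuous_at_imp_continuous_on)

lemma continuous_cgf': "continuous_on A cgf'"
  using has_derivative_cgf' DERIV_isCont by (blast intro: continuous_at_imp_continuous_on)

lemma continuous_cgf: "continuous_on A (cgf \<mu>)"
  using has_derivative_cgf DERIV_isCont by (blast intro: continuous_at_imp_continuous_on)

lemma measurable_cgf [measurable]:
  "cgf \<mu> \<in> borel_measurable borel" "cgf' \<in> borel_measurable borel" "cgf'' \<in> borel_measurable borel"
  using continuous_cgf continuous_cgf' continuous_cgf''
  by (auto intro: borel_measurable_continuous_onI)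

text \<open>A variance vanishes only if y equals the mean almost everywhere, which
  \<open>nondegenerate\<close> forbids.\<close>

lemma cgf''_pos: "cgf'' \<theta> > 0"
proof -
  define c where "c = cgf' \<theta>"
  let ?f = "\<lambda>y. (y - c)\<^sup>2 * exp (y * \<theta>)"
  have eq: "?f y = y ^ 2 * exp (y * \<theta>) - 2 * c * (y ^ 1 * exp (y * \<theta>)) + c\<^sup>2 * (y ^ 0 * exp (y * \<theta>))" for y
    by (simp add: power2_eq_square algebra_simps)
  have int: "integrable \<mu> ?f"
    unfolding eq by (intro Bochner_Integration.integrable_add Bochner_Integration.integrable_diff
        integrable_mult_right integrable_moment)
  have "(\<integral>y. ?f y \<partial>\<mu>) = moment 2 \<theta> - 2 * c * moment 1 \<theta> + c\<^sup>2 * moment 0 \<theta>"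
    unfolding eq moment_def using integrable_moment[of 0 \<theta>] integrable_moment[of 1 \<theta>] integrable_moment[of 2 \<theta>]
    by simp
  also have "\<dots> = cgf'' \<theta> * moment 0 \<theta>"
    using moment_0_pos[of \<theta>] by (simp add: c_def cgf'_def cgf''_def field_simps power2_eq_square)
  finally have val: "(\<integral>y. ?f y \<partial>\<mu>) = cgf'' \<theta> * moment 0 \<theta>" .
  have "\<not> (AE y in \<mu>. ?f y = 0)"
  proof
    assume "AE y in \<mu>. ?f y = 0"
    then have "AE y in \<mu>. y = c" by (rule AE_mp) auto
    then show False using nondegenerate by blast
  qed
  then have "(\<integral>y. ?f y \<partial>\<mu>) \<noteq> 0"
    using integral_nonneg_eq_0_iff_AE[OF int] by auto
  moreover have "(\<integral>y. ?f y \<partial>\<mu>) \<ge> 0" by (intro integral_nonneg_AE) auto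
  ultimately show ?thesis using val moment_0_pos[of \<theta>]
    by (metis less_eq_real_def mult_nonpos_nonneg not_le)
qed

text \<open>The Kullback-Leibler divergence between the members at \<theta> and \<theta> + h. In the
  log-likelihood it is what one observation loses beyond the linear term.\<close>

definition bregman :: "real \<Rightarrow> real \<Rightarrow> real" where
  "bregman \<theta> h = cgf \<mu> (\<theta> + h) - cgf \<mu> \<theta> - cgf' \<theta> * h"

lemma bregman_taylor: "\<exists>\<xi>. \<bar>\<xi> - \<theta>\<bar> \<le> \<bar>h\<bar> \<and> bregman \<theta> h = cgf'' \<xi> / 2 * h\<^sup>2"
proof (cases "h = 0")
  case True
  then show ?thesis by (auto simp: bregman_def)
next
  case False
  define diff where "diff = (\<lambda>k::nat. if k = 0 then cgf \<mu> else if k = 1 then cgf' else cgf'')"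
  have "\<exists>t. (if \<theta> + h < \<theta> then \<theta> + h < t \<and> t < \<theta> else \<theta> < t \<and> t < \<theta> + h) \<and>
        cgf \<mu> (\<theta> + h) = (\<Sum>m<2. diff m \<theta> / fact m * (\<theta> + h - \<theta>) ^ m) + diff 2 t / fact 2 * (\<theta> + h - \<theta>) ^ 2"
    using False has_derivative_cgf has_derivative_cgf'
    by (intro Taylor[where a = "\<theta> - \<bar>h\<bar>" and b = "\<theta> + \<bar>h\<bar>"])
       (auto simp: diff_def less_2_cases_iff)
  then obtain t where t: "if h < 0 then \<theta> + h < t \<and> t < \<theta> else \<theta> < t \<and> t < \<theta> + h"
    "cgf \<mu> (\<theta> + h) = (\<Sum>m<2. diff m \<theta> / fact m * h ^ m) + cgf'' t / 2 * h ^ 2"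
    by (auto simp: diff_def)
  then show ?thesis
    by (intro exI[of _ t]) (auto simp: bregman_def diff_def numeral_2_eq_2 split: if_splits)
qed

lemma bregman_nonneg: "bregman \<theta> h \<ge> 0"
  using bregman_taylor[of \<theta> h] cgf''_pos by (metis half_gt_zero less_imp_le mult_nonneg_nonneg zero_le_power2)

lemma cgf_convex: "convex_on UNIV (cgf \<mu>)"
  using has_derivative_cgf has_derivative_cgf' cgf''_pos
  by (intro f''_ge0_imp_convex[where f' = cgf' and f'' = cgf'']) (auto intro: less_imp_le)

text \<open>Convexity along a ray: \<theta> + h is the convex combination of \<theta> and \<theta> +
  s * h with weight 1 / s on the latter. This carries a curvature bound from a sphere to all larger
  distances.\<close>

lemma bregman_scale:
  assumes "s \<ge> 1"
  shows "bregman \<theta> (s * h) \<ge> s * bregman \<theta> h"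
proof -
  have "cgf \<mu> ((1 - 1 / s) *\<^sub>R \<theta> + (1 / s) *\<^sub>R (\<theta> + s * h)) \<le> (1 - 1 / s) * cgf \<mu> \<theta> + 1 / s * cgf \<mu> (\<theta> + s * h)"
    using assms by (intro convex_onD[OF cgf_convex]) auto
  also have "(1 - 1 / s) *\<^sub>R \<theta> + (1 / s) *\<^sub>R (\<theta> + s * h) = \<theta> + h"
    using assms by (simp add: field_simps)
  finally have "s * cgf \<mu> (\<theta> + h) \<le> s * ((1 - 1 / s) * cgf \<mu> \<theta> + 1 / s * cgf \<mu> (\<theta> + s * h))"
    using assms by (intro mult_left_mono) auto
  also have "\<dots> = (s - 1) * cgf \<mu> \<theta> + cgf \<mu> (\<theta> + s * h)"
    using assms by (simp add: field_simps)
  finally show ?thesis by (simp add: bregman_def algebra_simps)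
qed

text \<open>\<open>cgf''\<close> is positive and continuous, so it has a positive minimum on a
  compact interval; the radius T + 1 leaves room for the intermediate point when |h| \<le>
  1.\<close>

lemma bregman_lower:
  assumes "T \<ge> 0"
  obtains c where "c > 0" "\<And>\<theta> h. \<bar>\<theta>\<bar> \<le> T \<Longrightarrow> \<bar>h\<bar> \<le> 1 \<Longrightarrow> bregman \<theta> h \<ge> c * h\<^sup>2"
proof -
  have "\<exists>x\<in>{-(T + 1)..T + 1}. \<forall>y\<in>{-(T + 1)..T + 1}. cgf'' x \<le> cgf'' y"
    using assms by (intro continuous_attains_inf continuous_cgf'') auto
  then obtain x where x: "\<And>y. y \<in> {-(T + 1)..T + 1} \<Longrightarrow> cgf'' x \<le> cgf'' y" by blast
  show ?thesis
  proof (rule that[of "cgf'' x / 2"])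
    show "cgf'' x / 2 > 0" using cgf''_pos[of x] by simp
    fix \<theta> h assume "\<bar>\<theta>\<bar> \<le> T" "\<bar>h\<bar> \<le> (1 :: real)"
    then obtain \<xi> where "\<bar>\<xi> - \<theta>\<bar> \<le> \<bar>h\<bar>" "bregman \<theta> h = cgf'' \<xi> / 2 * h\<^sup>2"
      using bregman_taylor by blast
    moreover have "cgf'' x \<le> cgf'' \<xi>"
      using \<open>\<bar>\<theta>\<bar> \<le> T\<close> \<open>\<bar>h\<bar> \<le> 1\<close> \<open>\<bar>\<xi> - \<theta>\<bar> \<le> \<bar>h\<bar>\<close> by (intro x) auto
    ultimately show "bregman \<theta> h \<ge> cgf'' x / 2 * h\<^sup>2"
      by (simp add: mult_right_mono)
  qed
qed

text \<open>Suprema over symmetric intervals; monotonicity in the radius makes them measurable.\<close>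

definition sup_cgf'' :: "real \<Rightarrow> real" where
  "sup_cgf'' r = (SUP x\<in>{- (\<bar>r\<bar> + 1)..\<bar>r\<bar> + 1}. cgf'' x)"

lemma sup_cgf''_upper: "\<bar>x\<bar> \<le> \<bar>r\<bar> + 1 \<Longrightarrow> cgf'' x \<le> sup_cgf'' r"
  unfolding sup_cgf''_def
  by (intro cSUP_upper bounded_imp_bdd_above compact_imp_bounded compact_continuous_image continuous_cgf'') auto

lemma sup_cgf''_attained: "\<exists>x. \<bar>x\<bar> \<le> \<bar>r\<bar> + 1 \<and> sup_cgf'' r = cgf'' x"
proof -
  have "\<exists>x\<in>{- (\<bar>r\<bar> + 1)..\<bar>r\<bar> + 1}. \<forall>y\<in>{- (\<bar>r\<bar> + 1)..\<bar>r\<bar> + 1}. cgf'' y \<le> cgf'' x"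
    by (intro continuous_attains_sup continuous_cgf'') auto
  then obtain x where x: "x \<in> {- (\<bar>r\<bar> + 1)..\<bar>r\<bar> + 1}" "\<And>y. y \<in> {- (\<bar>r\<bar> + 1)..\<bar>r\<bar> + 1} \<Longrightarrow> cgf'' y \<le> cgf'' x"
    by blast
  have "sup_cgf'' r = cgf'' x"
    unfolding sup_cgf''_def by (rule cSup_eq_maximum) (use x in auto)
  with x(1) show ?thesis by (intro exI[of _ x]) auto
qed

lemma sup_cgf''_pos: "sup_cgf'' r > 0"
  using sup_cgf''_attained[of r] cgf''_pos by metis

lemma sup_cgf''_mono: "\<bar>r\<bar> \<le> \<bar>s\<bar> \<Longrightarrow> sup_cgf'' r \<le> sup_cgf'' s"
  using sup_cgf''_attained[of r] sup_cgf''_upper[of _ s] by force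

text \<open>The 1 in the radius of \<open>sup_cgf''\<close> covers the intermediate Taylor point, at
  distance at most |h| \<le> 1 from \<theta>.\<close>

lemma bregman_upper:
  assumes "\<bar>h\<bar> \<le> 1"
  shows "bregman \<theta> h \<le> sup_cgf'' \<theta> / 2 * h\<^sup>2"
proof -
  obtain \<xi> where "\<bar>\<xi> - \<theta>\<bar> \<le> \<bar>h\<bar>" "bregman \<theta> h = cgf'' \<xi> / 2 * h\<^sup>2"
    using bregman_taylor by blast
  moreover have "cgf'' \<xi> \<le> sup_cgf'' \<theta>"
    using assms \<open>\<bar>\<xi> - \<theta>\<bar> \<le> \<bar>h\<bar>\<close> by (intro sup_cgf''_upper) auto
  ultimately show ?thesis by (simp add: mult_right_mono)
qed

text \<open>Such a function is even and increasing on the nonnegative half-line; composing with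
  \<open>max 0\<close> makes it monotone on the whole line, where monotone functions are known to be
  measurable.\<close>

lemma measurable_abs_mono:
  fixes f :: "real \<Rightarrow> real"
  assumes "\<And>r s. \<bar>r\<bar> \<le> \<bar>s\<bar> \<Longrightarrow> f r \<le> f s"
  shows "f \<in> borel_measurable borel"
proof -
  have "mono (\<lambda>r. f (max 0 r))" by (intro monoI assms) auto
  then have "(\<lambda>r. f (max 0 r)) \<in> borel_measurable borel" by (rule borel_measurable_mono)
  then have "(\<lambda>r. f (max 0 \<bar>r\<bar>)) \<in> borel_measurable borel"
    by (rule measurable_compose_rev) measurable
  moreover have "f (max 0 \<bar>r\<bar>) = f r" for r by (intro antisym assms) auto
  ultimately show ?thesis by simp
qed

lemma measurable_sup_cgf'' [measurable]: "sup_cgf'' \<in> borel_measurable borel"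
  by (intro measurable_abs_mono sup_cgf''_mono)

text \<open>The interval is not enlarged here, so that at argument t * x this matches the supremum
  over |\<theta>| \<le> t * |x| in the moment condition.\<close>

definition sup_cgf''' :: "real \<Rightarrow> real" where
  "sup_cgf''' r = (SUP x\<in>{- \<bar>r\<bar>..\<bar>r\<bar>}. \<bar>cgf''' x\<bar>)"

lemma sup_cgf'''_attained: "\<exists>x. \<bar>x\<bar> \<le> \<bar>r\<bar> \<and> sup_cgf''' r = \<bar>cgf''' x\<bar>"
  and sup_cgf'''_upper: "\<bar>x\<bar> \<le> \<bar>r\<bar> \<Longrightarrow> \<bar>cgf''' x\<bar> \<le> sup_cgf''' r"
proof -
  have "\<exists>x\<in>{- \<bar>r\<bar>..\<bar>r\<bar>}. \<forall>y\<in>{- \<bar>r\<bar>..\<bar>r\<bar>}. \<bar>cgf''' y\<bar> \<le> \<bar>cgf''' x\<bar>"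
    by (intro continuous_attains_sup continuous_intros continuous_on_subset[OF continuous_cgf''']) auto
  then obtain x where x: "x \<in> {- \<bar>r\<bar>..\<bar>r\<bar>}" "\<And>y. y \<in> {- \<bar>r\<bar>..\<bar>r\<bar>} \<Longrightarrow> \<bar>cgf''' y\<bar> \<le> \<bar>cgf''' x\<bar>"
    by blast
  have eq: "sup_cgf''' r = \<bar>cgf''' x\<bar>"
    unfolding sup_cgf'''_def by (rule cSup_eq_maximum) (use x in auto)
  with x(1) show "\<exists>x. \<bar>x\<bar> \<le> \<bar>r\<bar> \<and> sup_cgf''' r = \<bar>cgf''' x\<bar>" by (intro exI[of _ x]) auto
  show "\<bar>x\<bar> \<le> \<bar>r\<bar> \<Longrightarrow> \<bar>cgf''' x\<bar> \<le> sup_cgf''' r" for x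
    unfolding eq by (rule x(2)) auto
qed

lemma sup_cgf'''_mono: "\<bar>r\<bar> \<le> \<bar>s\<bar> \<Longrightarrow> sup_cgf''' r \<le> sup_cgf''' s"
  using sup_cgf'''_attained[of r] sup_cgf'''_upper[of _ s] by force

lemma sup_cgf'''_nonneg: "sup_cgf''' r \<ge> 0"
  using sup_cgf'''_attained[of r] by force

lemma measurable_sup_cgf''' [measurable]: "sup_cgf''' \<in> borel_measurable borel"
  by (intro measurable_abs_mono sup_cgf'''_mono)

text \<open>The moment condition speaks about the third derivative only, whereas the curvature
  involves the second. The mean value theorem from 0 connects them; for |r| > 1 the radius |r| + 1
  is at most 2 * |r|, and for |r| \<le> 1 monotonicity suffices.\<close>

lemma sup_cgf''_le: "sup_cgf'' r \<le> sup_cgf'' 1 + 2 * \<bar>r\<bar> * sup_cgf''' (2 * r)"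
proof (cases "\<bar>r\<bar> \<le> 1")
  case True
  then have "sup_cgf'' r \<le> sup_cgf'' 1" by (intro sup_cgf''_mono) auto
  then show ?thesis using sup_cgf'''_nonneg[of "2 * r"] by (smt (verit) mult_nonneg_nonneg abs_ge_zero)
next
  case False
  obtain x where x: "\<bar>x\<bar> \<le> \<bar>r\<bar> + 1" "sup_cgf'' r = cgf'' x" using sup_cgf''_attained by blast
  have "cgf'' x - cgf'' 0 \<le> \<bar>x\<bar> * sup_cgf''' (2 * r)"
  proof (cases "x = 0")
    case False
    then obtain z where z: "\<bar>z\<bar> \<le> \<bar>x\<bar>" "cgf'' x - cgf'' 0 = x * cgf''' z"
    proof (cases "x > 0")
      case True
      then obtain z where "0 < z" "z < x" "cgf'' x - cgf'' 0 = (x - 0) * cgf''' z"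
        using MVT2[of 0 x cgf'' cgf'''] has_derivative_cgf'' by blast
      then show thesis by (intro that[of z]) auto
    next
      assume neg: "\<not> x > 0"
      then obtain z where "x < z" "z < 0" "cgf'' 0 - cgf'' x = (0 - x) * cgf''' z"
        using MVT2[of x 0 cgf'' cgf'''] has_derivative_cgf'' False by force
      then show thesis by (intro that[of z]) auto
    qed
    have "x * cgf''' z \<le> \<bar>x\<bar> * \<bar>cgf''' z\<bar>" by (metis abs_ge_self abs_mult)
    also have "\<dots> \<le> \<bar>x\<bar> * sup_cgf''' (2 * r)"
      using z(1) x(1) \<open>\<not> \<bar>r\<bar> \<le> 1\<close> by (intro mult_left_mono sup_cgf'''_upper) auto
    finally show ?thesis using z by simp
  qed simp
  moreover have "cgf'' 0 \<le> sup_cgf'' 1" by (rule sup_cgf''_upper) simp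
  moreover have "\<bar>x\<bar> * sup_cgf''' (2 * r) \<le> 2 * \<bar>r\<bar> * sup_cgf''' (2 * r)"
    using x(1) False by (intro mult_right_mono sup_cgf'''_nonneg) auto
  ultimately show ?thesis using x by linarith
qed

end

section \<open>Joint law of covariates and responses\<close>

(* keeps {1..n} from turning into {Suc 0..n} *)
declare One_nat_def [simp del]

abbreviation covariate_space :: "nat \<Rightarrow> nat \<Rightarrow> (nat \<Rightarrow> nat \<Rightarrow> real) measure" where
  "covariate_space n p \<equiv> PiM {1..n} (\<lambda>_. PiM {1..p} (\<lambda>_. borel))"

abbreviation response_space :: "nat \<Rightarrow> (nat \<Rightarrow> real) measure" where
  "response_space n \<equiv> PiM {1..n} (\<lambda>_. borel)"

lemma measurable_entry:
  assumes "i \<in> {1..n}" "j \<in> {1..p}"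
  shows "(\<lambda>x. x i j) \<in> borel_measurable (covariate_space n p)"
  using measurable_comp[OF measurable_component_singleton[OF assms(1)] measurable_component_singleton[OF assms(2)]]
  by (simp add: o_def)

lemma measurable_dot_row:
  assumes "i \<in> {1..n}"
  shows "(\<lambda>x. dot p (x i) \<phi>) \<in> borel_measurable (covariate_space n p)"
  unfolding dot_def using assms by (intro borel_measurable_sum borel_measurable_times measurable_entry) auto

lemma measurable_response:
  assumes "i \<in> {1..n}"
  shows "(\<lambda>y. y i) \<in> borel_measurable (response_space n)"
  using assms by (rule measurable_component_singleton)

lemma dot_add: "dot p x (\<lambda>j. \<phi> j + \<psi> j) = dot p x \<phi> + dot p x \<psi>"
  by (simp add: dot_def distrib_left sum.distrib)

lemma dot_scale: "dot p x (\<lambda>j. s * \<phi> j) = s * dot p x \<phi>"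
  by (simp add: dot_def sum_distrib_left mult.left_commute)

lemma likelihood_prod:
  "likelihood b n p x y \<phi> = (\<Prod>i\<in>{1..n}. exp (y i * dot p (x i) \<phi> - b (dot p (x i) \<phi>)))"
  by (simp add: likelihood_def exp_sum)

lemma likelihood_pos: "likelihood b n p x y \<phi> > 0"
  by (simp add: likelihood_def)

lemma (in exponential_family) measurable_likelihood:
  "(\<lambda>(x, y). likelihood (cgf \<mu>) n p x y \<phi>) \<in> borel_measurable (covariate_space n p \<Otimes>\<^sub>M response_space n)"
proof -
  have "(\<lambda>z. snd z i * dot p (fst z i) \<phi> - cgf \<mu> (dot p (fst z i) \<phi>))
     \<in> borel_measurable (covariate_space n p \<Otimes>\<^sub>M response_space n)" if i: "i \<in> {1..n}" for i
    using measurable_compose[OF measurable_fst measurable_dot_row[OF i]]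
      measurable_compose[OF measurable_snd measurable_response[OF i]]
    by measurable
  then show ?thesis unfolding likelihood_def case_prod_beta by measurable
qed

section \<open>The likelihood as a density with respect to the product of base measures\<close>

context exponential_family
begin

lemma nn_integral_expfam_density: "(\<integral>\<^sup>+y. ennreal (exp (y * \<theta> - cgf \<mu> \<theta>)) \<partial>\<mu>) = 1"
proof -
  have "(\<integral>\<^sup>+y. ennreal (exp (y * \<theta> - cgf \<mu> \<theta>)) \<partial>\<mu>) = (\<integral>y. exp (y * \<theta>) / moment 0 \<theta> \<partial>\<mu>)"
    using exp_integrable[of \<theta>] moment_0_pos[of \<theta>]
    by (subst nn_integral_eq_integral[symmetric]) (auto simp: exp_diff exp_cgf)
  also have "\<dots> = 1" using moment_0_pos[of \<theta>] by (simp add: moment_def)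
  finally show ?thesis by simp
qed

lemma sets_expfam [simp, measurable_cong]: "sets (expfam \<mu> \<theta>) = sets borel"
  by (simp add: expfam_def sets_base)

lemma prob_space_expfam: "prob_space (expfam \<mu> \<theta>)"
proof
  show "emeasure (expfam \<mu> \<theta>) (space (expfam \<mu> \<theta>)) = 1"
    unfolding expfam_def by (subst emeasure_density) (auto simp: nn_integral_expfam_density)
qed

sublocale base: product_sigma_finite "\<lambda>_ :: nat. \<mu>"
proof -
  interpret finite_measure \<mu> by (rule finite_measure_base)
  show "product_sigma_finite (\<lambda>_ :: nat. \<mu>)" by unfold_locales
qed

lemma sets_PiM_base [measurable_cong]: "sets (PiM I (\<lambda>_. \<mu>)) = sets (PiM I (\<lambda>_. borel))"
  by (intro sets_PiM_cong refl sets_base)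

lemma finite_measure_PiM_base: "finite_measure (PiM {1..n :: nat} (\<lambda>_. \<mu>))"
proof
  interpret finite_measure \<mu> by (rule finite_measure_base)
  have "emeasure (PiM {1..n} (\<lambda>_. \<mu>)) (PiE {1..n} (\<lambda>_. UNIV)) = (\<Prod>i\<in>{1..n}. emeasure \<mu> UNIV)"
    by (subst base.emeasure_PiM) (auto simp: sets_base)
  also have "\<dots> \<noteq> \<infinity>" using emeasure_finite[of UNIV] by (auto simp: power_eq_top_ennreal)
  finally show "emeasure (PiM {1..n} (\<lambda>_. \<mu>)) (space (PiM {1..n} (\<lambda>_. \<mu>))) \<noteq> \<infinity>"
    by (simp add: space_PiM)
qed

text \<open>For fixed covariates the likelihood is a product over the observations, so the integral
  over a finite product measure factorises into probabilities under \<open>expfam\<close>.\<close>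

lemma nn_integral_likelihood_rectangle:
  assumes S: "\<And>i. i \<in> {1..n} \<Longrightarrow> S i \<in> sets borel"
  shows "(\<integral>\<^sup>+y. indicator (PiE {1..n} S) y * ennreal (likelihood (cgf \<mu>) n p x y \<phi>) \<partial>PiM {1..n} (\<lambda>_. \<mu>))
       = ennreal (\<Prod>i\<in>{1..n}. measure (expfam \<mu> (dot p (x i) \<phi>)) (S i))"
proof -
  have "(\<integral>\<^sup>+y. indicator (PiE {1..n} S) y * ennreal (likelihood (cgf \<mu>) n p x y \<phi>) \<partial>PiM {1..n} (\<lambda>_. \<mu>))
      = (\<integral>\<^sup>+y. (\<Prod>i\<in>{1..n}. indicator (S i) (y i) *
            ennreal (exp (y i * dot p (x i) \<phi> - cgf \<mu> (dot p (x i) \<phi>)))) \<partial>PiM {1..n} (\<lambda>_. \<mu>))"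
  proof (intro nn_integral_cong)
    fix y assume "y \<in> space (PiM {1..n} (\<lambda>_. \<mu>))"
    then have "indicator (PiE {1..n} S) y = (\<Prod>i\<in>{1..n}. indicator (S i) (y i) :: ennreal)"
      by (auto simp: indicator_def space_PiM PiE_iff prod_zero_iff extensional_def)
    then show "indicator (PiE {1..n} S) y * ennreal (likelihood (cgf \<mu>) n p x y \<phi>)
       = (\<Prod>i\<in>{1..n}. indicator (S i) (y i) * ennreal (exp (y i * dot p (x i) \<phi> - cgf \<mu> (dot p (x i) \<phi>))))"
      by (simp add: likelihood_prod prod.distrib prod_ennreal)
  qed
  also have "\<dots> = (\<Prod>i\<in>{1..n}. \<integral>\<^sup>+y. indicator (S i) y *
            ennreal (exp (y * dot p (x i) \<phi> - cgf \<mu> (dot p (x i) \<phi>))) \<partial>\<mu>)"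
  proof (intro base.product_nn_integral_prod)
    fix i assume "i \<in> {1..n}"
    note [measurable] = S[OF this]
    show "(\<lambda>y. indicator (S i) y * ennreal (exp (y * dot p (x i) \<phi> - cgf \<mu> (dot p (x i) \<phi>)))) \<in> borel_measurable \<mu>"
      by measurable
  qed simp
  also have "\<dots> = (\<Prod>i\<in>{1..n}. ennreal (measure (expfam \<mu> (dot p (x i) \<phi>)) (S i)))"
  proof (intro prod.cong refl)
    fix i assume i: "i \<in> {1..n}"
    interpret E: prob_space "expfam \<mu> (dot p (x i) \<phi>)" by (rule prob_space_expfam)
    have "emeasure (expfam \<mu> (dot p (x i) \<phi>)) (S i) = (\<integral>\<^sup>+y. indicator (S i) y *
            ennreal (exp (y * dot p (x i) \<phi> - cgf \<mu> (dot p (x i) \<phi>))) \<partial>\<mu>)"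
      unfolding expfam_def using S[OF i] by (subst emeasure_density) (auto simp: sets_base mult.commute)
    then show "(\<integral>\<^sup>+y. indicator (S i) y * ennreal (exp (y * dot p (x i) \<phi> - cgf \<mu> (dot p (x i) \<phi>))) \<partial>\<mu>)
       = ennreal (measure (expfam \<mu> (dot p (x i) \<phi>)) (S i))"
      by (simp add: E.emeasure_eq_measure)
  qed
  also have "\<dots> = ennreal (\<Prod>i\<in>{1..n}. measure (expfam \<mu> (dot p (x i) \<phi>)) (S i))"
    by (simp add: prod_ennreal)
  finally show ?thesis .
qed

lemma nn_integral_likelihood:
  "(\<integral>\<^sup>+y. ennreal (likelihood (cgf \<mu>) n p x y \<phi>) \<partial>PiM {1..n} (\<lambda>_. \<mu>)) = 1"
proof -
  have "(\<integral>\<^sup>+y. ennreal (likelihood (cgf \<mu>) n p x y \<phi>) \<partial>PiM {1..n} (\<lambda>_. \<mu>)) =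
    (\<integral>\<^sup>+y. indicator (PiE {1..n} (\<lambda>_. UNIV)) y * ennreal (likelihood (cgf \<mu>) n p x y \<phi>) \<partial>PiM {1..n} (\<lambda>_. \<mu>))"
    by (intro nn_integral_cong) (auto simp: indicator_def space_PiM)
  also have "\<dots> = ennreal (\<Prod>i\<in>{1..n}. measure (expfam \<mu> (dot p (x i) \<phi>)) UNIV)"
    by (intro nn_integral_likelihood_rectangle) auto
  also have "\<dots> = 1"
  proof -
    have "measure (expfam \<mu> \<theta>) UNIV = 1" for \<theta>
      using prob_space.prob_space[OF prob_space_expfam[of \<theta>]] sets_eq_imp_space_eq[OF sets_expfam] by simp
    then show ?thesis by simp
  qed
  finally show ?thesis .
qed

end

section \<open>Joint distribution of the data and the change of measure\<close>

context glm_sequence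
begin

text \<open>Restricted to the index sets so that its values are points of the product space. The
  likelihood reads only these entries, which is \<open>likelihood_cov_matrix\<close>.\<close>

definition cov_matrix :: "nat \<Rightarrow> 'w \<Rightarrow> nat \<Rightarrow> nat \<Rightarrow> real" where
  "cov_matrix n \<omega> = (\<lambda>i\<in>{1..n}. covariate_row X p n i \<omega>)"

definition responses :: "nat \<Rightarrow> 'w \<Rightarrow> nat \<Rightarrow> real" where
  "responses n \<omega> = (\<lambda>i\<in>{1..n}. Y n i \<omega>)"

lemma measurable_row: "n \<ge> 1 \<Longrightarrow> i \<in> {1..n} \<Longrightarrow>
    covariate_row X p n i \<in> measurable (M n) (PiM {1..p n} (\<lambda>_. borel))"
  using rows_indep[of n] by (simp add: prob_space.indep_vars_def2[OF prob])

lemma measurable_cov_matrix: "n \<ge> 1 \<Longrightarrow> cov_matrix n \<in> measurable (M n) (covariate_space n (p n))"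
  unfolding cov_matrix_def [abs_def] by (intro measurable_restrict measurable_row)

lemma measurable_responses: "n \<ge> 1 \<Longrightarrow> responses n \<in> measurable (M n) (response_space n)"
  unfolding responses_def [abs_def] by (intro measurable_restrict Y_measurable)

lemma measurable_X: "n \<ge> 1 \<Longrightarrow> i \<in> {1..n} \<Longrightarrow> j \<in> {1..p n} \<Longrightarrow> X n i j \<in> borel_measurable (M n)"
  using measurable_comp[OF measurable_row[of n i] measurable_component_singleton[of j "{1..p n}" "\<lambda>_. borel"]]
  by (simp add: o_def covariate_row_def)

lemma cov_matrix_entry: "i \<in> {1..n} \<Longrightarrow> j \<in> {1..p n} \<Longrightarrow> cov_matrix n \<omega> i j = X n i j \<omega>"
  by (simp add: cov_matrix_def covariate_row_def)

lemma dot_cov_matrix: "i \<in> {1..n} \<Longrightarrow> dot (p n) (cov_matrix n \<omega> i) \<phi> = dot (p n) (\<lambda>j. X n i j \<omega>) \<phi>"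
  by (simp add: dot_def cov_matrix_entry)

lemma likelihood_cov_matrix:
  "likelihood b n (p n) (\<lambda>i j. X n i j \<omega>) (\<lambda>i. Y n i \<omega>) \<phi>
   = likelihood b n (p n) (cov_matrix n \<omega>) (responses n \<omega>) \<phi>"
  by (simp add: likelihood_def dot_cov_matrix responses_def)

definition cov_law :: "nat \<Rightarrow> (nat \<Rightarrow> nat \<Rightarrow> real) measure" where
  "cov_law n = distr (M n) (covariate_space n (p n)) (cov_matrix n)"

lemma sets_cov_law [measurable_cong]: "sets (cov_law n) = sets (covariate_space n (p n))"
  by (simp add: cov_law_def)

lemma covariate_algebra_eq:
  "covariate_algebra M X p n = vimage_algebra (space (M n)) (cov_matrix n) (covariate_space n (p n))"
  by (simp add: covariate_algebra_def cov_matrix_def [abs_def])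

lemma subalgebra_covariates: "n \<ge> 1 \<Longrightarrow> subalgebra (M n) (covariate_algebra M X p n)"
  unfolding subalgebra_def covariate_algebra_eq
  using sets_image_in_sets[OF refl measurable_cov_matrix] by simp

text \<open>The defining property of conditional expectation, tested on the event that the
  covariates lie in A. This event belongs to the covariate algebra, so the indicator of the
  responses may be replaced by its conditional probability.\<close>

lemma joint_law_rectangle:
  assumes n: "n \<ge> 1" and A: "A \<in> sets (covariate_space n (p n))"
    and S: "\<And>i. i \<in> {1..n} \<Longrightarrow> S i \<in> sets borel"
  shows "emeasure (M n) {\<omega> \<in> space (M n). cov_matrix n \<omega> \<in> A \<and> responses n \<omega> \<in> PiE {1..n} S}
    = (\<integral>\<^sup>+\<omega>. indicator A (cov_matrix n \<omega>) *
          ennreal (\<Prod>i\<in>{1..n}. measure (expfam \<mu> (dot (p n) (cov_matrix n \<omega> i) (\<phi>s n))) (S i)) \<partial>M n)"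
proof -
  interpret prob_space "M n" by (rule prob[OF n])
  interpret finite_measure_subalgebra "M n" "covariate_algebra M X p n"
    by unfold_locales (rule subalgebra_covariates[OF n])
  define f where "f = indicat_real {\<omega> \<in> space (M n). \<forall>i\<in>{1..n}. Y n i \<omega> \<in> S i}"
  define A' where "A' = cov_matrix n -` A \<inter> space (M n)"
  define g where "g = (\<lambda>\<omega>. \<Prod>i\<in>{1..n}. measure (expfam \<mu> (dot (p n) (cov_matrix n \<omega> i) (\<phi>s n))) (S i))"
  note [measurable] = measurable_cov_matrix[OF n] measurable_responses[OF n]
  have mE: "{\<omega> \<in> space (M n). \<forall>i\<in>{1..n}. Y n i \<omega> \<in> S i} \<in> sets (M n)"
    using Y_measurable[OF n] S by measurable
  have A': "A' \<in> sets (covariate_algebra M X p n)"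
    unfolding A'_def covariate_algebra_eq using A by (rule in_vimage_algebra)
  then have A'M: "A' \<in> sets (M n)" using subalgebra_covariates[OF n] unfolding subalgebra_def by blast
  have fint: "integrable (M n) f" unfolding f_def using mE by (intro integrable_real_indicator) (auto simp: emeasure_eq_measure)
  have ae: "AE \<omega> in M n. real_cond_exp (M n) (covariate_algebra M X p n) f \<omega> = g \<omega>"
    using Y_conditional_law[OF n S] unfolding f_def g_def by (simp add: dot_cov_matrix)
  have g0: "0 \<le> g \<omega>" for \<omega> unfolding g_def by (intro prod_nonneg) auto
  have gint: "integrable (M n) (\<lambda>\<omega>. indicat_real A' \<omega> * real_cond_exp (M n) (covariate_algebra M X p n) f \<omega>)"
    using integrable_real_mult_indicator[OF A'M real_cond_exp_int(1)[OF fint]] by (simp add: mult.commute)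
  have "emeasure (M n) {\<omega> \<in> space (M n). cov_matrix n \<omega> \<in> A \<and> responses n \<omega> \<in> PiE {1..n} S}
      = (\<integral>\<^sup>+\<omega>. ennreal (indicat_real A' \<omega> * f \<omega>) \<partial>M n)"
  proof -
    have eq: "{\<omega> \<in> space (M n). cov_matrix n \<omega> \<in> A \<and> responses n \<omega> \<in> PiE {1..n} S}
       = A' \<inter> {\<omega> \<in> space (M n). \<forall>i\<in>{1..n}. Y n i \<omega> \<in> S i}"
      by (auto simp: A'_def responses_def PiE_iff)
    have "(\<integral>\<^sup>+\<omega>. ennreal (indicat_real A' \<omega> * f \<omega>) \<partial>M n)
        = (\<integral>\<^sup>+\<omega>. indicator (A' \<inter> {\<omega> \<in> space (M n). \<forall>i\<in>{1..n}. Y n i \<omega> \<in> S i}) \<omega> \<partial>M n)"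
      by (intro nn_integral_cong) (auto simp: f_def indicator_def)
    then show ?thesis unfolding eq using A'M mE by (simp add: nn_integral_indicator)
  qed
  also have "\<dots> = ennreal (\<integral>\<omega>. indicat_real A' \<omega> * f \<omega> \<partial>M n)"
  proof (rule nn_integral_eq_integral)
    show "integrable (M n) (\<lambda>\<omega>. indicat_real A' \<omega> * f \<omega>)"
      using integrable_real_mult_indicator[OF A'M fint] by (simp add: mult.commute)
  qed (simp add: f_def)
  also have "(\<integral>\<omega>. indicat_real A' \<omega> * f \<omega> \<partial>M n)
      = (\<integral>\<omega>. indicat_real A' \<omega> * real_cond_exp (M n) (covariate_algebra M X p n) f \<omega> \<partial>M n)"
    using real_cond_exp_intA[OF fint A'] by (simp add: set_lebesgue_integral_def)
  also have "ennreal \<dots> = (\<integral>\<^sup>+\<omega>. ennreal (indicat_real A' \<omega> * real_cond_exp (M n) (covariate_algebra M X p n) f \<omega>) \<partial>M n)"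
    using ae g0 by (intro nn_integral_eq_integral[symmetric] gint) (auto elim!: eventually_mono)
  also have "\<dots> = (\<integral>\<^sup>+\<omega>. indicator A (cov_matrix n \<omega>) * ennreal (g \<omega>) \<partial>M n)"
  proof (rule nn_integral_cong_AE)
    show "AE \<omega> in M n. ennreal (indicat_real A' \<omega> * real_cond_exp (M n) (covariate_algebra M X p n) f \<omega>)
       = indicator A (cov_matrix n \<omega>) * ennreal (g \<omega>)"
      using ae AE_space by eventually_elim (auto simp: A'_def indicator_def)
  qed
  finally show ?thesis unfolding g_def .
qed

text \<open>The two sides are known to agree on A times a rectangle of responses. The extension has
  two stages: for fixed A from rectangles to all measurable sets of responses, then from products A
  \<times> D, an intersection-stable generator, to the product algebra.\<close>

theorem joint_law:
  assumes n: "n \<ge> 1"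
  shows "distr (M n) (covariate_space n (p n) \<Otimes>\<^sub>M response_space n) (\<lambda>\<omega>. (cov_matrix n \<omega>, responses n \<omega>))
    = density (cov_law n \<Otimes>\<^sub>M PiM {1..n} (\<lambda>_. \<mu>))
        (\<lambda>(x, y). ennreal (likelihood (cgf \<mu>) n (p n) x y (\<phi>s n)))" (is "?P = ?Q")
proof -
  interpret prob_space "M n" by (rule prob[OF n])
  interpret B: finite_measure "PiM {1..n} (\<lambda>_. \<mu>)" by (rule finite_measure_PiM_base)
  note [measurable] = measurable_cov_matrix[OF n] measurable_responses[OF n] measurable_likelihood
  let ?C = "covariate_space n (p n)" and ?R = "response_space n"
  have sQ: "sets (cov_law n \<Otimes>\<^sub>M PiM {1..n} (\<lambda>_. \<mu>)) = sets (?C \<Otimes>\<^sub>M ?R)"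
    by (intro sets_pair_measure_cong sets_cov_law sets_PiM_base)
  have lik [measurable]: "(\<lambda>(x, y). ennreal (likelihood (cgf \<mu>) n (p n) x y \<phi>))
       \<in> borel_measurable (cov_law n \<Otimes>\<^sub>M PiM {1..n} (\<lambda>_. \<mu>))" for \<phi>
    using measurable_likelihood[of n "p n" \<phi>] unfolding measurable_cong_sets[OF sQ refl]
    by (simp add: case_prod_beta)
  have Qval: "emeasure ?Q (A \<times> D) = (\<integral>\<^sup>+\<omega>. indicator A (cov_matrix n \<omega>) *
      (\<integral>\<^sup>+y. indicator D y * ennreal (likelihood (cgf \<mu>) n (p n) (cov_matrix n \<omega>) y (\<phi>s n)) \<partial>PiM {1..n} (\<lambda>_. \<mu>)) \<partial>M n)"
    if A: "A \<in> sets ?C" and D: "D \<in> sets ?R" for A D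
  proof -
    have AD: "A \<times> D \<in> sets (cov_law n \<Otimes>\<^sub>M PiM {1..n} (\<lambda>_. \<mu>))" unfolding sQ using A D by auto
    have h: "(\<lambda>x. indicator D (snd x) * ennreal (likelihood (cgf \<mu>) n (p n) (fst x) (snd x) (\<phi>s n)))
        \<in> borel_measurable (?C \<Otimes>\<^sub>M PiM {1..n} (\<lambda>_. \<mu>))"
    proof -
      note [measurable] = D
      have "(\<lambda>x. indicator D (snd x) * ennreal (likelihood (cgf \<mu>) n (p n) (fst x) (snd x) (\<phi>s n)))
        \<in> borel_measurable (?C \<Otimes>\<^sub>M ?R)"
        using measurable_likelihood[of n "p n" "\<phi>s n"] unfolding case_prod_beta by measurable
      then show ?thesis
        unfolding measurable_cong_sets[OF sets_pair_measure_cong[OF refl sets_PiM_base[of "{1..n}"]] refl] .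
    qed
    have "emeasure ?Q (A \<times> D) = (\<integral>\<^sup>+z. (case z of (x, y) \<Rightarrow> ennreal (likelihood (cgf \<mu>) n (p n) x y (\<phi>s n)))
        * indicator (A \<times> D) z \<partial>(cov_law n \<Otimes>\<^sub>M PiM {1..n} (\<lambda>_. \<mu>)))"
      by (rule emeasure_density[OF lik AD])
    also have "\<dots> = (\<integral>\<^sup>+x. \<integral>\<^sup>+y. (case (x, y) of (x, y) \<Rightarrow> ennreal (likelihood (cgf \<mu>) n (p n) x y (\<phi>s n)))
        * indicator (A \<times> D) (x, y) \<partial>PiM {1..n} (\<lambda>_. \<mu>) \<partial>cov_law n)"
      by (intro B.nn_integral_fst[symmetric] borel_measurable_times_ennreal lik borel_measurable_indicator AD)
    also have "\<dots> = (\<integral>\<^sup>+x. indicator A x * (\<integral>\<^sup>+y. indicator D y *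
        ennreal (likelihood (cgf \<mu>) n (p n) x y (\<phi>s n)) \<partial>PiM {1..n} (\<lambda>_. \<mu>)) \<partial>cov_law n)"
      by (intro nn_integral_cong) (auto simp: indicator_def mult.commute intro!: nn_integral_cong)
    also have "\<dots> = (\<integral>\<^sup>+\<omega>. indicator A (cov_matrix n \<omega>) *
      (\<integral>\<^sup>+y. indicator D y * ennreal (likelihood (cgf \<mu>) n (p n) (cov_matrix n \<omega>) y (\<phi>s n)) \<partial>PiM {1..n} (\<lambda>_. \<mu>)) \<partial>M n)"
      unfolding cov_law_def using A B.borel_measurable_nn_integral_fst[OF h]
      by (subst nn_integral_distr) auto
    finally show ?thesis .
  qed
  have Pval: "emeasure ?P (A \<times> D) = emeasure (M n) {\<omega> \<in> space (M n). cov_matrix n \<omega> \<in> A \<and> responses n \<omega> \<in> D}"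
    if "A \<in> sets ?C" "D \<in> sets ?R" for A D
    using that by (subst emeasure_distr) (auto intro!: arg_cong[where f = "emeasure (M n)"])
  have rect: "emeasure ?P (A \<times> D) = emeasure ?Q (A \<times> D)" if A: "A \<in> sets ?C" and D: "D \<in> sets ?R" for A D
  proof -
    \<comment> \<open>Restricting to A and projecting to the responses gives finite measures on the
      response space alone, where equality on rectangles determines a measure.\<close>
    let ?P' = "distr (restrict_space ?P (A \<times> space ?R)) ?R snd"
    let ?Q' = "distr (restrict_space ?Q (A \<times> space ?R)) ?R snd"
    have AR: "A \<times> space ?R \<in> sets ?P" "A \<times> space ?R \<in> sets ?Q" using A sQ by auto
    have sndP: "snd \<in> measurable (restrict_space ?P (A \<times> space ?R)) ?R"
      by (intro measurable_restrict_space1) simp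
    have sndQ: "snd \<in> measurable (restrict_space ?Q (A \<times> space ?R)) ?R"
      by (intro measurable_restrict_space1)
        (simp add: measurable_cong_sets[OF sQ refl])
    have spP: "space ?P = space ?C \<times> space ?R" "space ?Q = space ?C \<times> space ?R"
      using sets_eq_imp_space_eq[OF sQ] by (auto simp: space_pair_measure)
    have P': "emeasure ?P' D = emeasure ?P (A \<times> D)" if D: "D \<in> sets ?R" for D
    proof -
      have "emeasure ?P' D = emeasure (restrict_space ?P (A \<times> space ?R)) (A \<times> D)"
        using sets.sets_into_space[OF D] sets.sets_into_space[OF A] D
        by (subst emeasure_distr[OF sndP]) (auto simp: space_restrict_space space_pair_measure sets_eq_imp_space_eq[OF sets_cov_law] sets_eq_imp_space_eq[OF sets_PiM_base] intro!: arg_cong2[where f = emeasure])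
      also have "\<dots> = emeasure ?P (A \<times> D)"
        using AR sets.sets_into_space[OF D] by (intro emeasure_restrict_space) auto
      finally show ?thesis .
    qed
    have Q': "emeasure ?Q' D = emeasure ?Q (A \<times> D)" if D: "D \<in> sets ?R" for D
    proof -
      have "emeasure ?Q' D = emeasure (restrict_space ?Q (A \<times> space ?R)) (A \<times> D)"
        using sets.sets_into_space[OF D] sets.sets_into_space[OF A] D
        by (subst emeasure_distr[OF sndQ]) (auto simp: space_restrict_space space_pair_measure sets_eq_imp_space_eq[OF sets_cov_law] sets_eq_imp_space_eq[OF sets_PiM_base] intro!: arg_cong2[where f = emeasure])
      also have "\<dots> = emeasure ?Q (A \<times> D)"
        using AR sets.sets_into_space[OF D] by (intro emeasure_restrict_space) auto
      finally show ?thesis .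
    qed
    have "?P' = ?Q'"
    proof (rule measure_eqI_PiM_finite[where I = "{1..n}" and A = "\<lambda>_. space ?R"])
      show "emeasure ?P' (PiE {1..n} S) = emeasure ?Q' (PiE {1..n} S)"
        if S: "\<And>i. i \<in> {1..n} \<Longrightarrow> S i \<in> sets borel" for S
      proof -
        have SE: "PiE {1..n} S \<in> sets ?R" using S by (intro sets_PiM_I_finite) auto
        show ?thesis
          unfolding P'[OF SE] Q'[OF SE] Pval[OF A SE] Qval[OF A SE]
          by (simp only: joint_law_rectangle[OF n A, where S = S] nn_integral_likelihood_rectangle[where S = S] S)
      qed
      show "emeasure ?P' (space ?R) \<noteq> \<infinity>" for i :: nat
        unfolding P'[OF sets.top] by (subst Pval[OF A sets.top]) simp
      show "range (\<lambda>_. space ?R) \<subseteq> prod_algebra {1..n} (\<lambda>_. borel)"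
        using prod_algebraI_finite[of "{1..n}" "\<lambda>_. UNIV" "\<lambda>_. borel :: real measure"] by (auto simp: space_PiM)
    qed auto
    then show ?thesis using P'[OF D] Q'[OF D] by simp
  qed
  show ?thesis
  proof (rule measure_eqI_generator_eq[OF Int_stable_pair_measure_generator[of ?C ?R], where \<Omega> = "space ?C \<times> space ?R"
        and A = "\<lambda>_. space ?C \<times> space ?R"])
    show "emeasure ?P Z = emeasure ?Q Z" if "Z \<in> {a \<times> b |a b. a \<in> sets ?C \<and> b \<in> sets ?R}" for Z
      using that rect by auto
    show "sets ?P = sigma_sets (space ?C \<times> space ?R) {a \<times> b |a b. a \<in> sets ?C \<and> b \<in> sets ?R}"
      by (simp add: sets_pair_measure)
    show "sets ?Q = sigma_sets (space ?C \<times> space ?R) {a \<times> b |a b. a \<in> sets ?C \<and> b \<in> sets ?R}"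
      using sQ by (simp add: sets_pair_measure)
    show "emeasure ?P (space ?C \<times> space ?R) \<noteq> \<infinity>" for i :: nat
      by (subst Pval) auto
    show "{a \<times> b |a b. a \<in> sets ?C \<and> b \<in> sets ?R} \<subseteq> Pow (space ?C \<times> space ?R)"
      by (rule pair_measure_closed)
  qed auto
qed

lemma nn_integral_likelihood_ratio:
  assumes n: "n \<ge> 1"
  shows "(\<integral>\<^sup>+\<omega>. ennreal (likelihood (cgf \<mu>) n (p n) (\<lambda>i j. X n i j \<omega>) (\<lambda>i. Y n i \<omega>) \<phi>
      / likelihood (cgf \<mu>) n (p n) (\<lambda>i j. X n i j \<omega>) (\<lambda>i. Y n i \<omega>) (\<phi>s n)) \<partial>M n) = 1"
proof -
  interpret prob_space "M n" by (rule prob[OF n])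
  interpret B: finite_measure "PiM {1..n} (\<lambda>_. \<mu>)" by (rule finite_measure_PiM_base)
  interpret C: prob_space "cov_law n"
    unfolding cov_law_def by (intro prob_space_distr measurable_cov_matrix n)
  note [measurable] = measurable_cov_matrix[OF n] measurable_responses[OF n]
  let ?C = "covariate_space n (p n)" and ?R = "response_space n" and ?B = "PiM {1..n} (\<lambda>_. \<mu>)"
  let ?l = "\<lambda>\<phi> x y. likelihood (cgf \<mu>) n (p n) x y \<phi>"
  have sQ: "sets (cov_law n \<Otimes>\<^sub>M ?B) = sets (?C \<Otimes>\<^sub>M ?R)"
    by (intro sets_pair_measure_cong sets_cov_law sets_PiM_base)
  have m: "(\<lambda>z. ?l \<phi> (fst z) (snd z)) \<in> borel_measurable (?C \<Otimes>\<^sub>M ?R)" for \<phi>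
    using measurable_likelihood[of n "p n" \<phi>] by (simp add: case_prod_beta)
  have pr: "(\<lambda>\<omega>. (cov_matrix n \<omega>, responses n \<omega>)) \<in> measurable (M n) (?C \<Otimes>\<^sub>M ?R)" by measurable
  have m': "(\<lambda>z. ?l \<phi> (fst z) (snd z)) \<in> borel_measurable (cov_law n \<Otimes>\<^sub>M ?B)" for \<phi>
    using m measurable_cong_sets[OF sQ refl] by blast
  have "(\<integral>\<^sup>+\<omega>. ennreal (likelihood (cgf \<mu>) n (p n) (\<lambda>i j. X n i j \<omega>) (\<lambda>i. Y n i \<omega>) \<phi>
      / likelihood (cgf \<mu>) n (p n) (\<lambda>i j. X n i j \<omega>) (\<lambda>i. Y n i \<omega>) (\<phi>s n)) \<partial>M n)
    = (\<integral>\<^sup>+z. ennreal (?l \<phi> (fst z) (snd z) / ?l (\<phi>s n) (fst z) (snd z))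
          \<partial>distr (M n) (?C \<Otimes>\<^sub>M ?R) (\<lambda>\<omega>. (cov_matrix n \<omega>, responses n \<omega>)))"
    unfolding likelihood_cov_matrix using m pr by (subst nn_integral_distr) auto
  also have "\<dots> = (\<integral>\<^sup>+z. ennreal (?l (\<phi>s n) (fst z) (snd z)) * ennreal (?l \<phi> (fst z) (snd z) / ?l (\<phi>s n) (fst z) (snd z))
          \<partial>(cov_law n \<Otimes>\<^sub>M ?B))"
    unfolding joint_law[OF n] case_prod_beta
    using m' by (intro nn_integral_density) auto
  also have "\<dots> = (\<integral>\<^sup>+z. ennreal (?l \<phi> (fst z) (snd z)) \<partial>(cov_law n \<Otimes>\<^sub>M ?B))"
    using likelihood_pos[of "cgf \<mu>" n "p n"]
    by (intro nn_integral_cong) (simp add: less_imp_le ennreal_mult[symmetric] less_imp_neq[symmetric])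
  also have "\<dots> = (\<integral>\<^sup>+x. \<integral>\<^sup>+y. ennreal (?l \<phi> x y) \<partial>?B \<partial>cov_law n)"
    using m' by (subst B.nn_integral_fst[symmetric]) auto
  also have "\<dots> = 1" by (simp add: nn_integral_likelihood C.emeasure_space_1)
  finally show ?thesis .
qed

end

section \<open>Log-likelihood ratios and marginal likelihoods\<close>

text \<open>The inequality of arithmetic and geometric means, later applied to the likelihood ratios
  at a point and at its reflection.\<close>

lemma two_exp_mean_le: "2 * exp ((a + b) / 2) \<le> exp a + exp b" for a b :: real
proof -
  have "(exp (c / 2))\<^sup>2 = exp c" for c :: real
    by (simp add: power2_eq_square exp_add[symmetric])
  moreover have "exp ((a + b) / 2) = exp (a / 2) * exp (b / 2)"
    by (simp add: exp_add[symmetric] add_divide_distrib)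
  ultimately show ?thesis using sum_squares_bound[of "exp (a / 2)" "exp (b / 2)"] by simp
qed

lemma dot_cong: "(\<And>j. j \<in> {1..p} \<Longrightarrow> u j = v j) \<Longrightarrow> dot p x u = dot p x v"
  by (simp add: dot_def)

lemma L2_set_member_abs: "finite A \<Longrightarrow> i \<in> A \<Longrightarrow> \<bar>f i\<bar> \<le> L2_set f A"
  using member_le_L2_set[of A i "\<lambda>i. \<bar>f i\<bar>"] by (simp add: L2_set_def)

lemma sum_abs_le_card_L2_set: "finite A \<Longrightarrow> (\<Sum>i\<in>A. \<bar>f i\<bar>) \<le> real (card A) * L2_set f A"
  using sum_bounded_above[of A "\<lambda>i. \<bar>f i\<bar>" "L2_set f A"] by (simp add: L2_set_member_abs)

lemma L2_set_le_card: "finite A \<Longrightarrow> (\<And>i. i \<in> A \<Longrightarrow> \<bar>f i\<bar> \<le> c) \<Longrightarrow> L2_set f A \<le> real (card A) * c"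
  using L2_set_le_sum_abs[of f A] sum_bounded_above[of A "\<lambda>i. \<bar>f i\<bar>" c] by force

lemma abs_dot_le:
  assumes "S \<subseteq> {1..p}" "\<And>j. j \<in> {1..p} - S \<Longrightarrow> u j = 0" "\<And>j. j \<in> S \<Longrightarrow> \<bar>u j\<bar> \<le> c"
  shows "\<bar>dot p x u\<bar> \<le> c * (\<Sum>j\<in>S. \<bar>x j\<bar>)"
proof -
  have "dot p x u = (\<Sum>j\<in>S. x j * u j)"
    unfolding dot_def using assms by (intro sum.mono_neutral_right) auto
  also have "\<bar>\<dots>\<bar> \<le> (\<Sum>j\<in>S. \<bar>x j * u j\<bar>)" by (rule sum_abs)
  also have "\<dots> \<le> (\<Sum>j\<in>S. c * \<bar>x j\<bar>)"
    unfolding abs_mult using assms(3) by (intro sum_mono) (metis abs_ge_zero mult.commute mult_left_mono)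
  finally show ?thesis by (simp add: sum_distrib_left)
qed

text \<open>The reflection at a point preserves Lebesgue measure; it removes the linear term of the
  log-likelihood from the lower bound for the marginal likelihood.\<close>

lemma distr_reflect_coords:
  assumes J: "finite J"
  shows "distr (lebesgue_on_coords J) (lebesgue_on_coords J) (\<lambda>\<phi>. \<lambda>j\<in>J. c j - \<phi> j) = lebesgue_on_coords J"
proof -
  interpret product_sigma_finite "\<lambda>_ :: nat. lborel :: real measure" by unfold_locales
  have m: "(\<lambda>\<phi>. \<lambda>j\<in>J. c j - \<phi> j) \<in> measurable (lebesgue_on_coords J) (lebesgue_on_coords J)"
    by measurable
  have refl1: "emeasure lborel ((\<lambda>t. a - t) -` A) = emeasure lborel A" if "A \<in> sets borel" for a :: real and A
  proof -
    \<comment> \<open>The affine change of variables with factor -1; its Jacobian has absolute value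
      1 and drops out.\<close>
    have "distr lborel borel (\<lambda>t. a + -1 * t) = lborel"
    proof -
      have "density D (\<lambda>_. ennreal \<bar>- 1\<bar>) = D" for D :: "real measure" by (simp add: density_1)
      moreover have "- 1 \<noteq> (0 :: real)" by simp
      ultimately show ?thesis using lborel_real_affine[of "-1" a] by (simp only: not_False_eq_True simp_thms)
    qed
    then have "emeasure lborel A = emeasure (distr lborel borel (\<lambda>t. a + -1 * t)) A" by simp
    also have "\<dots> = emeasure lborel ((\<lambda>t. a - t) -` A)"
      using that by (subst emeasure_distr) auto
    finally show ?thesis by simp
  qed
  show ?thesis
  proof (rule PiM_eqI[OF J])
    fix A :: "nat \<Rightarrow> real set" assume A: "\<And>i. i \<in> J \<Longrightarrow> A i \<in> sets lborel"
    have "emeasure (distr (lebesgue_on_coords J) (lebesgue_on_coords J) (\<lambda>\<phi>. \<lambda>j\<in>J. c j - \<phi> j)) (PiE J A)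
        = emeasure (lebesgue_on_coords J) (PiE J (\<lambda>j. (\<lambda>t. c j - t) -` A j))"
    proof -
      have "(\<lambda>\<phi>. \<lambda>j\<in>J. c j - \<phi> j) -` PiE J A \<inter> space (lebesgue_on_coords J) = PiE J (\<lambda>j. (\<lambda>t. c j - t) -` A j)"
        unfolding space_PiM by (auto simp: PiE_iff)
      moreover have "PiE J A \<in> sets (lebesgue_on_coords J)" using A by (intro sets_PiM_I_finite J)
      ultimately show ?thesis using emeasure_distr[OF m] by simp
    qed
    also have "\<dots> = (\<Prod>j\<in>J. emeasure lborel ((\<lambda>t. c j - t) -` A j))"
    proof (rule emeasure_PiM[OF J])
      fix j assume "j \<in> J"
      then have "A j \<in> sets borel" using A by simp
      then have "(\<lambda>t. c j - t) -` A j \<inter> space borel \<in> sets borel"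
        by (rule measurable_sets[rotated]) measurable
      then show "(\<lambda>t. c j - t) -` A j \<in> sets lborel" by simp
    qed
    also have "\<dots> = (\<Prod>j\<in>J. emeasure lborel (A j))"
      using A by (intro prod.cong refl refl1) auto
    finally show "emeasure (distr (lebesgue_on_coords J) (lebesgue_on_coords J) (\<lambda>\<phi>. \<lambda>j\<in>J. c j - \<phi> j)) (PiE J A)
        = (\<Prod>j\<in>J. emeasure lborel (A j))" .
  qed simp
qed

text \<open>Cubes rather than balls: the volume is an explicit product, the reflection at the centre
  preserves them, and a point outside has a single coordinate that is off by more than h.\<close>

definition coord_cube :: "nat set \<Rightarrow> (nat \<Rightarrow> real) \<Rightarrow> real \<Rightarrow> (nat \<Rightarrow> real) set" where
  "coord_cube J c h = PiE J (\<lambda>j. {c j - h..c j + h})"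

lemma sets_coord_cube [measurable]: "finite J \<Longrightarrow> coord_cube J c h \<in> sets (lebesgue_on_coords J)"
  unfolding coord_cube_def by (intro sets_PiM_I_finite) auto

lemma emeasure_coord_cube:
  assumes "finite J" "h \<ge> 0"
  shows "emeasure (lebesgue_on_coords J) (coord_cube J c h) = ennreal ((2 * h) ^ card J)"
proof -
  interpret product_sigma_finite "\<lambda>_ :: nat. lborel :: real measure" by unfold_locales
  show ?thesis unfolding coord_cube_def
    using assms by (subst emeasure_PiM) (auto simp: ennreal_power)
qed

section \<open>Expansion of the log-likelihood ratio and bounds for restricted marginals\<close>

context exponential_family
begin

text \<open>The logarithm of L(\<phi>0 + u) / L(\<phi>0) as a function of the displacement u, so
  that scaling and reflection at \<phi>0 act on u directly.\<close>

definition llr :: "nat \<Rightarrow> nat \<Rightarrow> (nat \<Rightarrow> nat \<Rightarrow> real) \<Rightarrow> (nat \<Rightarrow> real) \<Rightarrow> (nat \<Rightarrow> real) \<Rightarrow> (nat \<Rightarrow> real) \<Rightarrow> real" where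
  "llr n p x y \<phi>0 u = (\<Sum>i\<in>{1..n}. y i * dot p (x i) u
      - (cgf \<mu> (dot p (x i) \<phi>0 + dot p (x i) u) - cgf \<mu> (dot p (x i) \<phi>0)))"

definition score :: "nat \<Rightarrow> nat \<Rightarrow> (nat \<Rightarrow> nat \<Rightarrow> real) \<Rightarrow> (nat \<Rightarrow> real) \<Rightarrow> (nat \<Rightarrow> real) \<Rightarrow> nat \<Rightarrow> real" where
  "score n p x y \<phi>0 j = (\<Sum>i\<in>{1..n}. x i j * (y i - cgf' (dot p (x i) \<phi>0)))"

text \<open>Not a quadratic approximation but the exact loss below the linear part. Hence
  \<open>llr_score\<close> is an identity and no Taylor remainder has to be controlled.\<close>

definition curv :: "nat \<Rightarrow> nat \<Rightarrow> (nat \<Rightarrow> nat \<Rightarrow> real) \<Rightarrow> (nat \<Rightarrow> real) \<Rightarrow> (nat \<Rightarrow> real) \<Rightarrow> real" where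
  "curv n p x \<phi>0 u = (\<Sum>i\<in>{1..n}. bregman (dot p (x i) \<phi>0) (dot p (x i) u))"

lemma llr_cong: "(\<And>j. j \<in> {1..p} \<Longrightarrow> u j = v j) \<Longrightarrow> llr n p x y \<phi>0 u = llr n p x y \<phi>0 v"
  unfolding llr_def using dot_cong[of p u v] by simp

lemma likelihood_eq_llr:
  "likelihood (cgf \<mu>) n p x y \<phi> = likelihood (cgf \<mu>) n p x y \<phi>0 * exp (llr n p x y \<phi>0 (\<lambda>j. \<phi> j - \<phi>0 j))"
proof -
  have "dot p (x i) \<phi> = dot p (x i) \<phi>0 + dot p (x i) (\<lambda>j. \<phi> j - \<phi>0 j)" for i
    using dot_add[of p "x i" \<phi>0 "\<lambda>j. \<phi> j - \<phi>0 j"] by simp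
  then show ?thesis
    by (simp add: likelihood_def llr_def exp_add[symmetric] sum.distrib[symmetric] algebra_simps)
qed

lemma llr_score: "llr n p x y \<phi>0 u = (\<Sum>j\<in>{1..p}. score n p x y \<phi>0 j * u j) - curv n p x \<phi>0 u"
proof -
  have "(\<Sum>j\<in>{1..p}. score n p x y \<phi>0 j * u j) = (\<Sum>j\<in>{1..p}. \<Sum>i\<in>{1..n}. x i j * u j * (y i - cgf' (dot p (x i) \<phi>0)))"
    unfolding score_def sum_distrib_right by (intro sum.cong refl) simp
  also have "\<dots> = (\<Sum>i\<in>{1..n}. \<Sum>j\<in>{1..p}. x i j * u j * (y i - cgf' (dot p (x i) \<phi>0)))"
    by (rule sum.swap)
  also have "\<dots> = (\<Sum>i\<in>{1..n}. dot p (x i) u * (y i - cgf' (dot p (x i) \<phi>0)))"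
    by (simp add: dot_def sum_distrib_right)
  finally show ?thesis
    by (simp add: llr_def curv_def bregman_def sum_subtractf[symmetric] algebra_simps)
qed

text \<open>The linear part is homogeneous and the curvature grows at least linearly along rays; in
  other words the ratio is concave and vanishes at u = 0.\<close>

lemma llr_scale:
  assumes "s \<ge> 1"
  shows "llr n p x y \<phi>0 (\<lambda>j. s * u j) \<le> s * llr n p x y \<phi>0 u"
proof -
  have "s * curv n p x \<phi>0 u \<le> curv n p x \<phi>0 (\<lambda>j. s * u j)"
    unfolding curv_def dot_scale sum_distrib_left by (intro sum_mono bregman_scale assms)
  then show ?thesis
    by (simp add: llr_score sum_distrib_left right_diff_distrib mult_ac)
qed

text \<open>Shrink u to the sphere of radius \<rho>. There the score contributes at most \<sigma>
  times the l1 norm, hence at most \<sigma> * card S * \<rho>, against a curvature of k * \<rho>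
  squared. \<open>llr_scale\<close> then returns to u, with a factor s \<ge> 1 that only makes the
  negative bound smaller.\<close>

lemma llr_le_outside:
  assumes S: "S \<subseteq> {1..p}" and \<rho>: "\<rho> > 0" and m: "m \<ge> 0"
    and score: "\<And>j. j \<in> S \<Longrightarrow> \<bar>score n p x y \<phi>0 j\<bar> \<le> \<sigma>"
    and curv: "\<And>v. (\<And>j. j \<in> {1..p} - S \<Longrightarrow> v j = 0) \<Longrightarrow> L2_set v S = \<rho> \<Longrightarrow> curv n p x \<phi>0 v \<ge> k * \<rho>\<^sup>2"
    and le: "\<sigma> * (real (card S) * \<rho>) - k * \<rho>\<^sup>2 \<le> - m"
    and u: "\<And>j. j \<in> {1..p} - S \<Longrightarrow> u j = 0" "L2_set u S \<ge> \<rho>"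
  shows "llr n p x y \<phi>0 u \<le> - m"
proof -
  define s where "s = L2_set u S / \<rho>"
  have s: "s \<ge> 1" using u(2) \<rho> by (simp add: s_def)
  define v where "v = (\<lambda>j. u j / s)"
  have u_eq: "u = (\<lambda>j. s * v j)" using s by (simp add: v_def)
  have v0: "v j = 0" if "j \<in> {1..p} - S" for j using u(1)[OF that] by (simp add: v_def)
  have "L2_set v S = \<rho>"
  proof -
    have "L2_set u S = s * L2_set v S"
      using s by (subst u_eq) (simp add: L2_set_right_distrib)
    also have "L2_set u S = s * \<rho>" using \<rho> by (simp add: s_def)
    finally show ?thesis using s by simp
  qed
  have S': "finite S" using S finite_subset by blast
  have "(\<Sum>j\<in>{1..p}. score n p x y \<phi>0 j * v j) = (\<Sum>j\<in>S. score n p x y \<phi>0 j * v j)"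
    using S v0 by (intro sum.mono_neutral_right) auto
  also have "\<dots> \<le> (\<Sum>j\<in>S. \<sigma> * \<bar>v j\<bar>)"
  proof (intro sum_mono)
    fix j assume "j \<in> S"
    have "score n p x y \<phi>0 j * v j \<le> \<bar>score n p x y \<phi>0 j\<bar> * \<bar>v j\<bar>" by (metis abs_ge_self abs_mult)
    also have "\<dots> \<le> \<sigma> * \<bar>v j\<bar>" using score[OF \<open>j \<in> S\<close>] by (intro mult_right_mono) auto
    finally show "score n p x y \<phi>0 j * v j \<le> \<sigma> * \<bar>v j\<bar>" .
  qed
  also have "\<dots> \<le> \<sigma> * (real (card S) * \<rho>)"
  \<comment> \<open>For nonempty S the score bounds force \<sigma> \<ge> 0; for empty S both sides
    are 0.\<close>
  proof (cases "S = {}")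
    case False
    then have "\<sigma> \<ge> 0" using score abs_ge_zero order_trans by blast
    then show ?thesis
      using sum_abs_le_card_L2_set[OF S', of v] \<open>L2_set v S = \<rho>\<close>
      by (simp add: sum_distrib_left[symmetric] mult_left_mono)
  qed simp
  finally have "llr n p x y \<phi>0 v \<le> \<sigma> * (real (card S) * \<rho>) - k * \<rho>\<^sup>2"
    using curv[OF v0 \<open>L2_set v S = \<rho>\<close>] by (simp add: llr_score)
  with le have "llr n p x y \<phi>0 v \<le> - m" by simp
  have "llr n p x y \<phi>0 u \<le> s * llr n p x y \<phi>0 v" by (subst u_eq) (rule llr_scale[OF s])
  also have "\<dots> \<le> s * (- m)" using \<open>llr n p x y \<phi>0 v \<le> - m\<close> s by (intro mult_left_mono) auto
  also have "\<dots> \<le> - m" using s m mult_right_mono[of 1 s m] by simp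
  finally show ?thesis .
qed

text \<open>The part over D of the marginal likelihood, divided by the likelihood at \<phi>0.
  Dividing makes its expectation computable when \<phi>0 is the truth.\<close>

definition marginal_on ::
  "nat \<Rightarrow> nat \<Rightarrow> (nat \<Rightarrow> nat \<Rightarrow> real) \<Rightarrow> (nat \<Rightarrow> real) \<Rightarrow> (nat \<Rightarrow> real) \<Rightarrow> ((nat \<Rightarrow> real) \<Rightarrow> real) \<Rightarrow>
   nat set \<Rightarrow> (nat \<Rightarrow> real) set \<Rightarrow> ennreal" where
  "marginal_on n p x y \<phi>0 g J D = (\<integral>\<^sup>+\<phi>. indicator D \<phi> *
      ennreal (exp (llr n p x y \<phi>0 (\<lambda>j. zero_ext J \<phi> j - \<phi>0 j)) * g \<phi>) \<partial>lebesgue_on_coords J)"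

lemma measurable_zero_ext [measurable]: "(\<lambda>\<phi>. zero_ext J \<phi> j) \<in> borel_measurable (lebesgue_on_coords J)"
  by (cases "j \<in> J") (simp_all add: zero_ext_def)

lemma measurable_llr:
  "(\<lambda>z. llr n p (fst (fst z)) (snd (fst z)) \<phi>0 (\<lambda>j. zero_ext J (snd z) j - \<phi>0 j))
     \<in> borel_measurable ((covariate_space n p \<Otimes>\<^sub>M response_space n) \<Otimes>\<^sub>M lebesgue_on_coords J)"
proof -
  let ?N = "(covariate_space n p \<Otimes>\<^sub>M response_space n) \<Otimes>\<^sub>M lebesgue_on_coords J"
  have x: "(\<lambda>z. fst (fst z) i j) \<in> borel_measurable ?N" if "i \<in> {1..n}" "j \<in> {1..p}" for i j
    using measurable_compose[OF measurable_compose[OF measurable_fst measurable_fst] measurable_entry[OF that]] .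
  have y: "(\<lambda>z. snd (fst z) i) \<in> borel_measurable ?N" if "i \<in> {1..n}" for i
    using measurable_compose[OF measurable_compose[OF measurable_fst measurable_snd] measurable_response[OF that]] .
  have f: "(\<lambda>z. zero_ext J (snd z) j) \<in> borel_measurable ?N" for j
    using measurable_compose[OF measurable_snd measurable_zero_ext] .
  have d: "(\<lambda>z. dot p (fst (fst z) i) (\<lambda>j. zero_ext J (snd z) j - \<phi>0 j)) \<in> borel_measurable ?N" if "i \<in> {1..n}" for i
    unfolding dot_def using x[OF that] f by measurable
  have d0: "(\<lambda>z. dot p (fst (fst z) i) \<phi>0) \<in> borel_measurable ?N" if "i \<in> {1..n}" for i
    unfolding dot_def using x[OF that] by measurable
  show ?thesis
    unfolding llr_def using d d0 y
    by (intro borel_measurable_sum borel_measurable_diff borel_measurable_times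
        measurable_compose[OF _ measurable_cgf(1)] borel_measurable_add) auto
qed

lemma measurable_dot_zero_ext [measurable]:
  "(\<lambda>\<phi>. dot p x (\<lambda>j. zero_ext J \<phi> j - \<phi>0 j)) \<in> borel_measurable (lebesgue_on_coords J)"
  unfolding dot_def by measurable

lemma measurable_llr_param [measurable]:
  "(\<lambda>\<phi>. llr n p x y \<phi>0 (\<lambda>j. zero_ext J \<phi> j - \<phi>0 j)) \<in> borel_measurable (lebesgue_on_coords J)"
  unfolding llr_def by measurable

text \<open>The likelihood at \<phi>0 is a common positive factor of all scores, so models are
  compared through likelihood ratios only.\<close>

lemma bayes_score_eq:
  assumes "card J \<le> q" and [measurable]: "f J \<in> borel_measurable (lebesgue_on_coords J)"
  shows "bayes_score (cgf \<mu>) n p q \<gamma> f x y J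
    = ennreal (likelihood (cgf \<mu>) n p x y \<phi>0 * real (p choose card J) powr (- \<gamma>)) * marginal_on n p x y \<phi>0 (f J) J UNIV"
    (is "_ = ennreal (?l * ?b) * _")
proof -
  have l: "?l > 0" by (rule likelihood_pos)
  have "(\<integral>\<^sup>+\<phi>. ennreal (likelihood (cgf \<mu>) n p x y (zero_ext J \<phi>) * f J \<phi>) \<partial>lebesgue_on_coords J)
     = (\<integral>\<^sup>+\<phi>. ennreal ?l * (indicator UNIV \<phi> *
      ennreal (exp (llr n p x y \<phi>0 (\<lambda>j. zero_ext J \<phi> j - \<phi>0 j)) * f J \<phi>)) \<partial>lebesgue_on_coords J)"
    using l by (intro nn_integral_cong) (subst likelihood_eq_llr[of n p x y _ \<phi>0],
      simp add: ennreal_mult'[symmetric] mult.assoc)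
  also have "\<dots> = ennreal ?l * marginal_on n p x y \<phi>0 (f J) J UNIV"
    unfolding marginal_on_def by (intro nn_integral_cmult) measurable
  finally show ?thesis
    using assms l by (simp add: bayes_score_def ennreal_mult mult_ac)
qed

lemma marginal_lower:
  assumes J: "J \<subseteq> {1..p}" and supp: "\<And>j. j \<in> {1..p} - J \<Longrightarrow> \<phi>0 j = 0"
    and h: "h \<ge> 0" and F: "F \<ge> 0"
    and g: "\<And>\<phi>. \<phi> \<in> coord_cube J \<phi>0 h \<Longrightarrow> F \<le> g \<phi>"
    and gm [measurable]: "g \<in> borel_measurable (lebesgue_on_coords J)"
    and curv: "\<And>u. (\<And>j. j \<in> {1..p} - J \<Longrightarrow> u j = 0) \<Longrightarrow> (\<And>j. j \<in> J \<Longrightarrow> \<bar>u j\<bar> \<le> h) \<Longrightarrow> curv n p x \<phi>0 u \<le> C"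
  shows "ennreal (F * exp (- C) * (2 * h) ^ card J) \<le> marginal_on n p x y \<phi>0 g J UNIV"
proof -
  have J': "finite J" using J finite_subset by blast
  let ?L = "lebesgue_on_coords J" and ?Q = "coord_cube J \<phi>0 h"
  define d where "d = (\<lambda>\<phi>. llr n p x y \<phi>0 (\<lambda>j. zero_ext J \<phi> j - \<phi>0 j))"
  define T where "T = (\<lambda>\<phi>. \<lambda>j\<in>J. 2 * \<phi>0 j - \<phi> j :: real)"
  have d_alt: "llr n p x y \<phi>0 (\<lambda>j. zero_ext J \<phi> j - \<phi>0 j) = d \<phi>" for \<phi> by (simp add: d_def)
  have dm [measurable]: "d \<in> borel_measurable ?L" unfolding d_def by measurable
  have Tm [measurable]: "T \<in> measurable ?L ?L" unfolding T_def by measurable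
  note [measurable] = sets_coord_cube[OF J']
  have sum_ge: "2 * exp (- C) \<le> exp (d \<phi>) + exp (d (T \<phi>))" if "\<phi> \<in> ?Q" for \<phi>
  proof -
    define u where "u = (\<lambda>j. if j \<in> J then \<phi> j - \<phi>0 j else 0)"
    have du: "d \<phi> = llr n p x y \<phi>0 u"
      unfolding d_def by (rule llr_cong) (auto simp: u_def zero_ext_def supp)
    have dT: "d (T \<phi>) = llr n p x y \<phi>0 (\<lambda>j. - u j)"
      unfolding d_def by (rule llr_cong) (auto simp: u_def zero_ext_def supp T_def)
    have ub: "\<bar>u j\<bar> \<le> h" if "j \<in> J" for j
    proof -
      have "\<phi> j \<in> {\<phi>0 j - h..\<phi>0 j + h}"
        using \<open>\<phi> \<in> ?Q\<close> that unfolding coord_cube_def by (rule PiE_mem)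
      then show ?thesis using that unfolding u_def atLeastAtMost_iff by (simp only: if_True) linarith
    qed
    have "d \<phi> + d (T \<phi>) = - (curv n p x \<phi>0 u + curv n p x \<phi>0 (\<lambda>j. - u j))"
      unfolding du dT llr_score by (simp add: sum_negf)
    moreover have "curv n p x \<phi>0 u \<le> C" by (rule curv) (use ub in \<open>auto simp: u_def\<close>)
    moreover have "curv n p x \<phi>0 (\<lambda>j. - u j) \<le> C"
      by (rule curv) (simp_all only: abs_minus_cancel ub, simp add: u_def)
    ultimately have "- C \<le> (d \<phi> + d (T \<phi>)) / 2" by simp
    then have "2 * exp (- C) \<le> 2 * exp ((d \<phi> + d (T \<phi>)) / 2)" by simp
    also have "\<dots> \<le> exp (d \<phi>) + exp (d (T \<phi>))"
      by (rule two_exp_mean_le)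
    finally show ?thesis .
  qed
  have TQ: "indicator ?Q (T \<phi>) = (indicator ?Q \<phi> :: ennreal)" if "\<phi> \<in> space ?L" for \<phi>
  proof -
    have "T \<phi> \<in> ?Q \<longleftrightarrow> (\<forall>j\<in>J. 2 * \<phi>0 j - \<phi> j \<in> {\<phi>0 j - h..\<phi>0 j + h})"
      unfolding coord_cube_def T_def by (simp only: PiE_iff restrict_apply' restrict_extensional simp_thms cong: ball_cong)
    also have "\<dots> \<longleftrightarrow> (\<forall>j\<in>J. \<phi> j \<in> {\<phi>0 j - h..\<phi>0 j + h})"
      by (intro ball_cong refl) (simp only: atLeastAtMost_iff, linarith)
    also have "\<dots> \<longleftrightarrow> \<phi> \<in> ?Q"
      using that unfolding coord_cube_def by (simp only: PiE_iff space_PiM simp_thms)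
    finally have "T \<phi> \<in> ?Q \<longleftrightarrow> \<phi> \<in> ?Q" .
    then show ?thesis by (simp add: indicator_def)
  qed
  define I where "I = (\<integral>\<^sup>+\<phi>. indicator ?Q \<phi> * ennreal (exp (d \<phi>)) \<partial>?L)"
  have "I = (\<integral>\<^sup>+\<phi>. indicator ?Q \<phi> * ennreal (exp (d \<phi>)) \<partial>distr ?L ?L T)"
    unfolding I_def T_def by (subst distr_reflect_coords[OF J']) simp
  also have "\<dots> = (\<integral>\<^sup>+\<phi>. indicator ?Q (T \<phi>) * ennreal (exp (d (T \<phi>))) \<partial>?L)"
    by (rule nn_integral_distr) measurable
  also have "\<dots> = (\<integral>\<^sup>+\<phi>. indicator ?Q \<phi> * ennreal (exp (d (T \<phi>))) \<partial>?L)"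
    by (intro nn_integral_cong) (simp add: TQ)
  finally have "I + I = (\<integral>\<^sup>+\<phi>. indicator ?Q \<phi> * ennreal (exp (d \<phi>)) \<partial>?L) + (\<integral>\<^sup>+\<phi>. indicator ?Q \<phi> * ennreal (exp (d (T \<phi>))) \<partial>?L)"
    by (simp add: I_def)
  also have "\<dots> = (\<integral>\<^sup>+\<phi>. indicator ?Q \<phi> * ennreal (exp (d \<phi>)) + indicator ?Q \<phi> * ennreal (exp (d (T \<phi>))) \<partial>?L)"
    by (rule nn_integral_add[symmetric]) measurable
  also have "\<dots> \<ge> (\<integral>\<^sup>+\<phi>. ennreal (2 * exp (- C)) * indicator ?Q \<phi> \<partial>?L)"
    using sum_ge by (intro nn_integral_mono) (auto simp: indicator_def ennreal_plus[symmetric] simp del: ennreal_plus)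
  also have "(\<integral>\<^sup>+\<phi>. ennreal (2 * exp (- C)) * indicator ?Q \<phi> \<partial>?L) = ennreal (2 * exp (- C)) * ennreal ((2 * h) ^ card J)"
    using emeasure_coord_cube[OF J' h] by (simp add: nn_integral_cmult_indicator)
  finally have le: "ennreal (2 * exp (- C)) * ennreal ((2 * h) ^ card J) \<le> I + I" .
  have I: "ennreal (exp (- C) * (2 * h) ^ card J) \<le> I"
  \<comment> \<open>Halving \<open>I + I\<close> is done in the reals; if \<open>I\<close> is
    infinite there is nothing to show.\<close>
  proof (cases I rule: ennreal_cases)
    case (real r)
    have "ennreal (2 * exp (- C)) * ennreal ((2 * h) ^ card J) = ennreal (2 * exp (- C) * (2 * h) ^ card J)"
      using h by (intro ennreal_mult[symmetric]) auto
    moreover have "I + I = ennreal (r + r)" using real by (simp only: ennreal_plus)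
    ultimately have "2 * exp (- C) * (2 * h) ^ card J \<le> r + r"
      using le real(1) by (simp only: ennreal_le_iff add_nonneg_nonneg)
    then show ?thesis unfolding real(2) by (intro ennreal_leI) linarith
  qed simp
  have "ennreal (F * exp (- C) * (2 * h) ^ card J) \<le> ennreal F * I"
    using mult_left_mono[OF I, of "ennreal F"] F h by (simp add: ennreal_mult mult.assoc)
  also have "\<dots> = (\<integral>\<^sup>+\<phi>. ennreal F * (indicator ?Q \<phi> * ennreal (exp (d \<phi>))) \<partial>?L)"
    unfolding I_def by (rule nn_integral_cmult[symmetric]) measurable
  also have "\<dots> \<le> marginal_on n p x y \<phi>0 g J UNIV"
    unfolding marginal_on_def d_alt
    using g F by (intro nn_integral_mono)
      (auto simp: indicator_def ennreal_mult'[symmetric] mult.commute intro!: ennreal_leI mult_left_mono)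
  finally show ?thesis .
qed

text \<open>Outside D the ratio is at most exp (- m) and the prior has mass one, so the far part
  costs exp (- m) without any volume factor.\<close>

lemma marginal_upper:
  assumes J: "finite J" and m: "D \<in> sets (lebesgue_on_coords J)"
    and gm [measurable]: "g \<in> borel_measurable (lebesgue_on_coords J)"
    and g0: "\<And>\<phi>. \<phi> \<in> space (lebesgue_on_coords J) \<Longrightarrow> 0 \<le> g \<phi>"
    and g1: "(\<integral>\<^sup>+\<phi>. ennreal (g \<phi>) \<partial>lebesgue_on_coords J) = 1"
    and llr: "\<And>\<phi>. \<phi> \<in> space (lebesgue_on_coords J) - D \<Longrightarrow> llr n p x y \<phi>0 (\<lambda>j. zero_ext J \<phi> j - \<phi>0 j) \<le> - m"
  shows "marginal_on n p x y \<phi>0 g J UNIV \<le> marginal_on n p x y \<phi>0 g J D + ennreal (exp (- m))"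
proof -
  let ?L = "lebesgue_on_coords J"
  define d where "d = (\<lambda>\<phi>. llr n p x y \<phi>0 (\<lambda>j. zero_ext J \<phi> j - \<phi>0 j))"
  have d_alt: "llr n p x y \<phi>0 (\<lambda>j. zero_ext J \<phi> j - \<phi>0 j) = d \<phi>" for \<phi> by (simp add: d_def)
  have dm [measurable]: "d \<in> borel_measurable ?L" unfolding d_def by measurable
  note [measurable] = m
  have "marginal_on n p x y \<phi>0 g J UNIV
      \<le> (\<integral>\<^sup>+\<phi>. indicator D \<phi> * ennreal (exp (d \<phi>) * g \<phi>) + ennreal (exp (- m)) * ennreal (g \<phi>) \<partial>?L)"
    unfolding marginal_on_def d_alt
  proof (rule nn_integral_mono)
    fix \<phi> assume \<phi>: "\<phi> \<in> space ?L"
    show "indicator UNIV \<phi> * ennreal (exp (d \<phi>) * g \<phi>)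
        \<le> indicator D \<phi> * ennreal (exp (d \<phi>) * g \<phi>) + ennreal (exp (- m)) * ennreal (g \<phi>)"
    proof (cases "\<phi> \<in> D")
      case False
      then have "exp (d \<phi>) * g \<phi> \<le> exp (- m) * g \<phi>"
        using llr[of \<phi>] g0[OF \<phi>] \<phi> by (intro mult_right_mono) (auto simp: d_def)
      then show ?thesis using False by (simp add: ennreal_mult'[symmetric] ennreal_leI)
    qed simp
  qed
  also have "\<dots> = marginal_on n p x y \<phi>0 g J D + ennreal (exp (- m)) * (\<integral>\<^sup>+\<phi>. ennreal (g \<phi>) \<partial>?L)"
    unfolding marginal_on_def d_alt
    by (subst nn_integral_add) (auto simp: nn_integral_cmult)
  finally show ?thesis by (simp add: g1)
qed

end

section \<open>Tail bounds\<close>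

text \<open>Markov's inequality for a function that is known to be large on E; E need not be a level
  set of it. This is how good events are intersected with tail events later.\<close>

lemma (in prob_space) prob_le_nn_integral:
  assumes E: "E \<in> events" and c: "c > 0" and b: "b \<ge> 0"
    and u: "\<And>\<omega>. \<omega> \<in> E \<Longrightarrow> ennreal c \<le> u \<omega>" and int: "(\<integral>\<^sup>+\<omega>. u \<omega> \<partial>M) \<le> ennreal b"
  shows "prob E \<le> b / c"
proof -
  have "ennreal c * emeasure M E = (\<integral>\<^sup>+\<omega>. ennreal c * indicator E \<omega> \<partial>M)"
    using E by (simp add: nn_integral_cmult_indicator)
  also have "\<dots> \<le> (\<integral>\<^sup>+\<omega>. u \<omega> \<partial>M)"
    using u by (intro nn_integral_mono) (auto simp: indicator_def)
  finally have "ennreal (c * prob E) \<le> ennreal b"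
    using int c by (simp add: emeasure_eq_measure ennreal_mult'')
  then have "c * prob E \<le> b" using b by (simp add: ennreal_le_iff)
  then show ?thesis using c by (simp add: field_simps)
qed

lemma (in prob_space) prob_UN_le_card:
  assumes "finite I" "\<And>i. i \<in> I \<Longrightarrow> A i \<in> events" "\<And>i. i \<in> I \<Longrightarrow> prob (A i) \<le> c" "real (card I) \<le> m" "c \<ge> 0"
  shows "prob (\<Union>i\<in>I. A i) \<le> m * c"
proof -
  have "prob (\<Union>i\<in>I. A i) \<le> (\<Sum>i\<in>I. prob (A i))"
    using assms by (intro finite_measure_subadditive_finite) auto
  also have "\<dots> \<le> real (card I) * c" using assms sum_bounded_above[of I "\<lambda>i. prob (A i)" c] by simp
  also have "\<dots> \<le> m * c" using assms by (intro mult_right_mono) auto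
  finally show ?thesis .
qed

section \<open>Sums over independent rows, expected marginals and tails of the score\<close>

context glm_sequence
begin

lemma cov_matrix_row: "i \<in> {1..n} \<Longrightarrow> cov_matrix n \<omega> i = covariate_row X p n i \<omega>"
  by (simp add: cov_matrix_def)

lemma measurable_row_fun:
  assumes "n \<ge> 1" "i \<in> {1..n}" "g \<in> borel_measurable (PiM {1..p n} (\<lambda>_. borel))"
  shows "(\<lambda>\<omega>. g (covariate_row X p n i \<omega>)) \<in> borel_measurable (M n)"
  using measurable_compose[OF measurable_row[OF assms(1,2)] assms(3)] .

lemma nn_integral_row:
  assumes n: "n \<ge> 1" "i \<in> {1..n}" and g: "g \<in> borel_measurable (PiM {1..p n} (\<lambda>_. borel))"
  shows "(\<integral>\<^sup>+\<omega>. g (covariate_row X p n i \<omega>) \<partial>M n) = (\<integral>\<^sup>+\<omega>. g (covariate_row X p n 1 \<omega>) \<partial>M n)"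
proof -
  have "(\<integral>\<^sup>+\<omega>. g (covariate_row X p n i \<omega>) \<partial>M n)
      = (\<integral>\<^sup>+r. g r \<partial>distr (M n) (PiM {1..p n} (\<lambda>_. borel)) (covariate_row X p n i))" if "i \<in> {1..n}" for i
    using g by (intro nn_integral_distr[symmetric] measurable_row n(1) that) simp
  from this[OF n(2)] this[of 1] show ?thesis using n(1) unfolding rows_ident[OF n] by simp
qed

lemma integral_row:
  fixes g :: "(nat \<Rightarrow> real) \<Rightarrow> real"
  assumes n: "n \<ge> 1" "i \<in> {1..n}" and g: "g \<in> borel_measurable (PiM {1..p n} (\<lambda>_. borel))"
  shows "(\<integral>\<omega>. g (covariate_row X p n i \<omega>) \<partial>M n) = (\<integral>\<omega>. g (covariate_row X p n 1 \<omega>) \<partial>M n)"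
proof -
  have "(\<integral>\<omega>. g (covariate_row X p n i \<omega>) \<partial>M n)
      = (\<integral>r. g r \<partial>distr (M n) (PiM {1..p n} (\<lambda>_. borel)) (covariate_row X p n i))" if "i \<in> {1..n}" for i
    using g by (intro integral_distr[symmetric] measurable_row n(1) that)
  from this[OF n(2)] this[of 1] show ?thesis using n(1) unfolding rows_ident[OF n] by simp
qed

lemma indep_row_fun:
  fixes g :: "(nat \<Rightarrow> real) \<Rightarrow> 'b :: topological_space"
  assumes n: "n \<ge> 1" and g: "g \<in> borel_measurable (PiM {1..p n} (\<lambda>_. borel))"
  shows "prob_space.indep_vars (M n) (\<lambda>_. borel) (\<lambda>i \<omega>. g (covariate_row X p n i \<omega>)) {1..n}"
  using prob_space.indep_vars_compose2[OF prob[OF n] rows_indep[OF n], of "\<lambda>_. g" "\<lambda>_. borel"] g by simp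

lemma row_sum_Hoeffding:
  fixes g :: "(nat \<Rightarrow> real) \<Rightarrow> real"
  assumes n: "n \<ge> 1" and g [measurable]: "g \<in> borel_measurable (PiM {1..p n} (\<lambda>_. borel))"
    and b: "\<And>r. \<bar>g r\<bar> \<le> b" "b > 0" and \<epsilon>: "\<epsilon> \<ge> 0"
  shows "measure (M n) {\<omega> \<in> space (M n).
     \<bar>(\<Sum>i\<in>{1..n}. g (covariate_row X p n i \<omega>)) - real n * (\<integral>\<omega>. g (covariate_row X p n 1 \<omega>) \<partial>M n)\<bar> \<ge> real n * \<epsilon>}
    \<le> 2 * exp (- (real n * \<epsilon>\<^sup>2 / (2 * b\<^sup>2)))"
proof -
  interpret prob_space "M n" by (rule prob[OF n])
  define \<nu> where "\<nu> = (\<Sum>i\<in>{1..n}. expectation (\<lambda>\<omega>. g (covariate_row X p n i \<omega>)))"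
  have \<nu>: "\<nu> = real n * (\<integral>\<omega>. g (covariate_row X p n 1 \<omega>) \<partial>M n)"
  proof -
    have "\<nu> = (\<Sum>i\<in>{1..n}. \<integral>\<omega>. g (covariate_row X p n 1 \<omega>) \<partial>M n)"
      unfolding \<nu>_def by (intro sum.cong refl integral_row[OF n _ g])
    then show ?thesis by simp
  qed
  have "- b \<le> g r \<and> g r \<le> b" for r using b(1)[of r] by linarith
  then interpret Hoeffding_ineq "M n" "{1..n}" "\<lambda>i \<omega>. g (covariate_row X p n i \<omega>)" "\<lambda>_. - b" "\<lambda>_. b" \<nu>
    using indep_row_fun[OF n g] by unfold_locales (auto simp: \<nu>_def)
  have "prob {\<omega> \<in> space (M n). \<bar>(\<Sum>i\<in>{1..n}. g (covariate_row X p n i \<omega>)) - \<nu>\<bar> \<ge> real n * \<epsilon>}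
     \<le> 2 * exp (- 2 * (real n * \<epsilon>)\<^sup>2 / (\<Sum>i\<in>{1..n}. (b - - b)\<^sup>2))"
    using n b \<epsilon> by (intro Hoeffding_ineq_abs_ge) auto
  also have "- 2 * (real n * \<epsilon>)\<^sup>2 / (\<Sum>i\<in>{1..n}. (b - - b)\<^sup>2) = - (real n * \<epsilon>\<^sup>2 / (2 * b\<^sup>2))"
    using n b by (simp add: field_simps power2_eq_square)
  finally show ?thesis unfolding \<nu> .
qed

text \<open>Hoeffding would give an exponent of order n / m^2, which is useless for m close to n.
  For nonnegative g the inequality exp (g / m) \<le> 1 + 2 * g / m bounds the exponential moment of
  the sum over m by exp (2 * z * n / m), and Markov at the level (2 * z + 1) * n leaves exp (- n /
  m).\<close>

lemma row_sum_Chernoff: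
  fixes g :: "(nat \<Rightarrow> real) \<Rightarrow> real"
  assumes n: "n \<ge> 1" and g [measurable]: "g \<in> borel_measurable (PiM {1..p n} (\<lambda>_. borel))"
    and g0: "\<And>r. 0 \<le> g r" and gm: "\<And>r. g r \<le> m" and m: "m > 0"
    and z: "(\<integral>\<^sup>+\<omega>. ennreal (g (covariate_row X p n 1 \<omega>)) \<partial>M n) \<le> ennreal z" "z \<ge> 0"
  shows "measure (M n) {\<omega> \<in> space (M n). (\<Sum>i\<in>{1..n}. g (covariate_row X p n i \<omega>)) \<ge> (2 * z + 1) * real n}
    \<le> exp (- (real n / m))"
proof -
  interpret prob_space "M n" by (rule prob[OF n])
  note [measurable] = measurable_row_fun[OF n _ g]
  let ?r = "covariate_row X p n"
  have exp_le: "exp (g r / m) \<le> 1 + 2 / m * g r" for r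
  proof -
    have "0 \<le> g r / m" "g r / m \<le> 1" using g0 gm m by auto
    then have "exp (g r / m) \<le> 1 + g r / m + (g r / m)\<^sup>2" by (rule exp_bound)
    also have "(g r / m)\<^sup>2 \<le> g r / m"
      using mult_left_le[OF \<open>g r / m \<le> 1\<close> \<open>0 \<le> g r / m\<close>] unfolding power2_eq_square .
    finally show ?thesis by simp
  qed
  have one: "(\<integral>\<^sup>+\<omega>. ennreal (exp (g (?r i \<omega>) / m)) \<partial>M n) \<le> ennreal (exp (2 * z / m))" if i: "i \<in> {1..n}" for i
  proof -
    have "(\<integral>\<^sup>+\<omega>. ennreal (exp (g (?r i \<omega>) / m)) \<partial>M n) = (\<integral>\<^sup>+\<omega>. ennreal (exp (g (?r 1 \<omega>) / m)) \<partial>M n)"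
      by (rule nn_integral_row[OF n i]) measurable
    also have "\<dots> \<le> (\<integral>\<^sup>+\<omega>. ennreal 1 + ennreal (2 / m) * ennreal (g (?r 1 \<omega>)) \<partial>M n)"
      using exp_le g0 m
      by (intro nn_integral_mono) (simp add: ennreal_mult[symmetric] ennreal_plus[symmetric] del: ennreal_plus ennreal_1)
    also have "\<dots> = 1 + ennreal (2 / m) * (\<integral>\<^sup>+\<omega>. ennreal (g (?r 1 \<omega>)) \<partial>M n)"
      using n by (subst nn_integral_add) (auto simp: nn_integral_cmult emeasure_space_1)
    also have "\<dots> \<le> 1 + ennreal (2 / m) * ennreal z"
      by (intro add_left_mono mult_left_mono z) auto
    also have "\<dots> = ennreal (1 + 2 * z / m)"
      using z m by (simp add: ennreal_mult[symmetric] ennreal_1[symmetric] ennreal_plus[symmetric] del: ennreal_plus ennreal_1)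
    also have "\<dots> \<le> ennreal (exp (2 * z / m))" by (intro ennreal_leI exp_ge_add_one_self)
    finally show ?thesis .
  qed
  have "(\<integral>\<^sup>+\<omega>. ennreal (exp ((\<Sum>i\<in>{1..n}. g (?r i \<omega>)) / m)) \<partial>M n) = (\<integral>\<^sup>+\<omega>. (\<Prod>i\<in>{1..n}. ennreal (exp (g (?r i \<omega>) / m))) \<partial>M n)"
    by (simp add: sum_divide_distrib exp_sum prod_ennreal)
  also have "\<dots> = (\<Prod>i\<in>{1..n}. \<integral>\<^sup>+\<omega>. ennreal (exp (g (?r i \<omega>) / m)) \<partial>M n)"
  proof (rule indep_vars_nn_integral)
    show "indep_vars (\<lambda>_. borel) (\<lambda>i \<omega>. ennreal (exp (g (?r i \<omega>) / m))) {1..n}"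
      by (rule indep_row_fun[OF n]) measurable
  qed simp_all
  also have "\<dots> \<le> (\<Prod>i\<in>{1..n}. ennreal (exp (2 * z / m)))"
    by (intro prod_mono_ennreal one)
  also have "\<dots> = ennreal (exp (2 * z / m * real n))"
    by (simp add: ennreal_power exp_of_nat_mult[symmetric] mult.commute)
  finally have int: "(\<integral>\<^sup>+\<omega>. ennreal (exp ((\<Sum>i\<in>{1..n}. g (?r i \<omega>)) / m)) \<partial>M n) \<le> ennreal (exp (2 * z / m * real n))" .
  have "prob {\<omega> \<in> space (M n). (\<Sum>i\<in>{1..n}. g (?r i \<omega>)) \<ge> (2 * z + 1) * real n}
     \<le> exp (2 * z / m * real n) / exp ((2 * z + 1) * real n / m)"
    using m by (intro prob_le_nn_integral[OF _ _ _ _ int]) (auto intro!: ennreal_leI divide_right_mono)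
  also have "\<dots> = exp (- (real n / m))"
    by (simp add: exp_diff[symmetric] add_divide_distrib distrib_right)
  finally show ?thesis .
qed

lemma measure_some_row:
  assumes n: "n \<ge> 1" and A: "A \<in> sets (PiM {1..p n} (\<lambda>_. borel))"
    and c: "measure (M n) {\<omega> \<in> space (M n). covariate_row X p n 1 \<omega> \<in> A} \<le> c"
  shows "{\<omega> \<in> space (M n). \<exists>i\<in>{1..n}. covariate_row X p n i \<omega> \<in> A} \<in> sets (M n)"
    and "measure (M n) {\<omega> \<in> space (M n). \<exists>i\<in>{1..n}. covariate_row X p n i \<omega> \<in> A} \<le> real n * c"
proof -
  interpret prob_space "M n" by (rule prob[OF n])
  note [measurable] = measurable_row[OF n] A
  have m: "{\<omega> \<in> space (M n). covariate_row X p n i \<omega> \<in> A} \<in> events" if "i \<in> {1..n}" for i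
    using that by measurable
  have eq: "{\<omega> \<in> space (M n). \<exists>i\<in>{1..n}. covariate_row X p n i \<omega> \<in> A}
      = (\<Union>i\<in>{1..n}. {\<omega> \<in> space (M n). covariate_row X p n i \<omega> \<in> A})" by auto
  show "{\<omega> \<in> space (M n). \<exists>i\<in>{1..n}. covariate_row X p n i \<omega> \<in> A} \<in> sets (M n)"
    unfolding eq using m by auto
  have pr: "prob {\<omega> \<in> space (M n). covariate_row X p n i \<omega> \<in> A} \<le> c" if i: "i \<in> {1..n}" for i
  proof -
    have "emeasure (M n) {\<omega> \<in> space (M n). covariate_row X p n i \<omega> \<in> A}
        = (\<integral>\<^sup>+\<omega>. indicator A (covariate_row X p n i \<omega>) \<partial>M n)" if "i \<in> {1..n}" for i
    proof -
      have "(\<integral>\<^sup>+\<omega>. indicator A (covariate_row X p n i \<omega>) \<partial>M n)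
         = (\<integral>\<^sup>+\<omega>. indicator {\<omega> \<in> space (M n). covariate_row X p n i \<omega> \<in> A} \<omega> \<partial>M n)"
        by (intro nn_integral_cong) (auto simp: indicator_def)
      then show ?thesis using m[OF that] by simp
    qed
    from this[OF i] this[of 1] nn_integral_row[OF n i borel_measurable_indicator[OF A]] n
    have "emeasure (M n) {\<omega> \<in> space (M n). covariate_row X p n i \<omega> \<in> A}
      = emeasure (M n) {\<omega> \<in> space (M n). covariate_row X p n 1 \<omega> \<in> A}" by simp
    then show ?thesis using c by (simp add: measure_def)
  qed
  show "prob {\<omega> \<in> space (M n). \<exists>i\<in>{1..n}. covariate_row X p n i \<omega> \<in> A} \<le> real n * c"
    unfolding eq using m pr measure_nonneg order_trans c by (intro prob_UN_le_card) (auto intro: order_trans[OF measure_nonneg c])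
qed

lemma measurable_llr_joint:
  assumes n: "n \<ge> 1"
  shows "(\<lambda>(\<omega>, \<phi>). llr n (p n) (cov_matrix n \<omega>) (responses n \<omega>) \<phi>0 (\<lambda>j. zero_ext J \<phi> j - \<phi>0 j))
     \<in> borel_measurable (M n \<Otimes>\<^sub>M lebesgue_on_coords J)"
proof -
  note [measurable] = measurable_cov_matrix[OF n] measurable_responses[OF n]
  have "(\<lambda>z. ((cov_matrix n (fst z), responses n (fst z)), snd z)) \<in>
     measurable (M n \<Otimes>\<^sub>M lebesgue_on_coords J)
       ((covariate_space n (p n) \<Otimes>\<^sub>M response_space n) \<Otimes>\<^sub>M lebesgue_on_coords J)"
    by measurable
  from measurable_compose[OF this measurable_llr] show ?thesis by (simp add: case_prod_beta)
qed

lemma measurable_marginal_on: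
  assumes n: "n \<ge> 1" and J: "finite J" and D [measurable]: "D \<in> sets (lebesgue_on_coords J)"
    and g [measurable]: "g \<in> borel_measurable (lebesgue_on_coords J)"
  shows "(\<lambda>\<omega>. marginal_on n (p n) (cov_matrix n \<omega>) (responses n \<omega>) \<phi>0 g J D) \<in> borel_measurable (M n)"
proof -
  interpret product_sigma_finite "\<lambda>_ :: nat. lborel :: real measure" by unfold_locales
  interpret L: sigma_finite_measure "lebesgue_on_coords J" by (rule sigma_finite[OF J])
  note [measurable] = measurable_llr_joint[OF n, unfolded case_prod_beta]
  show ?thesis unfolding marginal_on_def by measurable
qed

lemma nn_integral_llr:
  assumes n: "n \<ge> 1"
  shows "(\<integral>\<^sup>+\<omega>. ennreal (exp (llr n (p n) (cov_matrix n \<omega>) (responses n \<omega>) (\<phi>s n) u)) \<partial>M n) = 1"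
proof -
  have "exp (llr n (p n) (cov_matrix n \<omega>) (responses n \<omega>) (\<phi>s n) u)
     = likelihood (cgf \<mu>) n (p n) (\<lambda>i j. X n i j \<omega>) (\<lambda>i. Y n i \<omega>) (\<lambda>j. \<phi>s n j + u j)
      / likelihood (cgf \<mu>) n (p n) (\<lambda>i j. X n i j \<omega>) (\<lambda>i. Y n i \<omega>) (\<phi>s n)" for \<omega>
    unfolding likelihood_cov_matrix
    using likelihood_pos[of "cgf \<mu>" n "p n" "cov_matrix n \<omega>" "responses n \<omega>" "\<phi>s n"]
    by (subst likelihood_eq_llr[of _ _ _ _ "\<lambda>j. \<phi>s n j + u j" "\<phi>s n"]) simp
  then show ?thesis using nn_integral_likelihood_ratio[OF n] by simp
qed

lemma nn_integral_marginal_on: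
  assumes n: "n \<ge> 1" and J: "finite J" and D [measurable]: "D \<in> sets (lebesgue_on_coords J)"
    and g [measurable]: "g \<in> borel_measurable (lebesgue_on_coords J)"
    and F: "F \<ge> 0" "\<And>\<phi>. \<phi> \<in> space (lebesgue_on_coords J) \<Longrightarrow> 0 \<le> g \<phi> \<and> g \<phi> \<le> F"
  shows "(\<integral>\<^sup>+\<omega>. marginal_on n (p n) (cov_matrix n \<omega>) (responses n \<omega>) (\<phi>s n) g J D \<partial>M n)
    \<le> ennreal F * emeasure (lebesgue_on_coords J) D"
proof -
  interpret prob_space "M n" by (rule prob[OF n])
  interpret product_sigma_finite "\<lambda>_ :: nat. lborel :: real measure" by unfold_locales
  interpret L: sigma_finite_measure "lebesgue_on_coords J" by (rule sigma_finite[OF J])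
  interpret PL: pair_sigma_finite "M n" "lebesgue_on_coords J" by unfold_locales
  note [measurable] = measurable_llr_joint[OF n, unfolded case_prod_beta]
  let ?d = "\<lambda>\<omega> \<phi>. exp (llr n (p n) (cov_matrix n \<omega>) (responses n \<omega>) (\<phi>s n) (\<lambda>j. zero_ext J \<phi> j - \<phi>s n j))"
  have "(\<integral>\<^sup>+\<omega>. marginal_on n (p n) (cov_matrix n \<omega>) (responses n \<omega>) (\<phi>s n) g J D \<partial>M n)
     = (\<integral>\<^sup>+\<phi>. \<integral>\<^sup>+\<omega>. indicator D \<phi> * ennreal (?d \<omega> \<phi> * g \<phi>) \<partial>M n \<partial>lebesgue_on_coords J)"
    unfolding marginal_on_def by (rule PL.Fubini'[symmetric]) measurable
  also have "\<dots> \<le> (\<integral>\<^sup>+\<phi>. ennreal F * indicator D \<phi> \<partial>lebesgue_on_coords J)"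
  proof (rule nn_integral_mono)
    fix \<phi> assume \<phi>: "\<phi> \<in> space (lebesgue_on_coords J)"
    have dm: "(\<lambda>\<omega>. ?d \<omega> \<phi>) \<in> borel_measurable (M n)"
      using measurable_compose[OF measurable_Pair2'[OF \<phi>] measurable_llr_joint[OF n, of "\<phi>s n" J]] by simp
    have "(\<integral>\<^sup>+\<omega>. indicator D \<phi> * ennreal (?d \<omega> \<phi> * g \<phi>) \<partial>M n)
       = (\<integral>\<^sup>+\<omega>. (indicator D \<phi> * ennreal (g \<phi>)) * ennreal (?d \<omega> \<phi>) \<partial>M n)"
      using F(2)[OF \<phi>] by (intro nn_integral_cong) (simp add: ennreal_mult mult_ac)
    also have "\<dots> = (indicator D \<phi> * ennreal (g \<phi>)) * (\<integral>\<^sup>+\<omega>. ennreal (?d \<omega> \<phi>) \<partial>M n)"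
      by (intro nn_integral_cmult measurable_compose[OF dm measurable_ennreal])
    also have "\<dots> = indicator D \<phi> * ennreal (g \<phi>)" by (simp add: nn_integral_llr[OF n])
    also have "\<dots> \<le> ennreal F * indicator D \<phi>"
      using F(2)[OF \<phi>] by (auto simp: indicator_def ennreal_leI)
    finally show "(\<integral>\<^sup>+\<omega>. indicator D \<phi> * ennreal (?d \<omega> \<phi> * g \<phi>) \<partial>M n) \<le> ennreal F * indicator D \<phi>" .
  qed
  also have "\<dots> = ennreal F * emeasure (lebesgue_on_coords J) D"
    by (rule nn_integral_cmult_indicator[OF D])
  finally show ?thesis .
qed

lemma measurable_score:
  assumes n: "n \<ge> 1" and j: "j \<in> {1..p n}"
  shows "(\<lambda>\<omega>. score n (p n) (cov_matrix n \<omega>) (responses n \<omega>) \<phi>0 j) \<in> borel_measurable (M n)"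
proof -
  note c = measurable_compose[OF measurable_cov_matrix[OF n]]
  have "(\<lambda>\<omega>. cov_matrix n \<omega> i j) \<in> borel_measurable (M n)"
    "(\<lambda>\<omega>. dot (p n) (cov_matrix n \<omega> i) \<phi>0) \<in> borel_measurable (M n)"
    "(\<lambda>\<omega>. responses n \<omega> i) \<in> borel_measurable (M n)" if i: "i \<in> {1..n}" for i
    using c[OF measurable_entry[OF i j]] c[OF measurable_dot_row[OF i]]
      measurable_compose[OF measurable_responses[OF n] measurable_response[OF i]] by auto
  then show ?thesis unfolding score_def by measurable
qed

text \<open>Tilting by the score in direction j is a likelihood ratio times the exponential of a
  curvature term, so its expectation is controlled on events on which the curvature is bounded.\<close>

lemma score_tail_one:
  assumes n: "n \<ge> 1" and j: "j \<in> {1..p n}" and G: "G \<in> sets (M n)"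
    and c: "\<And>\<omega>. \<omega> \<in> G \<Longrightarrow> curv n (p n) (cov_matrix n \<omega>) (\<phi>s n) (\<lambda>k. if k = j then t else 0) \<le> c"
  shows "measure (M n) {\<omega> \<in> G. t * score n (p n) (cov_matrix n \<omega>) (responses n \<omega>) (\<phi>s n) j > a} \<le> exp (c - a)"
proof -
  interpret prob_space "M n" by (rule prob[OF n])
  let ?u = "\<lambda>k. if k = j then t else 0"
  let ?s = "\<lambda>\<omega>. score n (p n) (cov_matrix n \<omega>) (responses n \<omega>) (\<phi>s n) j"
  let ?l = "\<lambda>\<omega>. llr n (p n) (cov_matrix n \<omega>) (responses n \<omega>) (\<phi>s n) ?u"
  have eq: "?l \<omega> = t * ?s \<omega> - curv n (p n) (cov_matrix n \<omega>) (\<phi>s n) ?u" for \<omega>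
  proof -
    have "(\<Sum>k\<in>{1..p n}. score n (p n) (cov_matrix n \<omega>) (responses n \<omega>) (\<phi>s n) k * ?u k)
        = (\<Sum>k\<in>{1..p n}. if k = j then t * ?s \<omega> else 0)"
      by (intro sum.cong) auto
    also have "\<dots> = t * ?s \<omega>" using j by (simp only: sum.delta finite_atLeastAtMost if_True)
    finally show ?thesis unfolding llr_score by simp
  qed
  have "prob {\<omega> \<in> G. t * ?s \<omega> > a} \<le> 1 / exp (a - c)"
  proof (rule prob_le_nn_integral)
    show "{\<omega> \<in> G. t * ?s \<omega> > a} \<in> events"
    proof -
      have "{\<omega> \<in> G. t * ?s \<omega> > a} = G \<inter> {\<omega> \<in> space (M n). t * ?s \<omega> > a}"
        using sets.sets_into_space[OF G] by auto
      moreover note [measurable] = measurable_score[OF n j]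
      have "{\<omega> \<in> space (M n). t * ?s \<omega> > a} \<in> events" by measurable
      ultimately show ?thesis using G by auto
    qed
    show "(\<integral>\<^sup>+\<omega>. ennreal (exp (?l \<omega>)) \<partial>M n) \<le> ennreal 1" using nn_integral_llr[OF n] by simp
    fix \<omega> assume "\<omega> \<in> {\<omega> \<in> G. t * ?s \<omega> > a}"
    then show "ennreal (exp (a - c)) \<le> ennreal (exp (?l \<omega>))"
      using c[of \<omega>] unfolding eq by (intro ennreal_leI) auto
  qed auto
  also have "1 / exp (a - c) = exp (c - a)" by (simp add: exp_diff)
  finally show ?thesis .
qed

text \<open>The tilts t and - t take care of the two signs of the score. Later t is sqrt (log (n p)
  / n), for which c and t * \<sigma> are both of order log (n p).\<close>

lemma score_tail:
  assumes n: "n \<ge> 1" and j: "j \<in> {1..p n}" and G: "G \<in> sets (M n)" and t: "t > 0"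
    and c: "\<And>\<omega> s. \<omega> \<in> G \<Longrightarrow> \<bar>s\<bar> = t \<Longrightarrow> curv n (p n) (cov_matrix n \<omega>) (\<phi>s n) (\<lambda>k. if k = j then s else 0) \<le> c"
  shows "{\<omega> \<in> G. \<bar>score n (p n) (cov_matrix n \<omega>) (responses n \<omega>) (\<phi>s n) j\<bar> > \<sigma>} \<in> sets (M n)"
    and "measure (M n) {\<omega> \<in> G. \<bar>score n (p n) (cov_matrix n \<omega>) (responses n \<omega>) (\<phi>s n) j\<bar> > \<sigma>} \<le> 2 * exp (c - t * \<sigma>)"
proof -
  interpret prob_space "M n" by (rule prob[OF n])
  let ?s = "\<lambda>\<omega>. score n (p n) (cov_matrix n \<omega>) (responses n \<omega>) (\<phi>s n) j"
  note [measurable] = measurable_score[OF n j]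
  have ev: "{\<omega> \<in> G. P (?s \<omega>)} \<in> events" if [measurable]: "Measurable.pred borel P" for P
  proof -
    have "{\<omega> \<in> G. P (?s \<omega>)} = G \<inter> {\<omega> \<in> space (M n). P (?s \<omega>)}"
      using sets.sets_into_space[OF G] by auto
    moreover have "{\<omega> \<in> space (M n). P (?s \<omega>)} \<in> events" by measurable
    ultimately show ?thesis using G by auto
  qed
  show "{\<omega> \<in> G. \<bar>?s \<omega>\<bar> > \<sigma>} \<in> events" by (rule ev) measurable
  have "{\<omega> \<in> G. \<bar>?s \<omega>\<bar> > \<sigma>} \<subseteq> {\<omega> \<in> G. t * ?s \<omega> > t * \<sigma>} \<union> {\<omega> \<in> G. - t * ?s \<omega> > t * \<sigma>}"
  proof
    fix \<omega> assume "\<omega> \<in> {\<omega> \<in> G. \<bar>?s \<omega>\<bar> > \<sigma>}"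
    then have "\<omega> \<in> G" "?s \<omega> > \<sigma> \<or> - ?s \<omega> > \<sigma>" by auto
    then have "t * ?s \<omega> > t * \<sigma> \<or> t * (- ?s \<omega>) > t * \<sigma>"
      using t mult_strict_left_mono[OF _ t] by blast
    then show "\<omega> \<in> {\<omega> \<in> G. t * ?s \<omega> > t * \<sigma>} \<union> {\<omega> \<in> G. - t * ?s \<omega> > t * \<sigma>}"
      using \<open>\<omega> \<in> G\<close> by auto
  qed
  then have "prob {\<omega> \<in> G. \<bar>?s \<omega>\<bar> > \<sigma>} \<le> prob ({\<omega> \<in> G. t * ?s \<omega> > t * \<sigma>} \<union> {\<omega> \<in> G. - t * ?s \<omega> > t * \<sigma>})"
    by (intro finite_measure_mono sets.Un ev) measurable
  also have "\<dots> \<le> prob {\<omega> \<in> G. t * ?s \<omega> > t * \<sigma>} + prob {\<omega> \<in> G. - t * ?s \<omega> > t * \<sigma>}"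
    by (intro measure_Un_le ev) measurable
  also have "\<dots> \<le> exp (c - t * \<sigma>) + exp (c - t * \<sigma>)"
    using t by (intro add_mono score_tail_one n j G c) auto
  finally show "prob {\<omega> \<in> G. \<bar>?s \<omega>\<bar> > \<sigma>} \<le> 2 * exp (c - t * \<sigma>)" by simp
qed

end

section \<open>Elementary inequalities, in particular for binomial penalties\<close>

lemma square_sum_le_card:
  fixes v :: "'a \<Rightarrow> real"
  shows "(\<Sum>j\<in>J. \<bar>v j\<bar>)\<^sup>2 \<le> real (card J) * (\<Sum>j\<in>J. (v j)\<^sup>2)"
  using Cauchy_Schwarz_ineq_sum[of "\<lambda>_. 1" "\<lambda>j. \<bar>v j\<bar>" J] by simp

text \<open>With \<open>choose_le_pow\<close> this says that for model sizes up to q the binomial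
  coefficient is p ^ m up to a constant depending on q. The penalty thus becomes a power of
  p.\<close>

lemma choose_ge_pow: "real p ^ m \<le> real q ^ q * real (p choose m)" if "m \<le> q" "m \<le> p" "q \<ge> 1"
proof -
  have "(real p / real m) ^ m \<le> real (p choose m)"
    using binomial_ge_n_over_k_pow_k[OF that(2), where 'a = real] by simp
  moreover have "real m ^ m \<le> real q ^ q"
  proof -
    have "real m ^ m \<le> real q ^ m" using that by (intro power_mono) auto
    also have "\<dots> \<le> real q ^ q" using that by (intro power_increasing) auto
    finally show ?thesis .
  qed
  moreover have "real p ^ m = real m ^ m * (real p / real m) ^ m"
    by (cases "m = 0") (simp_all add: power_divide)
  ultimately show ?thesis
    by (metis mult_mono zero_le_power of_nat_0_le_iff zero_le_divide_iff)
qed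

lemma choose_le_pow: "real (p choose m) \<le> real p ^ m"
proof (cases "m \<le> p")
  case True
  then show ?thesis using binomial_le_pow[of m p] by (metis of_nat_le_iff of_nat_power)
qed (simp add: binomial_eq_0)

lemma choose_powr_ge: "real p powr (- (\<gamma> * real k)) \<le> real (p choose k) powr (- \<gamma>)"
  if "\<gamma> \<ge> 0" "k \<le> p" "p \<ge> 1"
proof -
  have "real (p choose k) powr \<gamma> \<le> (real p ^ k) powr \<gamma>"
    using that by (intro powr_mono2 choose_le_pow) auto
  also have "\<dots> = real p powr (\<gamma> * real k)"
    using that by (simp add: powr_realpow[symmetric] powr_powr mult.commute)
  finally show ?thesis
    using that by (simp add: powr_minus le_imp_inverse_le)
qed

lemma choose_powr_le: "real (p choose m) powr (- \<gamma>) \<le> real q powr (real q * \<gamma>) * real p powr (- (\<gamma> * real m))"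
  if "\<gamma> \<ge> 0" "m \<le> q" "m \<le> p" "q \<ge> 1" "p \<ge> 1"
proof -
  have c: "real (p choose m) > 0" using that by simp
  have "(real p ^ m) powr \<gamma> \<le> (real q ^ q * real (p choose m)) powr \<gamma>"
    using that by (intro powr_mono2 choose_ge_pow) auto
  also have "\<dots> = real q powr (real q * \<gamma>) * real (p choose m) powr \<gamma>"
    using that c by (simp add: powr_mult powr_realpow[symmetric] powr_powr)
  also have "(real p ^ m) powr \<gamma> = real p powr (\<gamma> * real m)"
    using that by (simp add: powr_realpow[symmetric] powr_powr mult.commute)
  finally have "real p powr (\<gamma> * real m) \<le> real q powr (real q * \<gamma>) * real (p choose m) powr \<gamma>" .
  moreover have "real p powr (\<gamma> * real m) > 0" "real (p choose m) powr \<gamma> > 0" using that c by auto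
  ultimately show ?thesis by (simp add: powr_minus field_simps)
qed

section \<open>Uniform lower bound for truncated empirical Gram matrices\<close>

context glm_sequence
begin

text \<open>Of the population eigenvalue bound a, truncation at T costs at most a / 4 by fourth
  moments, and random fluctuation at most another a / 4. Controlling the entries of the matrix gives
  all v at once, so no covering of the sphere is needed; truncated entries are bounded, so Hoeffding
  applies with an exponent linear in n.\<close>

lemma hessian_event:
  assumes n: "n \<ge> 1" and J: "J \<subseteq> {1..p n}" "card J \<le> d" "d \<ge> 1"
    and a: "a > 0" and T: "T > 0" "4 * real d ^ 2 * m4 \<le> a * T\<^sup>2" and m4: "m4 \<ge> 0"
    and moment: "\<And>j. j \<in> J \<Longrightarrow> (\<integral>\<^sup>+\<omega>. ennreal ((X n 1 j \<omega>) ^ 4) \<partial>M n) \<le> ennreal m4"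
    and loew: "loewner_le J (\<lambda>j k. if j = k then a else 0) (\<lambda>j k. \<integral>\<omega>. X n 1 j \<omega> * X n 1 k \<omega> \<partial>M n)"
  obtains Bd where "Bd \<in> sets (M n)"
    "measure (M n) Bd \<le> 2 * real d ^ 2 * exp (- (real n * (a / (4 * real d))\<^sup>2 / (2 * T ^ 4)))"
    "\<And>\<omega> (v :: nat \<Rightarrow> real). \<omega> \<in> space (M n) - Bd \<Longrightarrow>
      a / 2 * real n * (\<Sum>j\<in>J. (v j)\<^sup>2)
      \<le> (\<Sum>i\<in>{1..n}. if \<forall>l\<in>J. \<bar>cov_matrix n \<omega> i l\<bar> \<le> T then (\<Sum>j\<in>J. cov_matrix n \<omega> i j * v j)\<^sup>2 else 0)"
proof -
  interpret prob_space "M n" by (rule prob[OF n])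
  have fin: "finite J" using J finite_subset by blast
  let ?r = "covariate_row X p n"
  \<comment> \<open>All entries of a row are cut by the same indicator, so the truncated quadratic
    form is still a square. The rows that survive are those on which the linear predictor is
    bounded.\<close>
  define g where "g = (\<lambda>j k r. if \<forall>l\<in>J. \<bar>r l\<bar> \<le> T then r j * r k else 0 :: real)"
  have comp: "(\<lambda>r. r j) \<in> borel_measurable (PiM {1..p n} (\<lambda>_. borel))" if "j \<in> J" for j
    using that J by (intro measurable_component_singleton) auto
  have gm: "g j k \<in> borel_measurable (PiM {1..p n} (\<lambda>_. borel))" if "j \<in> J" "k \<in> J" for j k
  proof -
    note [measurable] = comp[OF that(1)] comp[OF that(2)]
    have [measurable]: "Measurable.pred (PiM {1..p n} (\<lambda>_. borel)) (\<lambda>r. \<forall>l\<in>J. \<bar>r l\<bar> \<le> T)"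
    proof (intro pred_intros_finite fin)
      fix l assume "l \<in> J"
      then have "l \<in> {1..p n}" using J by auto
      then show "Measurable.pred (PiM {1..p n} (\<lambda>_. borel)) (\<lambda>r. \<bar>r l\<bar> \<le> T)" by measurable
    qed
    show ?thesis unfolding g_def by measurable
  qed
  have gb: "\<bar>g j k r\<bar> \<le> T\<^sup>2" if "j \<in> J" "k \<in> J" for j k r
    using that T(1) by (auto simp: g_def abs_mult power2_eq_square intro!: mult_mono)
  define m where "m = (\<lambda>j k. \<integral>\<omega>. g j k (?r 1 \<omega>) \<partial>M n)"
  \<comment> \<open>An entrywise error of n * \<epsilon> changes the quadratic form by at most n *
    \<epsilon> * (\<Sum>j\<in>J. |v j|)^2, hence by n * \<epsilon> * d * V; with this \<epsilon>
    that is n * (a / 4) * V.\<close>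
  define \<epsilon> where "\<epsilon> = a / (4 * real d)"
  have \<epsilon>: "\<epsilon> > 0" using a J by (simp add: \<epsilon>_def)
  define A where "A = (\<lambda>(j, k). {\<omega> \<in> space (M n). \<bar>(\<Sum>i\<in>{1..n}. g j k (?r i \<omega>)) - real n * m j k\<bar> \<ge> real n * \<epsilon>})"
  define Bd where "Bd = (\<Union>z\<in>J \<times> J. A z)"
  have Am: "A z \<in> events" if "z \<in> J \<times> J" for z
  proof -
    obtain j k where z: "z = (j, k)" "j \<in> J" "k \<in> J" using \<open>z \<in> J \<times> J\<close> by auto
    note [measurable] = measurable_row_fun[OF n _ gm[OF z(2,3)]]
    show ?thesis unfolding A_def z prod.case by measurable
  qed
  have AP: "prob (A z) \<le> 2 * exp (- (real n * \<epsilon>\<^sup>2 / (2 * T ^ 4)))" if "z \<in> J \<times> J" for z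
  proof -
    obtain j k where z: "z = (j, k)" "j \<in> J" "k \<in> J" using \<open>z \<in> J \<times> J\<close> by auto
    have "prob (A z) \<le> 2 * exp (- (real n * \<epsilon>\<^sup>2 / (2 * (T\<^sup>2)\<^sup>2)))"
      unfolding A_def z m_def prod.case using \<epsilon> T(1) gb[OF z(2,3)]
      by (intro row_sum_Hoeffding n gm z) auto
    then show ?thesis by simp
  qed
  show ?thesis
  proof (rule that[of Bd])
    show "Bd \<in> sets (M n)" unfolding Bd_def using Am fin by auto
    have "card (J \<times> J) \<le> d ^ 2" using J(2) by (simp add: card_cartesian_product power2_eq_square mult_mono)
    then have "real (card (J \<times> J)) \<le> real d ^ 2" by (metis of_nat_le_iff of_nat_power)
    then have "prob Bd \<le> real d ^ 2 * (2 * exp (- (real n * \<epsilon>\<^sup>2 / (2 * T ^ 4))))"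
      unfolding Bd_def using fin Am AP by (intro prob_UN_le_card) auto
    then show "prob Bd \<le> 2 * real d ^ 2 * exp (- (real n * (a / (4 * real d))\<^sup>2 / (2 * T ^ 4)))"
      by (simp add: \<epsilon>_def)
    fix \<omega> and v :: "nat \<Rightarrow> real" assume \<omega>: "\<omega> \<in> space (M n) - Bd"
    define V where "V = (\<Sum>j\<in>J. (v j)\<^sup>2)"
    have V0: "V \<ge> 0" by (simp add: V_def sum_nonneg)
    have quad: "(\<Sum>j\<in>J. \<Sum>k\<in>J. v j * g j k r * v k) = (if \<forall>l\<in>J. \<bar>r l\<bar> \<le> T then (\<Sum>j\<in>J. r j * v j)\<^sup>2 else 0)" for r
    proof (cases "\<forall>l\<in>J. \<bar>r l\<bar> \<le> T")
      case True
      then have "g j k r = r j * r k" for j k by (simp add: g_def)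
      then show ?thesis unfolding if_P[OF True] by (simp add: power2_eq_square sum_product mult_ac)
    next
      case False
      then have "g j k r = 0" for j k unfolding g_def by (rule if_not_P)
      then show ?thesis unfolding if_not_P[OF False] by simp
    qed
    have XY: "X n 1 j \<omega> = ?r 1 \<omega> j" if "j \<in> J" for j \<omega> using that J by (auto simp: covariate_row_def)
    have int4: "integrable (M n) (\<lambda>\<omega>. (X n 1 j \<omega>) ^ 4)" and E4: "(\<integral>\<omega>. (X n 1 j \<omega>) ^ 4 \<partial>M n) \<le> m4" if j: "j \<in> J" for j
    proof -
      have [measurable]: "X n 1 j \<in> borel_measurable (M n)" using j J n by (intro measurable_X) auto
      show i: "integrable (M n) (\<lambda>\<omega>. (X n 1 j \<omega>) ^ 4)"
        using moment[OF j] by (intro integrableI_nonneg) (auto simp: less_top[symmetric] top_unique intro: le_less_trans)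
      show "(\<integral>\<omega>. (X n 1 j \<omega>) ^ 4 \<partial>M n) \<le> m4"
        using moment[OF j] m4 by (subst (asm) nn_integral_eq_integral[OF i]) (auto simp: ennreal_le_iff)
    qed
    have intXX: "integrable (M n) (\<lambda>\<omega>. X n 1 j \<omega> * X n 1 k \<omega>)" if jk: "j \<in> J" "k \<in> J" for j k
    proof (rule Bochner_Integration.integrable_bound)
      show "integrable (M n) (\<lambda>\<omega>. 1 + (X n 1 j \<omega>) ^ 4 + (X n 1 k \<omega>) ^ 4)" using int4 jk by auto
      have "X n 1 j \<in> borel_measurable (M n)" "X n 1 k \<in> borel_measurable (M n)"
        using jk J n by (auto intro!: measurable_X)
      then show "(\<lambda>\<omega>. X n 1 j \<omega> * X n 1 k \<omega>) \<in> borel_measurable (M n)" by measurable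
      have "\<bar>s * t\<bar> \<le> 1 + s ^ 4 + t ^ 4" for s t :: real
      proof -
        have "0 \<le> (\<bar>s\<bar> - \<bar>t\<bar>)\<^sup>2" "0 \<le> (s\<^sup>2 - 1)\<^sup>2" "0 \<le> (t\<^sup>2 - 1)\<^sup>2" by simp_all
        then have "2 * \<bar>s * t\<bar> \<le> s\<^sup>2 + t\<^sup>2" "2 * s\<^sup>2 \<le> s ^ 4 + 1" "2 * t\<^sup>2 \<le> t ^ 4 + 1"
          by (auto simp: power2_diff abs_mult)
        moreover have "0 \<le> s ^ 4" "0 \<le> t ^ 4" by auto
        ultimately show ?thesis by linarith
      qed
      then show "AE \<omega> in M n. norm (X n 1 j \<omega> * X n 1 k \<omega>) \<le> norm (1 + (X n 1 j \<omega>) ^ 4 + (X n 1 k \<omega>) ^ 4)"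
        by (intro AE_I2) (auto intro: order_trans[OF _ abs_ge_self])
    qed
    have intg: "integrable (M n) (\<lambda>\<omega>. g j k (?r 1 \<omega>))" if "j \<in> J" "k \<in> J" for j k
      using gb[OF that] n by (intro integrable_const_bound[where B = "T\<^sup>2"] measurable_row_fun gm that) auto
    \<comment> \<open>A discarded row has an entry beyond T, so a square is bounded by a fourth
      power over the square of T: the loss from truncation is a fourth moment.\<close>
    have tail: "(\<Sum>j\<in>J. r j * v j)\<^sup>2 - (if \<forall>l\<in>J. \<bar>r l\<bar> \<le> T then (\<Sum>j\<in>J. r j * v j)\<^sup>2 else 0)
        \<le> V * (real d / T\<^sup>2) * (\<Sum>j\<in>J. (r j) ^ 4)" for r
    proof (cases "\<forall>l\<in>J. \<bar>r l\<bar> \<le> T")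
      case True
      then show ?thesis using V0 by (simp add: sum_nonneg)
    next
      case False
      then obtain l where l: "l \<in> J" "\<bar>r l\<bar> > T" by auto
      define Q where "Q = (\<Sum>j\<in>J. (r j) ^ 4)"
      have Q: "(r j) ^ 4 \<le> Q" if "j \<in> J" for j
        unfolding Q_def using that fin by (intro member_le_sum) auto
      have bd: "(r j)\<^sup>2 \<le> Q / T\<^sup>2" if j: "j \<in> J" for j
      proof -
        have Tsq: "T\<^sup>2 > 0" using T by simp
        have "(r j)\<^sup>2 * T\<^sup>2 \<le> Q"
        \<comment> \<open>If r j itself reaches T, its own fourth power suffices; otherwise the
          entry l beyond T is larger than both r j and T.\<close>
        proof (cases "\<bar>r j\<bar> \<ge> T")
          case True
          then have "T\<^sup>2 \<le> (r j)\<^sup>2" using T(1) by (metis abs_le_square_iff abs_of_pos)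
          then have "(r j)\<^sup>2 * T\<^sup>2 \<le> (r j)\<^sup>2 * (r j)\<^sup>2" by (intro mult_left_mono) auto
          also have "\<dots> = (r j) ^ 4" by simp
          finally show ?thesis using Q[OF j] by simp
        next
          case False
          then have "(r j)\<^sup>2 \<le> (r l)\<^sup>2" using l(2) by (intro iffD1[OF abs_le_square_iff]) auto
          moreover have "T\<^sup>2 \<le> (r l)\<^sup>2" using l(2) T(1) by (intro iffD1[OF abs_le_square_iff]) auto
          ultimately have "(r j)\<^sup>2 * T\<^sup>2 \<le> (r l)\<^sup>2 * (r l)\<^sup>2" by (intro mult_mono) auto
          also have "\<dots> = (r l) ^ 4" by simp
          finally show ?thesis using Q[OF l(1)] by simp
        qed
        then show ?thesis using Tsq by (simp add: field_simps)
      qed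
      have "(\<Sum>j\<in>J. r j * v j)\<^sup>2 \<le> (\<Sum>j\<in>J. (r j)\<^sup>2) * (\<Sum>j\<in>J. (v j)\<^sup>2)"
        by (rule Cauchy_Schwarz_ineq_sum)
      also have "(\<Sum>j\<in>J. (r j)\<^sup>2) \<le> real (card J) * (Q / T\<^sup>2)"
        using sum_bounded_above[of J "\<lambda>j. (r j)\<^sup>2" "Q / T\<^sup>2"] bd by simp
      also have "\<dots> \<le> real d * (Q / T\<^sup>2)"
        using J(2) Q[OF l(1)] by (intro mult_right_mono) (auto intro!: divide_nonneg_nonneg intro: order_trans[of _ "r l ^ 4"])
      finally have "(\<Sum>j\<in>J. r j * v j)\<^sup>2 \<le> real d * (Q / T\<^sup>2) * V"
        using V0 by (simp add: V_def mult_right_mono)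
      then show ?thesis using False by (auto simp: Q_def mult_ac)
    qed
    \<comment> \<open>The loss V * d^2 * m4 / T^2 is at most a / 4 * V by the assumption that T is
      large compared with m4.\<close>
    have main: "(\<Sum>j\<in>J. \<Sum>k\<in>J. v j * m j k * v k) \<ge> 3 / 4 * a * V"
    proof -
      have "a * V \<le> (\<Sum>j\<in>J. \<Sum>k\<in>J. v j * (\<integral>\<omega>. X n 1 j \<omega> * X n 1 k \<omega> \<partial>M n) * v k)"
      proof -
        have eq: "(\<Sum>j\<in>J. \<Sum>k\<in>J. v j * (if j = k then a else 0) * v k) = a * V"
          unfolding V_def sum_distrib_left
        proof (rule sum.cong[OF refl])
          fix j assume "j \<in> J"
          have "(\<Sum>k\<in>J. v j * (if j = k then a else 0) * v k) = (\<Sum>k\<in>J. if j = k then a * (v j)\<^sup>2 else 0)"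
            by (intro sum.cong) (auto simp: power2_eq_square)
          then show "(\<Sum>k\<in>J. v j * (if j = k then a else 0) * v k) = a * (v j)\<^sup>2" using fin \<open>j \<in> J\<close> by simp
        qed
        have "(\<Sum>j\<in>J. \<Sum>k\<in>J. v j * (if j = k then a else 0) * v k)
            \<le> (\<Sum>j\<in>J. \<Sum>k\<in>J. v j * (\<integral>\<omega>. X n 1 j \<omega> * X n 1 k \<omega> \<partial>M n) * v k)"
          using loew unfolding loewner_le_def by (rule spec)
        then show ?thesis unfolding eq .
      qed
      also have "\<dots> = (\<integral>\<omega>. (\<Sum>j\<in>J. \<Sum>k\<in>J. v j * (X n 1 j \<omega> * X n 1 k \<omega>) * v k) \<partial>M n)"
        using intXX by (simp add: Bochner_Integration.integral_sum)
      also have "\<dots> \<le> (\<integral>\<omega>. (\<Sum>j\<in>J. \<Sum>k\<in>J. v j * g j k (?r 1 \<omega>) * v k) + V * (real d / T\<^sup>2) * (\<Sum>j\<in>J. (X n 1 j \<omega>) ^ 4) \<partial>M n)"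
      proof (rule integral_mono)
        show "integrable (M n) (\<lambda>\<omega>. \<Sum>j\<in>J. \<Sum>k\<in>J. v j * (X n 1 j \<omega> * X n 1 k \<omega>) * v k)"
          using intXX by auto
        show "integrable (M n) (\<lambda>\<omega>. (\<Sum>j\<in>J. \<Sum>k\<in>J. v j * g j k (?r 1 \<omega>) * v k) + V * (real d / T\<^sup>2) * (\<Sum>j\<in>J. (X n 1 j \<omega>) ^ 4))"
          using intg int4 by auto
        fix \<omega>
        have "(\<Sum>j\<in>J. \<Sum>k\<in>J. v j * (X n 1 j \<omega> * X n 1 k \<omega>) * v k) = (\<Sum>j\<in>J. ?r 1 \<omega> j * v j)\<^sup>2"
          by (simp add: power2_eq_square sum_product mult_ac XY cong: sum.cong)
        then show "(\<Sum>j\<in>J. \<Sum>k\<in>J. v j * (X n 1 j \<omega> * X n 1 k \<omega>) * v k)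
          \<le> (\<Sum>j\<in>J. \<Sum>k\<in>J. v j * g j k (?r 1 \<omega>) * v k) + V * (real d / T\<^sup>2) * (\<Sum>j\<in>J. (X n 1 j \<omega>) ^ 4)"
          using tail[of "?r 1 \<omega>"] unfolding quad by (simp add: XY cong: sum.cong)
      qed
      also have "\<dots> = (\<Sum>j\<in>J. \<Sum>k\<in>J. v j * m j k * v k) + V * (real d / T\<^sup>2) * (\<Sum>j\<in>J. \<integral>\<omega>. (X n 1 j \<omega>) ^ 4 \<partial>M n)"
        unfolding m_def using intg int4 by (simp add: Bochner_Integration.integral_sum)
      also have "V * (real d / T\<^sup>2) * (\<Sum>j\<in>J. \<integral>\<omega>. (X n 1 j \<omega>) ^ 4 \<partial>M n) \<le> V * (real d / T\<^sup>2) * (real d * m4)"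
      proof (intro mult_left_mono)
        have "(\<Sum>j\<in>J. \<integral>\<omega>. (X n 1 j \<omega>) ^ 4 \<partial>M n) \<le> real (card J) * m4"
          using sum_bounded_above[of J "\<lambda>j. \<integral>\<omega>. (X n 1 j \<omega>) ^ 4 \<partial>M n" m4] E4 by simp
        also have "\<dots> \<le> real d * m4" using J(2) m4 by (intro mult_right_mono) auto
        finally show "(\<Sum>j\<in>J. \<integral>\<omega>. (X n 1 j \<omega>) ^ 4 \<partial>M n) \<le> real d * m4" .
      qed (use V0 in auto)
      also have "V * (real d / T\<^sup>2) * (real d * m4) \<le> V * (a / 4)"
      proof -
        have "(real d / T\<^sup>2) * (real d * m4) \<le> a / 4"
          using T by (simp add: field_simps power2_eq_square)
        then show ?thesis using V0 unfolding mult.assoc by (rule mult_left_mono)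
      qed
      finally show ?thesis by (simp add: algebra_simps)
    qed
    have dev: "\<bar>(\<Sum>i\<in>{1..n}. g j k (?r i \<omega>)) - real n * m j k\<bar> \<le> real n * \<epsilon>" if "j \<in> J" "k \<in> J" for j k
    proof -
      have "\<omega> \<notin> A (j, k)" using \<omega> that unfolding Bd_def by auto
      then show ?thesis using \<omega> unfolding A_def by auto
    qed
    have "(\<Sum>i\<in>{1..n}. if \<forall>l\<in>J. \<bar>cov_matrix n \<omega> i l\<bar> \<le> T then (\<Sum>j\<in>J. cov_matrix n \<omega> i j * v j)\<^sup>2 else 0)
       = (\<Sum>i\<in>{1..n}. \<Sum>j\<in>J. \<Sum>k\<in>J. v j * g j k (?r i \<omega>) * v k)"
      unfolding quad by (intro sum.cong refl) (simp only: cov_matrix_row)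
    also have "\<dots> = (\<Sum>j\<in>J. \<Sum>k\<in>J. v j * (\<Sum>i\<in>{1..n}. g j k (?r i \<omega>)) * v k)"
      by (simp only: sum_distrib_left sum_distrib_right sum.swap[of _ J "{1..n}"])
    also have "\<dots> \<ge> (\<Sum>j\<in>J. \<Sum>k\<in>J. real n * (v j * m j k * v k) - real n * \<epsilon> * (\<bar>v j\<bar> * \<bar>v k\<bar>))"
    proof (intro sum_mono)
      fix j k assume jk: "j \<in> J" "k \<in> J"
      have "- (\<bar>v j * v k\<bar> * \<bar>(\<Sum>i\<in>{1..n}. g j k (?r i \<omega>)) - real n * m j k\<bar>)
         \<le> v j * v k * ((\<Sum>i\<in>{1..n}. g j k (?r i \<omega>)) - real n * m j k)"
        by (metis abs_ge_minus_self abs_mult minus_le_iff)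
      moreover have "\<bar>v j * v k\<bar> * \<bar>(\<Sum>i\<in>{1..n}. g j k (?r i \<omega>)) - real n * m j k\<bar> \<le> \<bar>v j * v k\<bar> * (real n * \<epsilon>)"
        using dev[OF jk] by (intro mult_left_mono) auto
      ultimately show "real n * (v j * m j k * v k) - real n * \<epsilon> * (\<bar>v j\<bar> * \<bar>v k\<bar>) \<le> v j * (\<Sum>i\<in>{1..n}. g j k (?r i \<omega>)) * v k"
        by (simp add: abs_mult algebra_simps)
    qed
    also have "(\<Sum>j\<in>J. \<Sum>k\<in>J. real n * (v j * m j k * v k) - real n * \<epsilon> * (\<bar>v j\<bar> * \<bar>v k\<bar>))
       = real n * (\<Sum>j\<in>J. \<Sum>k\<in>J. v j * m j k * v k) - real n * \<epsilon> * (\<Sum>j\<in>J. \<bar>v j\<bar>)\<^sup>2"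
      by (simp add: sum_subtractf sum_distrib_left[symmetric] power2_eq_square sum_product)
    finally have fin1: "real n * (\<Sum>j\<in>J. \<Sum>k\<in>J. v j * m j k * v k) - real n * \<epsilon> * (\<Sum>j\<in>J. \<bar>v j\<bar>)\<^sup>2
      \<le> (\<Sum>i\<in>{1..n}. if \<forall>l\<in>J. \<bar>cov_matrix n \<omega> i l\<bar> \<le> T then (\<Sum>j\<in>J. cov_matrix n \<omega> i j * v j)\<^sup>2 else 0)" .
    have "(\<Sum>j\<in>J. \<bar>v j\<bar>)\<^sup>2 \<le> real d * V"
    proof -
      have "(\<Sum>j\<in>J. \<bar>v j\<bar>)\<^sup>2 \<le> real (card J) * V" unfolding V_def by (rule square_sum_le_card)
      also have "\<dots> \<le> real d * V" using J V0 by (intro mult_right_mono) auto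
      finally show ?thesis .
    qed
    then have "real n * \<epsilon> * (\<Sum>j\<in>J. \<bar>v j\<bar>)\<^sup>2 \<le> real n * \<epsilon> * (real d * V)"
      using \<epsilon> by (intro mult_left_mono) auto
    also have "\<dots> = real n * (a / 4 * V)" using J by (simp add: \<epsilon>_def)
    finally have "real n * (3 / 4 * a * V) - real n * (a / 4 * V)
       \<le> real n * (\<Sum>j\<in>J. \<Sum>k\<in>J. v j * m j k * v k) - real n * \<epsilon> * (\<Sum>j\<in>J. \<bar>v j\<bar>)\<^sup>2"
      using main by (intro diff_mono mult_left_mono) auto
    also have "real n * (3 / 4 * a * V) - real n * (a / 4 * V) = a / 2 * real n * V" by simp
    finally show "a / 2 * real n * (\<Sum>j\<in>J. (v j)\<^sup>2)
      \<le> (\<Sum>i\<in>{1..n}. if \<forall>l\<in>J. \<bar>cov_matrix n \<omega> i l\<bar> \<le> T then (\<Sum>j\<in>J. cov_matrix n \<omega> i j * v j)\<^sup>2 else 0)"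
      using fin1 unfolding V_def by linarith
  qed
qed

end

lemma card_small_subsets_le: "real (card {J. J \<subseteq> {1..p} \<and> card J \<le> q}) \<le> (real q + 1) * real p ^ q" if "p \<ge> 1" for p :: nat
proof -
  have "{J. J \<subseteq> {1..p} \<and> card J \<le> q} = (\<Union>k\<in>{..q}. {J. J \<subseteq> {1..p} \<and> card J = k})" by auto
  then have "card {J. J \<subseteq> {1..p} \<and> card J \<le> q} \<le> (\<Sum>k\<le>q. card {J. J \<subseteq> {1..p} \<and> card J = k})"
    by (simp add: card_UN_le)
  also have "\<dots> = (\<Sum>k\<le>q. p choose k)" by (simp add: n_subsets)
  finally have "real (card {J. J \<subseteq> {1..p} \<and> card J \<le> q}) \<le> (\<Sum>k\<le>q. real (p choose k))"
    by (metis of_nat_le_iff of_nat_sum)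
  also have "\<dots> \<le> (\<Sum>k\<le>q. real p ^ q)"
  proof (rule sum_mono)
    fix k assume "k \<in> {..q}"
    then have "real p ^ k \<le> real p ^ q" using that by (intro power_increasing) auto
    then show "real (p choose k) \<le> real p ^ q" using choose_le_pow[of p k] by linarith
  qed
  finally show ?thesis by (simp add: add.commute)
qed

section \<open>Deterministic comparison of two scores and bounds for the curvature\<close>

context exponential_family
begin

text \<open>For supersets of the truth D will be a cube around it and U the level from Markov's
  inequality. For models that miss a true covariate D is empty and U = 0, as all their parameters
  are far from the truth.\<close>

lemma bayes_score_less:
  assumes J0: "J0 \<subseteq> {1..p}" "card J0 \<le> q" "\<And>j. j \<in> {1..p} - J0 \<Longrightarrow> \<phi>0 j = 0"
    and J: "J \<subseteq> {1..p}" "card J \<le> q"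
    and h: "h \<ge> 0" and F: "F \<ge> 0" "\<And>\<phi>. \<phi> \<in> coord_cube J0 \<phi>0 h \<Longrightarrow> F \<le> f J0 \<phi>"
    and f0: "f J0 \<in> borel_measurable (lebesgue_on_coords J0)"
    and f: "f J \<in> borel_measurable (lebesgue_on_coords J)"
      "\<And>\<phi>. \<phi> \<in> space (lebesgue_on_coords J) \<Longrightarrow> 0 \<le> f J \<phi>"
      "(\<integral>\<^sup>+\<phi>. ennreal (f J \<phi>) \<partial>lebesgue_on_coords J) = 1"
    and curv: "\<And>u. (\<And>j. j \<in> {1..p} - J0 \<Longrightarrow> u j = 0) \<Longrightarrow> (\<And>j. j \<in> J0 \<Longrightarrow> \<bar>u j\<bar> \<le> h) \<Longrightarrow> curv n p x \<phi>0 u \<le> C"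
    and D: "D \<in> sets (lebesgue_on_coords J)" "marginal_on n p x y \<phi>0 (f J) J D \<le> ennreal U" "U \<ge> 0"
    and llr: "\<And>\<phi>. \<phi> \<in> space (lebesgue_on_coords J) - D \<Longrightarrow> llr n p x y \<phi>0 (\<lambda>j. zero_ext J \<phi> j - \<phi>0 j) \<le> - m"
    and num: "real (p choose card J) powr (- \<gamma>) * (U + exp (- m))
      < real (p choose card J0) powr (- \<gamma>) * (F * exp (- C) * (2 * h) ^ card J0)"
  shows "bayes_score (cgf \<mu>) n p q \<gamma> f x y J < bayes_score (cgf \<mu>) n p q \<gamma> f x y J0"
proof -
  let ?l = "likelihood (cgf \<mu>) n p x y \<phi>0"
  let ?b = "\<lambda>J. real (p choose card J) powr (- \<gamma>)"
  have l: "?l > 0" by (rule likelihood_pos)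
  have fin: "finite J" using J(1) finite_subset by blast
  have "marginal_on n p x y \<phi>0 (f J) J UNIV \<le> marginal_on n p x y \<phi>0 (f J) J D + ennreal (exp (- m))"
    using llr by (intro marginal_upper[OF fin D(1) f]) auto
  also have "\<dots> \<le> ennreal U + ennreal (exp (- m))" using D(2) by (intro add_right_mono)
  also have "\<dots> = ennreal (U + exp (- m))" using D(3) by simp
  finally have "bayes_score (cgf \<mu>) n p q \<gamma> f x y J \<le> ennreal (?l * ?b J) * ennreal (U + exp (- m))"
    unfolding bayes_score_eq[where f = f and ?\<phi>0.0 = \<phi>0, OF J(2) f(1)] by (intro mult_left_mono) auto
  also have "\<dots> = ennreal (?l * (?b J * (U + exp (- m))))"
    using l D(3) by (simp add: ennreal_mult[symmetric] mult.assoc del: ennreal_plus)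
  also have "\<dots> < ennreal (?l * (?b J0 * (F * exp (- C) * (2 * h) ^ card J0)))"
    using l D(3) by (intro ennreal_less_iff[THEN iffD2] mult_strict_left_mono[OF num]) auto
  also have "\<dots> = ennreal (?l * ?b J0) * ennreal (F * exp (- C) * (2 * h) ^ card J0)"
    using l F(1) h by (simp add: ennreal_mult[symmetric] mult.assoc)
  also have "\<dots> \<le> bayes_score (cgf \<mu>) n p q \<gamma> f x y J0"
    unfolding bayes_score_eq[where f = f and ?\<phi>0.0 = \<phi>0, OF J0(2) f0]
    by (intro mult_left_mono marginal_lower J0 h F f0 curv) auto
  finally show ?thesis .
qed

text \<open>On a row with all entries in S bounded by T, the true predictor is at most a3 * q * T
  and the displacement is at most \<rho> * d * T \<le> 1, so \<open>breg\<close> turns the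
  divergence into a square. All other rows contribute nonnegative divergences and are dropped. The
  truncated Gram matrix is what remains, and \<open>llr_le_outside\<close> applies.\<close>

lemma llr_le_of_hessian:
  assumes J0: "J0 \<subseteq> {1..p}" "\<And>j. j \<in> {1..p} - J0 \<Longrightarrow> \<phi>0 j = 0" "\<And>j. j \<in> J0 \<Longrightarrow> \<bar>\<phi>0 j\<bar> \<le> a3"
    and J: "J \<subseteq> {1..p}" and S: "S = J \<union> J0" "card S \<le> d" "card J0 \<le> q"
    and pos: "\<rho> > 0" "m \<ge> 0" "T > 0" "c > 0" "\<sigma> \<ge> 0" "a3 \<ge> 0"
    and breg: "\<And>\<theta> h. \<bar>\<theta>\<bar> \<le> a3 * (real q * T) \<Longrightarrow> \<bar>h\<bar> \<le> 1 \<Longrightarrow> bregman \<theta> h \<ge> c * h\<^sup>2"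
    and hess: "\<And>v. a / 2 * real n * (\<Sum>j\<in>S. (v j)\<^sup>2)
      \<le> (\<Sum>i\<in>{1..n}. if \<forall>l\<in>S. \<bar>x i l\<bar> \<le> T then (\<Sum>j\<in>S. x i j * v j)\<^sup>2 else 0)"
    and score: "\<And>j. j \<in> {1..p} \<Longrightarrow> \<bar>score n p x y \<phi>0 j\<bar> \<le> \<sigma>"
    and small: "\<rho> * (real d * T) \<le> 1"
    and le: "\<sigma> * (real d * \<rho>) - c * a / 2 * real n * \<rho>\<^sup>2 \<le> - m"
    and far: "\<exists>j\<in>S. \<rho> \<le> \<bar>zero_ext J \<phi> j - \<phi>0 j\<bar>"
  shows "llr n p x y \<phi>0 (\<lambda>j. zero_ext J \<phi> j - \<phi>0 j) \<le> - m"
proof -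
  have Sp: "S \<subseteq> {1..p}" using S J J0 by auto
  have fin: "finite S" using Sp finite_subset by blast
  show ?thesis
  proof (rule llr_le_outside[where S = S and \<sigma> = \<sigma> and k = "c * a / 2 * real n" and \<rho> = \<rho>])
    show "zero_ext J \<phi> j - \<phi>0 j = 0" if "j \<in> {1..p} - S" for j
      using that S J0(2) by (auto simp: zero_ext_def)
    obtain j where "j \<in> S" "\<rho> \<le> \<bar>zero_ext J \<phi> j - \<phi>0 j\<bar>" using far by blast
    then show "\<rho> \<le> L2_set (\<lambda>j. zero_ext J \<phi> j - \<phi>0 j) S"
      using L2_set_member_abs[OF fin, of j "\<lambda>j. zero_ext J \<phi> j - \<phi>0 j"] by linarith
    have "\<sigma> * (real (card S) * \<rho>) \<le> \<sigma> * (real d * \<rho>)"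
      using S pos by (intro mult_left_mono mult_right_mono) auto
    then show "\<sigma> * (real (card S) * \<rho>) - c * a / 2 * real n * \<rho>\<^sup>2 \<le> - m" using le by linarith
    fix v :: "nat \<Rightarrow> real" assume v: "\<And>j. j \<in> {1..p} - S \<Longrightarrow> v j = 0" "L2_set v S = \<rho>"
    have V: "(\<Sum>j\<in>S. (v j)\<^sup>2) = \<rho>\<^sup>2"
      using v(2) by (metis L2_set_def L2_set_nonneg real_sqrt_pow2 sum_nonneg zero_le_power2)
    have "c * (if \<forall>l\<in>S. \<bar>x i l\<bar> \<le> T then (\<Sum>j\<in>S. x i j * v j)\<^sup>2 else 0)
        \<le> bregman (dot p (x i) \<phi>0) (dot p (x i) v)" for i
    proof (cases "\<forall>l\<in>S. \<bar>x i l\<bar> \<le> T")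
      case True
      have d: "dot p (x i) v = (\<Sum>j\<in>S. x i j * v j)"
        unfolding dot_def using Sp v(1) by (intro sum.mono_neutral_right) auto
      have "\<bar>dot p (x i) \<phi>0\<bar> \<le> a3 * (\<Sum>j\<in>J0. \<bar>x i j\<bar>)"
        by (intro abs_dot_le J0)
      also have "(\<Sum>j\<in>J0. \<bar>x i j\<bar>) \<le> real (card J0) * T"
        using True S sum_bounded_above[of J0 "\<lambda>j. \<bar>x i j\<bar>" T] by auto
      also have "\<dots> \<le> real q * T" using S pos by (intro mult_right_mono) auto
      finally have 1: "\<bar>dot p (x i) \<phi>0\<bar> \<le> a3 * (real q * T)" using pos by (simp add: mult_left_mono)
      have "\<bar>dot p (x i) v\<bar> \<le> \<rho> * (\<Sum>j\<in>S. \<bar>x i j\<bar>)"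
        using v(2) L2_set_member_abs[OF fin, of _ v] by (intro abs_dot_le Sp v) auto
      also have "(\<Sum>j\<in>S. \<bar>x i j\<bar>) \<le> real (card S) * T"
        using True sum_bounded_above[of S "\<lambda>j. \<bar>x i j\<bar>" T] by auto
      also have "\<dots> \<le> real d * T" using S pos by (intro mult_right_mono) auto
      finally have "\<bar>dot p (x i) v\<bar> \<le> 1" using small pos by (simp add: mult_left_mono)
      from breg[OF 1 this] show ?thesis unfolding if_P[OF True] d .
    next
      case False
      then show ?thesis unfolding if_not_P[OF False] by (simp add: bregman_nonneg)
    qed
    then have "(\<Sum>i\<in>{1..n}. c * (if \<forall>l\<in>S. \<bar>x i l\<bar> \<le> T then (\<Sum>j\<in>S. x i j * v j)\<^sup>2 else 0)) \<le> curv n p x \<phi>0 v"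
      unfolding curv_def by (intro sum_mono)
    moreover have "c * (a / 2 * real n * (\<Sum>j\<in>S. (v j)\<^sup>2))
       \<le> c * (\<Sum>i\<in>{1..n}. if \<forall>l\<in>S. \<bar>x i l\<bar> \<le> T then (\<Sum>j\<in>S. x i j * v j)\<^sup>2 else 0)"
      using hess pos by (intro mult_left_mono) auto
    ultimately show "c * a / 2 * real n * \<rho>\<^sup>2 \<le> curv n p x \<phi>0 v"
      unfolding V sum_distrib_left[symmetric] by simp
  qed (use Sp pos score in auto)
qed

text \<open>One factor q comes from Cauchy-Schwarz on the sum over J, the other from adding the
  bounds for the at most q coordinates. The weighted sums of squares involve single coordinates, so
  a union over p of them controls every model.\<close>

lemma curv_upper:
  assumes J: "J \<subseteq> {1..p}" "card J \<le> q" and h: "h \<ge> 0"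
    and u: "\<And>j. j \<in> {1..p} - J \<Longrightarrow> u j = 0" "\<And>j. j \<in> J \<Longrightarrow> \<bar>u j\<bar> \<le> h"
    and small: "\<And>i j. i \<in> {1..n} \<Longrightarrow> j \<in> {1..p} \<Longrightarrow> real q * h * \<bar>x i j\<bar> \<le> 1"
    and sup: "\<And>j. j \<in> {1..p} \<Longrightarrow> (\<Sum>i\<in>{1..n}. (x i j)\<^sup>2 * sup_cgf'' (dot p (x i) \<phi>0)) \<le> C * real n"
    and C: "C \<ge> 0"
  shows "curv n p x \<phi>0 u \<le> real q ^ 2 * h\<^sup>2 * (C * real n) / 2"
proof -
  have fin: "finite J" using J finite_subset by blast
  have "bregman (dot p (x i) \<phi>0) (dot p (x i) u)
      \<le> (\<Sum>j\<in>J. real q * h\<^sup>2 / 2 * ((x i j)\<^sup>2 * sup_cgf'' (dot p (x i) \<phi>0)))" if i: "i \<in> {1..n}" for i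
  proof -
    let ?w = "sup_cgf'' (dot p (x i) \<phi>0)"
    have w: "?w > 0" by (rule sup_cgf''_pos)
    have d: "\<bar>dot p (x i) u\<bar> \<le> h * (\<Sum>j\<in>J. \<bar>x i j\<bar>)" by (intro abs_dot_le J u)
    have "\<bar>dot p (x i) u\<bar> \<le> 1"
    proof (cases "J = {}")
      case False
      have q: "q > 0" using False J(2) fin by (metis card_gt_0_iff order_less_le_trans)
      have "h * (\<Sum>j\<in>J. \<bar>x i j\<bar>) = (\<Sum>j\<in>J. h * \<bar>x i j\<bar>)" by (simp add: sum_distrib_left)
      also have "\<dots> \<le> (\<Sum>j\<in>J. 1 / real q)"
        using small[OF i] J(1) q by (intro sum_mono) (auto simp: field_simps)
      also have "\<dots> \<le> 1" using J(2) q by (simp add: field_simps)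
      finally show ?thesis using d by linarith
    qed (use d in simp)
    then have "bregman (dot p (x i) \<phi>0) (dot p (x i) u) \<le> ?w / 2 * (dot p (x i) u)\<^sup>2"
      by (rule bregman_upper)
    also have "(dot p (x i) u)\<^sup>2 \<le> (h * (\<Sum>j\<in>J. \<bar>x i j\<bar>))\<^sup>2"
      using d by (metis abs_ge_zero power2_abs power_mono)
    also have "(h * (\<Sum>j\<in>J. \<bar>x i j\<bar>))\<^sup>2 = h\<^sup>2 * (\<Sum>j\<in>J. \<bar>x i j\<bar>)\<^sup>2" by (rule power_mult_distrib)
    also have "(\<Sum>j\<in>J. \<bar>x i j\<bar>)\<^sup>2 \<le> real (card J) * (\<Sum>j\<in>J. (x i j)\<^sup>2)" by (rule square_sum_le_card)
    also have "\<dots> \<le> real q * (\<Sum>j\<in>J. (x i j)\<^sup>2)" using J(2) by (intro mult_right_mono sum_nonneg) auto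
    finally have "bregman (dot p (x i) \<phi>0) (dot p (x i) u) \<le> ?w / 2 * (h\<^sup>2 * (real q * (\<Sum>j\<in>J. (x i j)\<^sup>2)))"
      using w by (simp add: mult_left_mono)
    also have "\<dots> = (\<Sum>j\<in>J. real q * h\<^sup>2 / 2 * ((x i j)\<^sup>2 * ?w))"
      by (simp add: sum_distrib_left mult_ac)
    finally show ?thesis .
  qed
  then have "curv n p x \<phi>0 u \<le> (\<Sum>i\<in>{1..n}. \<Sum>j\<in>J. real q * h\<^sup>2 / 2 * ((x i j)\<^sup>2 * sup_cgf'' (dot p (x i) \<phi>0)))"
    unfolding curv_def by (intro sum_mono)
  also have "\<dots> = (\<Sum>j\<in>J. real q * h\<^sup>2 / 2 * (\<Sum>i\<in>{1..n}. (x i j)\<^sup>2 * sup_cgf'' (dot p (x i) \<phi>0)))"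
    by (subst sum.swap) (simp add: sum_distrib_left)
  also have "\<dots> \<le> (\<Sum>j\<in>J. real q * h\<^sup>2 / 2 * (C * real n))"
    using sup J(1) by (intro sum_mono mult_left_mono) auto
  also have "\<dots> = real (card J) * (real q * h\<^sup>2 / 2 * (C * real n))" by simp
  also have "\<dots> \<le> real q * (real q * h\<^sup>2 / 2 * (C * real n))"
    using J(2) C by (intro mult_right_mono) auto
  finally show ?thesis by (simp add: power2_eq_square mult_ac)
qed

lemma curv_unit:
  assumes j: "j \<in> {1..p}" and small: "\<And>i. i \<in> {1..n} \<Longrightarrow> \<bar>s\<bar> * \<bar>x i j\<bar> \<le> 1"
    and sup: "(\<Sum>i\<in>{1..n}. (x i j)\<^sup>2 * sup_cgf'' (dot p (x i) \<phi>0)) \<le> C * real n"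
  shows "curv n p x \<phi>0 (\<lambda>k. if k = j then s else 0) \<le> s\<^sup>2 * (C * real n) / 2"
proof -
  have d: "dot p (x i) (\<lambda>k. if k = j then s else 0) = s * x i j" for i
  proof -
    have "dot p (x i) (\<lambda>k. if k = j then s else 0) = (\<Sum>k\<in>{1..p}. if k = j then s * x i j else 0)"
      unfolding dot_def by (intro sum.cong) auto
    also have "\<dots> = s * x i j" using j by (simp only: sum.delta finite_atLeastAtMost if_True)
    finally show ?thesis .
  qed
  have "curv n p x \<phi>0 (\<lambda>k. if k = j then s else 0)
      \<le> (\<Sum>i\<in>{1..n}. s\<^sup>2 / 2 * ((x i j)\<^sup>2 * sup_cgf'' (dot p (x i) \<phi>0)))"
    unfolding curv_def d
  proof (intro sum_mono)
    fix i assume "i \<in> {1..n}"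
    then have "bregman (dot p (x i) \<phi>0) (s * x i j) \<le> sup_cgf'' (dot p (x i) \<phi>0) / 2 * (s * x i j)\<^sup>2"
      using small by (intro bregman_upper) (simp add: abs_mult)
    then show "bregman (dot p (x i) \<phi>0) (s * x i j) \<le> s\<^sup>2 / 2 * ((x i j)\<^sup>2 * sup_cgf'' (dot p (x i) \<phi>0))"
      by (simp add: power_mult_distrib mult_ac)
  qed
  also have "\<dots> = s\<^sup>2 / 2 * (\<Sum>i\<in>{1..n}. (x i j)\<^sup>2 * sup_cgf'' (dot p (x i) \<phi>0))"
    by (simp add: sum_distrib_left)
  also have "\<dots> \<le> s\<^sup>2 / 2 * (C * real n)" using sup by (intro mult_left_mono) auto
  finally show ?thesis by simp
qed

end

section \<open>Measurability of the selection event\<close>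

context glm_sequence
begin

lemma true_support_subset: "true_support p \<phi>s n \<subseteq> {1..p n}"
  by (auto simp: true_support_def)

lemma bayes_selects_truth_eq:
  "bayes_selects_truth \<mu> M X Y p \<phi>s q \<gamma> f n = {\<omega> \<in> space (M n).
    \<forall>J\<in>{J. J \<subseteq> {1..p n} \<and> J \<noteq> true_support p \<phi>s n \<and> card J \<le> q}.
      bayes_score (cgf \<mu>) n (p n) q \<gamma> (f n) (cov_matrix n \<omega>) (responses n \<omega>) J
      < bayes_score (cgf \<mu>) n (p n) q \<gamma> (f n) (cov_matrix n \<omega>) (responses n \<omega>) (true_support p \<phi>s n)}"
  by (simp add: bayes_selects_truth_def bayes_score_def likelihood_cov_matrix Let_def)

lemma sets_bayes_selects_truth:
  assumes n: "n \<ge> 1" and q: "card (true_support p \<phi>s n) \<le> q"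
    and f: "\<And>J. J \<subseteq> {1..p n} \<Longrightarrow> card J \<le> q \<Longrightarrow> f n J \<in> borel_measurable (lebesgue_on_coords J)"
  shows "bayes_selects_truth \<mu> M X Y p \<phi>s q \<gamma> f n \<in> sets (M n)"
proof -
  have m: "(\<lambda>\<omega>. bayes_score (cgf \<mu>) n (p n) q \<gamma> (f n) (cov_matrix n \<omega>) (responses n \<omega>) J) \<in> borel_measurable (M n)"
    if J: "J \<subseteq> {1..p n}" "card J \<le> q" for J
  proof -
    have fin: "finite J" using J finite_subset by blast
    \<comment> \<open>UNIV is replaced by the whole parameter space, which is a measurable set to
      which \<open>measurable_marginal_on\<close> applies.\<close>
    have 1: "marginal_on n (p n) x y (\<phi>s n) (f n J) J UNIV = marginal_on n (p n) x y (\<phi>s n) (f n J) J (space (lebesgue_on_coords J))" for x y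
      unfolding marginal_on_def by (intro nn_integral_cong) simp
    have 2: "(\<lambda>\<omega>. likelihood (cgf \<mu>) n (p n) (cov_matrix n \<omega>) (responses n \<omega>) (\<phi>s n)) \<in> borel_measurable (M n)"
      using measurable_compose[OF measurable_Pair[OF measurable_cov_matrix[OF n] measurable_responses[OF n]] measurable_likelihood[of n "p n" "\<phi>s n"]]
      by simp
    note [measurable] = 2 measurable_marginal_on[OF n fin sets.top f[OF J], of "\<phi>s n"]
    show ?thesis
      unfolding bayes_score_eq[where f = "f n" and ?\<phi>0.0 = "\<phi>s n", OF J(2) f[OF J]] 1 by measurable
  qed
  have "finite {J. J \<subseteq> {1..p n} \<and> J \<noteq> true_support p \<phi>s n \<and> card J \<le> q}" by simp
  then show ?thesis
    unfolding bayes_selects_truth_eq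
    by (intro sets.sets_Collect_finite_All borel_measurable_less m)
      (auto intro!: m true_support_subset q)
qed

end

section \<open>Selection for a fixed sample size\<close>

context glm_sequence
begin

abbreviation weighted_square_sum :: "nat \<Rightarrow> 'w \<Rightarrow> nat \<Rightarrow> real" where
  "weighted_square_sum n \<omega> j \<equiv> (\<Sum>i\<in>{1..n}. (cov_matrix n \<omega> i j)\<^sup>2 * sup_cgf'' (dot (p n) (cov_matrix n \<omega> i) (\<phi>s n)))"

abbreviation selection_prob ::
  "nat \<Rightarrow> real \<Rightarrow> (nat \<Rightarrow> nat set \<Rightarrow> (nat \<Rightarrow> real) \<Rightarrow> real) \<Rightarrow> nat \<Rightarrow> real" where
  "selection_prob q \<gamma> f n \<equiv> measure (M n) (bayes_selects_truth \<mu> M X Y p \<phi>s q \<gamma> f n)"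

text \<open>Outside three bad events the comparison of scores is deterministic. The three subtracted
  terms are union bounds for, in this order, a large score in one of the p coordinates, a degenerate
  Hessian for one of the models, and a large near part of a superset. Here t is the tilt for the
  score, \<rho> the radius separating near from far, and h the half-width of the cube for the lower
  bound.\<close>

lemma selection_probability:
  fixes U :: "nat set \<Rightarrow> real" and n q :: nat
  defines "J0 \<equiv> true_support p \<phi>s n"
  assumes n: "n \<ge> 1" and q: "q \<ge> 1" "card J0 \<le> q"
    and \<phi>: "L2_set (\<phi>s n) {1..p n} \<le> a3" "a3 \<le> R"
    and a: "a > 0"
      "\<And>J. J \<subseteq> {1..p n} \<Longrightarrow> card J \<le> 2 * q \<Longrightarrow>
         loewner_le J (\<lambda>j k. if j = k then a else 0) (\<lambda>j k. \<integral>\<omega>. X n 1 j \<omega> * X n 1 k \<omega> \<partial>M n)"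
    and m4: "m4 \<ge> 0" "\<And>j. j \<in> {1..p n} \<Longrightarrow> (\<integral>\<^sup>+\<omega>. ennreal ((X n 1 j \<omega>) ^ 4) \<partial>M n) \<le> ennreal m4"
    and T: "T > 0" "4 * real (2 * q) ^ 2 * m4 \<le> a * T\<^sup>2"
    and breg: "c > 0" "\<And>\<theta> h. \<bar>\<theta>\<bar> \<le> a3 * (real q * T) \<Longrightarrow> \<bar>h\<bar> \<le> 1 \<Longrightarrow> bregman \<theta> h \<ge> c * h\<^sup>2"
    and G: "G \<in> sets (M n)"
      "\<And>\<omega> i j. \<omega> \<in> G \<Longrightarrow> i \<in> {1..n} \<Longrightarrow> j \<in> {1..p n} \<Longrightarrow> t * \<bar>cov_matrix n \<omega> i j\<bar> \<le> 1"
      "\<And>\<omega> j. \<omega> \<in> G \<Longrightarrow> j \<in> {1..p n} \<Longrightarrow>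
         weighted_square_sum n \<omega> j \<le> C * real n"
    and C: "C \<ge> 0"
    and prior: "prior_conditions p q R f F1 F2 F3"
    and pos: "t > 0" "\<rho> > 0" "\<sigma> \<ge> 0" "m \<ge> 0" "h \<ge> 0"
    and h: "real q * h \<le> t" "real q * h \<le> 1"
    and small: "\<rho> * (real (2 * q) * T) \<le> 1"
    and signal: "\<And>j. j \<in> J0 \<Longrightarrow> \<rho> \<le> \<bar>\<phi>s n j\<bar>"
    and le: "\<sigma> * (real (2 * q) * \<rho>) - c * a / 2 * real n * \<rho>\<^sup>2 \<le> - m"
    and U: "\<And>J. J \<subseteq> {1..p n} \<Longrightarrow> J0 \<subset> J \<Longrightarrow> card J \<le> q \<Longrightarrow> U J > 0"
    and num1: "\<And>J. J \<subseteq> {1..p n} \<Longrightarrow> \<not> J0 \<subseteq> J \<Longrightarrow> card J \<le> q \<Longrightarrow>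
      real (p n choose card J) powr (- \<gamma>) * exp (- m) < real (p n choose card J0) powr (- \<gamma>) *
        (F2 * exp (- (real q ^ 2 * h\<^sup>2 * (C * real n) / 2)) * (2 * h) ^ card J0)"
    and num2: "\<And>J. J \<subseteq> {1..p n} \<Longrightarrow> J0 \<subset> J \<Longrightarrow> card J \<le> q \<Longrightarrow>
      real (p n choose card J) powr (- \<gamma>) * (U J + exp (- m)) < real (p n choose card J0) powr (- \<gamma>) *
        (F2 * exp (- (real q ^ 2 * h\<^sup>2 * (C * real n) / 2)) * (2 * h) ^ card J0)"
  shows "selection_prob q \<gamma> f n \<ge> measure (M n) G
    - (real (p n) * (2 * exp (t\<^sup>2 * (C * real n) / 2 - t * \<sigma>))
       + (real q + 1) * real (p n) ^ q *
         (2 * real (2 * q) ^ 2 * exp (- (real n * (a / (4 * real (2 * q)))\<^sup>2 / (2 * T ^ 4))))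
       + (\<Sum>J\<in>{J. J \<subseteq> {1..p n} \<and> J0 \<subset> J \<and> card J \<le> q}. F1 * (2 * \<rho>) ^ card J / U J))"
proof -
  interpret prob_space "M n" by (rule prob[OF n])
  have J0: "J0 \<subseteq> {1..p n}" "\<And>j. j \<in> {1..p n} - J0 \<Longrightarrow> \<phi>s n j = 0"
    unfolding J0_def true_support_def by auto
  have finJ: "finite J" if "J \<subseteq> {1..p n}" for J using that finite_subset by blast
  have p1: "p n \<ge> 1" by (rule p_pos[OF n])
  have F: "F1 > 0" "F2 > 0" and
    f_meas: "\<And>J. J \<subseteq> {1..p n} \<Longrightarrow> card J \<le> q \<Longrightarrow> f n J \<in> borel_measurable (lebesgue_on_coords J)" and
    f_nn: "\<And>J \<phi>. J \<subseteq> {1..p n} \<Longrightarrow> card J \<le> q \<Longrightarrow> \<phi> \<in> space (lebesgue_on_coords J) \<Longrightarrow> 0 \<le> f n J \<phi>" and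
    f_int: "\<And>J. J \<subseteq> {1..p n} \<Longrightarrow> card J \<le> q \<Longrightarrow> (\<integral>\<^sup>+\<phi>. ennreal (f n J \<phi>) \<partial>lebesgue_on_coords J) = 1" and
    f_up: "\<And>J \<phi>. J \<subseteq> {1..p n} \<Longrightarrow> card J \<le> q \<Longrightarrow> \<phi> \<in> space (lebesgue_on_coords J) \<Longrightarrow> f n J \<phi> \<le> F1" and
    f_low: "\<And>J \<phi>. J \<subseteq> {1..p n} \<Longrightarrow> card J \<le> q \<Longrightarrow> \<phi> \<in> space (lebesgue_on_coords J) \<Longrightarrow>
      L2_set \<phi> J \<le> R + 1 \<Longrightarrow> F2 \<le> f n J \<phi>"
    using prior n unfolding prior_conditions_def by blast+
  let ?x = "cov_matrix n" and ?y = "responses n"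
  define Js where "Js = {J. J \<subseteq> {1..p n} \<and> card J \<le> q}"
  define Fs where "Fs = {J. J \<subseteq> {1..p n} \<and> J0 \<subset> J \<and> card J \<le> q}"
  have finJs: "finite Js" "finite Fs" unfolding Js_def Fs_def by simp_all
  have a3: "a3 \<ge> 0" using \<phi>(1) L2_set_nonneg order_trans by blast
  have \<phi>a3: "\<bar>\<phi>s n j\<bar> \<le> a3" if "j \<in> {1..p n}" for j
    using L2_set_member_abs[of "{1..p n}" j "\<phi>s n"] that \<phi>(1) by simp

  define eH where "eH = 2 * real (2 * q) ^ 2 * exp (- (real n * (a / (4 * real (2 * q)))\<^sup>2 / (2 * T ^ 4)))"
  \<comment> \<open>All displacements v are quantified inside, so one bad event per model suffices.
    The union with the true support is taken because displacements from the truth live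
    there.\<close>
  define hess where "hess = (\<lambda>J \<omega>. \<forall>v :: nat \<Rightarrow> real. a / 2 * real n * (\<Sum>j\<in>J \<union> J0. (v j)\<^sup>2)
      \<le> (\<Sum>i\<in>{1..n}. if \<forall>l\<in>J \<union> J0. \<bar>?x \<omega> i l\<bar> \<le> T then (\<Sum>j\<in>J \<union> J0. ?x \<omega> i j * v j)\<^sup>2 else 0))"
  have card_un: "card (J \<union> J0) \<le> 2 * q" if "J \<in> Js" for J
    using card_Un_le[of J J0] that q(2) by (simp add: Js_def)
  have "\<exists>B. B \<in> events \<and> prob B \<le> eH \<and> (\<forall>\<omega>\<in>space (M n) - B. hess J \<omega>)" if J: "J \<in> Js" for J
  proof -
    have sub: "J \<union> J0 \<subseteq> {1..p n}" using J J0 by (auto simp: Js_def)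
    have mm: "(\<integral>\<^sup>+\<omega>. ennreal ((X n 1 j \<omega>) ^ 4) \<partial>M n) \<le> ennreal m4" if "j \<in> J \<union> J0" for j
      using m4(2) sub that by blast
    have d1: "2 * q \<ge> 1" using q by simp
    show ?thesis
    proof (rule hessian_event[OF n sub card_un[OF J] d1 a(1) T m4(1) mm a(2)[OF sub card_un[OF J]]])
      fix Bd assume Bd: "Bd \<in> events"
        "prob Bd \<le> 2 * real (2 * q) ^ 2 * exp (- (real n * (a / (4 * real (2 * q)))\<^sup>2 / (2 * T ^ 4)))"
        "\<And>\<omega> (v :: nat \<Rightarrow> real). \<omega> \<in> space (M n) - Bd \<Longrightarrow> a / 2 * real n * (\<Sum>j\<in>J \<union> J0. (v j)\<^sup>2)
      \<le> (\<Sum>i\<in>{1..n}. if \<forall>l\<in>J \<union> J0. \<bar>?x \<omega> i l\<bar> \<le> T then (\<Sum>j\<in>J \<union> J0. ?x \<omega> i j * v j)\<^sup>2 else 0)"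
      show ?thesis
        by (rule exI[of _ Bd]) (use Bd in \<open>simp add: eH_def hess_def\<close>)
    qed
  qed
  then obtain B where B: "\<And>J. J \<in> Js \<Longrightarrow> B J \<in> events" "\<And>J. J \<in> Js \<Longrightarrow> prob (B J) \<le> eH"
    "\<And>J \<omega>. J \<in> Js \<Longrightarrow> \<omega> \<in> space (M n) - B J \<Longrightarrow> hess J \<omega>" by metis
  define BH where "BH = (\<Union>J\<in>Js. B J)"
  have BH: "BH \<in> events" unfolding BH_def using finJs B(1) by auto
  have PH: "prob BH \<le> (real q + 1) * real (p n) ^ q * eH"
    unfolding BH_def using card_small_subsets_le[OF p1, of q]
    by (intro prob_UN_le_card finJs B) (auto simp: Js_def eH_def)

  \<comment> \<open>The score is controlled only inside G, where the curvature of a unit tilt is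
    bounded.\<close>
  define A where "A = (\<lambda>j. {\<omega> \<in> G. \<bar>score n (p n) (?x \<omega>) (?y \<omega>) (\<phi>s n) j\<bar> > \<sigma>})"
  have cu: "curv n (p n) (?x \<omega>) (\<phi>s n) (\<lambda>k. if k = j then s else 0) \<le> t\<^sup>2 * (C * real n) / 2"
    if "\<omega> \<in> G" "\<bar>s\<bar> = t" "j \<in> {1..p n}" for \<omega> s j
  proof -
    have "s\<^sup>2 = t\<^sup>2" using that(2) by (metis power2_abs)
    then show ?thesis using curv_unit[of j "p n" n s "?x \<omega>" "\<phi>s n" C] G(2,3)[OF that(1)] that by simp
  qed
  have Am: "A j \<in> events" and AP: "prob (A j) \<le> 2 * exp (t\<^sup>2 * (C * real n) / 2 - t * \<sigma>)" if "j \<in> {1..p n}" for j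
    unfolding A_def using score_tail[OF n that G(1) pos(1) cu[OF _ _ that]] by auto
  define BS where "BS = (\<Union>j\<in>{1..p n}. A j)"
  have BS: "BS \<in> events" unfolding BS_def using Am by auto
  have PS: "prob BS \<le> real (p n) * (2 * exp (t\<^sup>2 * (C * real n) / 2 - t * \<sigma>))"
    unfolding BS_def by (intro prob_UN_le_card Am AP) auto

  \<comment> \<open>Only supersets of the truth have a near part, so Markov's inequality is spent on
    these models alone.\<close>
  define E where "E = (\<lambda>J. {\<omega> \<in> space (M n).
      ennreal (U J) < marginal_on n (p n) (?x \<omega>) (?y \<omega>) (\<phi>s n) (f n J) J (coord_cube J (\<phi>s n) \<rho>)})"
  have E: "E J \<in> events" "prob (E J) \<le> F1 * (2 * \<rho>) ^ card J / U J" if J: "J \<in> Fs" for J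
  proof -
    have J': "J \<subseteq> {1..p n}" "card J \<le> q" "J0 \<subset> J" using J by (auto simp: Fs_def)
    note [measurable] = measurable_marginal_on[OF n finJ[OF J'(1)] sets_coord_cube[OF finJ[OF J'(1)]] f_meas[OF J'(1,2)],
        of "\<phi>s n" "\<phi>s n" \<rho>]
    show Em: "E J \<in> events" unfolding E_def by measurable
    have "(\<integral>\<^sup>+\<omega>. marginal_on n (p n) (?x \<omega>) (?y \<omega>) (\<phi>s n) (f n J) J (coord_cube J (\<phi>s n) \<rho>) \<partial>M n)
       \<le> ennreal F1 * emeasure (lebesgue_on_coords J) (coord_cube J (\<phi>s n) \<rho>)"
      using F f_nn[OF J'(1,2)] f_up[OF J'(1,2)]
      by (intro nn_integral_marginal_on n finJ J' sets_coord_cube f_meas) auto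
    also have "\<dots> = ennreal (F1 * (2 * \<rho>) ^ card J)"
      using emeasure_coord_cube[OF finJ[OF J'(1)], of \<rho>] F pos by (simp add: ennreal_mult)
    finally show "prob (E J) \<le> F1 * (2 * \<rho>) ^ card J / U J"
      using U[OF J'(1,3,2)] F pos by (intro prob_le_nn_integral[OF Em]) (auto simp: E_def less_imp_le)
  qed
  define BE where "BE = (\<Union>J\<in>Fs. E J)"
  have BE: "BE \<in> events" unfolding BE_def using E(1) finJs by auto
  have PE: "prob BE \<le> (\<Sum>J\<in>Fs. F1 * (2 * \<rho>) ^ card J / U J)"
  proof -
    have "prob BE \<le> (\<Sum>J\<in>Fs. prob (E J))"
      unfolding BE_def using E(1) finJs by (intro finite_measure_subadditive_finite) auto
    also have "\<dots> \<le> (\<Sum>J\<in>Fs. F1 * (2 * \<rho>) ^ card J / U J)" by (intro sum_mono E)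
    finally show ?thesis .
  qed

  have sel: "\<omega> \<in> bayes_selects_truth \<mu> M X Y p \<phi>s q \<gamma> f n"
    if \<omega>: "\<omega> \<in> G" "\<omega> \<notin> BH" "\<omega> \<notin> BS" "\<omega> \<notin> BE" for \<omega>
  proof -
    have \<omega>s: "\<omega> \<in> space (M n)" using \<omega>(1) sets.sets_into_space[OF G(1)] by auto
    have score: "\<bar>score n (p n) (?x \<omega>) (?y \<omega>) (\<phi>s n) j\<bar> \<le> \<sigma>" if "j \<in> {1..p n}" for j
      using \<omega>(1,3) that unfolding BS_def A_def by force
    have curv: "curv n (p n) (?x \<omega>) (\<phi>s n) u \<le> real q ^ 2 * h\<^sup>2 * (C * real n) / 2"
      if "\<And>j. j \<in> {1..p n} - J0 \<Longrightarrow> u j = 0" "\<And>j. j \<in> J0 \<Longrightarrow> \<bar>u j\<bar> \<le> h" for u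
    proof (rule curv_upper[OF J0(1) q(2) pos(5) that _ _ C])
      show "real q * h * \<bar>?x \<omega> i j\<bar> \<le> 1" if "i \<in> {1..n}" "j \<in> {1..p n}" for i j
        using mult_right_mono[OF h(1), of "\<bar>?x \<omega> i j\<bar>"] G(2)[OF \<omega>(1) that] by linarith
      show "(\<Sum>i\<in>{1..n}. (?x \<omega> i j)\<^sup>2 * sup_cgf'' (dot (p n) (?x \<omega> i) (\<phi>s n))) \<le> C * real n"
        if "j \<in> {1..p n}" for j by (rule G(3)[OF \<omega>(1) that])
    qed
    \<comment> \<open>The truth has norm at most a3 \<le> R and the cube adds at most q * h \<le> 1,
      so the cube lies in the ball of radius R + 1 on which the prior is bounded below.\<close>
    have low: "F2 \<le> f n J0 \<phi>" if "\<phi> \<in> coord_cube J0 (\<phi>s n) h" for \<phi>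
    proof (rule f_low[OF J0(1) q(2)])
      show "\<phi> \<in> space (lebesgue_on_coords J0)"
        using that unfolding coord_cube_def space_PiM by (auto simp: PiE_iff)
      have d: "\<bar>\<phi> j - \<phi>s n j\<bar> \<le> h" if "j \<in> J0" for j
        using PiE_mem[OF \<open>\<phi> \<in> coord_cube J0 (\<phi>s n) h\<close>[unfolded coord_cube_def] that]
        unfolding atLeastAtMost_iff by linarith
      have "L2_set \<phi> J0 = L2_set (\<lambda>j. \<phi>s n j + (\<phi> j - \<phi>s n j)) J0" by simp
      also have "\<dots> \<le> L2_set (\<phi>s n) J0 + L2_set (\<lambda>j. \<phi> j - \<phi>s n j) J0" by (rule L2_set_triangle_ineq)
      also have "L2_set (\<phi>s n) J0 \<le> L2_set (\<phi>s n) {1..p n}"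
        unfolding L2_set_def using J0(1) by (intro real_sqrt_le_mono sum_mono2) auto
      also have "L2_set (\<lambda>j. \<phi> j - \<phi>s n j) J0 \<le> real (card J0) * h"
        by (rule L2_set_le_card[OF finJ[OF J0(1)] d])
      also have "\<dots> \<le> real q * h" using q pos by (intro mult_right_mono) auto
      finally show "L2_set \<phi> J0 \<le> R + 1" using \<phi> h by linarith
    qed
    have out: "llr n (p n) (?x \<omega>) (?y \<omega>) (\<phi>s n) (\<lambda>j. zero_ext J \<phi> j - \<phi>s n j) \<le> - m"
      if J: "J \<in> Js" and far: "\<exists>j\<in>J \<union> J0. \<rho> \<le> \<bar>zero_ext J \<phi> j - \<phi>s n j\<bar>" for J \<phi>
    proof (rule llr_le_of_hessian[OF J0 _ _ refl card_un[OF J] q(2) pos(2,4) T(1) breg(1) pos(3) a3 breg(2) _ score small le far])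
      show "\<bar>\<phi>s n j\<bar> \<le> a3" if "j \<in> J0" for j using \<phi>a3 J0 that by blast
      show "J \<subseteq> {1..p n}" using J by (simp add: Js_def)
      have "hess J \<omega>" using B(3)[OF J] \<omega>(2) \<omega>s J unfolding BH_def by blast
      then show "a / 2 * real n * (\<Sum>j\<in>J \<union> J0. (v j)\<^sup>2)
          \<le> (\<Sum>i\<in>{1..n}. if \<forall>l\<in>J \<union> J0. \<bar>?x \<omega> i l\<bar> \<le> T then (\<Sum>j\<in>J \<union> J0. ?x \<omega> i j * v j)\<^sup>2 else 0)" for v
        unfolding hess_def by blast
    qed
    have "bayes_score (cgf \<mu>) n (p n) q \<gamma> (f n) (?x \<omega>) (?y \<omega>) J < bayes_score (cgf \<mu>) n (p n) q \<gamma> (f n) (?x \<omega>) (?y \<omega>) J0"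
      if J: "J \<subseteq> {1..p n}" "J \<noteq> J0" "card J \<le> q" for J
    proof (cases "J0 \<subseteq> J")
      case False
      \<comment> \<open>Every parameter of J vanishes at j while the true coefficient there is at
        least \<rho>, so no parameter of J is near the truth.\<close>
      then obtain j where j: "j \<in> J0" "j \<notin> J" by blast
      show ?thesis
      proof (rule bayes_score_less[OF J0(1) q(2) J0(2) J(1,3) pos(5) less_imp_le[OF F(2)] low f_meas[OF J0(1) q(2)]
            f_meas[OF J(1,3)] f_nn[OF J(1,3)] f_int[OF J(1,3)] curv, where D = "{}" and U = 0 and m = m])
        show "marginal_on n (p n) (?x \<omega>) (?y \<omega>) (\<phi>s n) (f n J) J {} \<le> ennreal 0"
          by (simp add: marginal_on_def)
        show "llr n (p n) (?x \<omega>) (?y \<omega>) (\<phi>s n) (\<lambda>j. zero_ext J \<phi> j - \<phi>s n j) \<le> - m" for \<phi>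
          using J j signal[OF j(1)] by (intro out bexI[of _ j]) (auto simp: Js_def zero_ext_def)
        show "real (p n choose card J) powr (- \<gamma>) * (0 + exp (- m)) < real (p n choose card J0) powr (- \<gamma>) *
          (F2 * exp (- (real q ^ 2 * h\<^sup>2 * (C * real n) / 2)) * (2 * h) ^ card J0)"
          using num1[OF J(1) False J(3)] by simp
      qed auto
    next
      case True
      then have sub: "J0 \<subset> J" using J by auto
      then have JF: "J \<in> Fs" using J by (auto simp: Fs_def)
      show ?thesis
      proof (rule bayes_score_less[OF J0(1) q(2) J0(2) J(1,3) pos(5) less_imp_le[OF F(2)] low f_meas[OF J0(1) q(2)]
            f_meas[OF J(1,3)] f_nn[OF J(1,3)] f_int[OF J(1,3)] curv, where D = "coord_cube J (\<phi>s n) \<rho>" and U = "U J" and m = m])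
        show "coord_cube J (\<phi>s n) \<rho> \<in> sets (lebesgue_on_coords J)" by (rule sets_coord_cube[OF finJ[OF J(1)]])
        show "marginal_on n (p n) (?x \<omega>) (?y \<omega>) (\<phi>s n) (f n J) J (coord_cube J (\<phi>s n) \<rho>) \<le> ennreal (U J)"
          using \<omega>(4) \<omega>s JF unfolding BE_def E_def by (auto simp: not_less)
        show "0 \<le> U J" using U[OF J(1) sub J(3)] by simp
        show "llr n (p n) (?x \<omega>) (?y \<omega>) (\<phi>s n) (\<lambda>j. zero_ext J \<phi> j - \<phi>s n j) \<le> - m"
          if \<phi>: "\<phi> \<in> space (lebesgue_on_coords J) - coord_cube J (\<phi>s n) \<rho>" for \<phi>
        proof (rule out)
          show "J \<in> Js" using J by (simp add: Js_def)
          obtain j where j: "j \<in> J" "\<phi> j \<notin> {\<phi>s n j - \<rho>..\<phi>s n j + \<rho>}"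
            using \<phi> unfolding coord_cube_def space_PiM PiE_iff Diff_iff by blast
          then have "\<rho> \<le> \<bar>zero_ext J \<phi> j - \<phi>s n j\<bar>"
            unfolding zero_ext_def atLeastAtMost_iff by (simp only: if_True) linarith
          then show "\<exists>j\<in>J \<union> J0. \<rho> \<le> \<bar>zero_ext J \<phi> j - \<phi>s n j\<bar>" using j(1) by blast
        qed
      qed (use num2[OF J(1) sub J(3)] in auto)
    qed
    then show ?thesis unfolding bayes_selects_truth_eq J0_def[symmetric] using \<omega>s by blast
  qed
  have Sm: "bayes_selects_truth \<mu> M X Y p \<phi>s q \<gamma> f n \<in> events"
    using q(2) f_meas unfolding J0_def by (intro sets_bayes_selects_truth n)
  have "prob G \<le> prob (bayes_selects_truth \<mu> M X Y p \<phi>s q \<gamma> f n \<union> (BS \<union> BH \<union> BE))"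
    using sel Sm BS BH BE by (intro finite_measure_mono) auto
  also have "\<dots> \<le> prob (bayes_selects_truth \<mu> M X Y p \<phi>s q \<gamma> f n) + prob (BS \<union> BH \<union> BE)"
    using Sm BS BH BE by (intro measure_Un_le) auto
  also have "prob (BS \<union> BH \<union> BE) \<le> prob BS + prob BH + prob BE"
    using measure_Un_le[of BS "M n" BH] measure_Un_le[of "BS \<union> BH" "M n" BE] BS BH BE by auto
  finally show ?thesis using PS PH PE unfolding eH_def Fs_def by linarith
qed

end

section \<open>Asymptotics\<close>

text \<open>There are at most p ^ r supersets with r additional elements, so each r from 1 to q
  contributes at most one. Removing J0 is injective on supersets and reduces the count to subsets of
  size r.\<close>

lemma sum_supersets_le:
  fixes p q :: nat
  assumes p: "p \<ge> 1" and J0: "J0 \<subseteq> {1..p}"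
  shows "(\<Sum>J\<in>{J. J \<subseteq> {1..p} \<and> J0 \<subset> J \<and> card J \<le> q}. (1 / real p) ^ (card J - card J0)) \<le> real q"
proof -
  let ?F = "{J. J \<subseteq> {1..p} \<and> J0 \<subset> J \<and> card J \<le> q}"
  let ?D = "\<lambda>r. {D. D \<subseteq> {1..p} \<and> card D = r}"
  have fin: "finite J" if "J \<subseteq> {1..p}" for J using that finite_subset by blast
  have c: "card (J - J0) = card J - card J0" if "J \<in> ?F" for J
    using that fin[OF J0] by (intro card_Diff_subset) auto
  have "(\<Sum>J\<in>?F. (1 / real p) ^ (card J - card J0)) = (\<Sum>J\<in>?F. (1 / real p) ^ card (J - J0))"
    using c by (intro sum.cong) auto
  also have "\<dots> = (\<Sum>D\<in>(\<lambda>J. J - J0) ` ?F. (1 / real p) ^ card D)"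
    by (rule sum.reindex_cong[symmetric, OF _ refl refl]) (auto simp: inj_on_def)
  also have "\<dots> \<le> (\<Sum>D\<in>(\<Union>r\<in>{1..q}. ?D r). (1 / real p) ^ card D)"
  proof (intro sum_mono2)
    show "finite (\<Union>r\<in>{1..q}. ?D r)" by auto
    show "(\<lambda>J. J - J0) ` ?F \<subseteq> (\<Union>r\<in>{1..q}. ?D r)"
    proof (rule image_subsetI)
      fix J assume J: "J \<in> ?F"
      then have "card J0 < card J" using fin by (intro psubset_card_mono) auto
      then show "J - J0 \<in> (\<Union>r\<in>{1..q}. ?D r)" using J c[OF J] by auto
    qed
  qed auto
  also have "\<dots> = (\<Sum>r\<in>{1..q}. \<Sum>D\<in>?D r. (1 / real p) ^ card D)"
    by (intro sum.UNION_disjoint) auto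
  also have "\<dots> = (\<Sum>r\<in>{1..q}. real (p choose r) * (1 / real p) ^ r)"
    by (intro sum.cong refl) (simp add: n_subsets)
  also have "\<dots> \<le> (\<Sum>r\<in>{1..q}. 1)"
  proof (rule sum_mono)
    fix r
    have "real (p choose r) * (1 / real p) ^ r \<le> real p ^ r * (1 / real p) ^ r"
      by (intro mult_right_mono choose_le_pow) auto
    also have "\<dots> = 1" using p by (simp add: power_mult_distrib[symmetric])
    finally show "real (p choose r) * (1 / real p) ^ r \<le> 1" .
  qed
  finally show ?thesis by simp
qed

text \<open>Multiplication by k clears the divisions. At k = 0 the linear inequality becomes
  \<alpha> < 1 / 2, so both cases of the definition take one form.\<close>

lemma admissible_ereal:
  assumes "admissible_scalars \<alpha> \<beta> \<gamma> (ereal k)" "k \<ge> 0"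
  shows "(\<gamma> - 1 - \<beta>) * k + (1 / 2 - \<alpha>) > 0"
proof (cases "k = 0")
  case True
  then show ?thesis using assms by (simp add: admissible_scalars_def zero_ereal_def)
next
  case False
  then have k: "k > 0" using assms by simp
  have "\<gamma> > 1 - 1 / (2 * k) + \<beta> + \<alpha> / k"
    using assms(1) k by (simp add: admissible_scalars_def one_ereal_def)
  then have "(1 - 1 / (2 * k) + \<beta> + \<alpha> / k) * k < \<gamma> * k" using k by (rule mult_strict_right_mono)
  moreover have "(1 - 1 / (2 * k) + \<beta> + \<alpha> / k) * k = k - 1 / 2 + \<beta> * k + \<alpha>"
    using k by (simp add: field_simps)
  ultimately show ?thesis by (simp add: algebra_simps)
qed

lemma admissible_infinity:
  assumes "admissible_scalars \<alpha> \<beta> \<gamma> \<infinity>"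
  shows "\<gamma> - 1 - \<beta> > 0"
  using assms by (simp add: admissible_scalars_def one_ereal_def)

lemma growth_rate_eq: "n \<ge> 2 \<Longrightarrow> growth_rate p n = ereal (ln (real (p n)) / ln (real n))"
  by (simp add: growth_rate_def log_def)

lemma growth_rate_nonneg:
  assumes "\<And>n. n \<ge> 1 \<Longrightarrow> p n \<ge> 1"
  shows "0 \<le> liminf (growth_rate p)" "0 \<le> limsup (growth_rate p)"
proof -
  have "\<forall>\<^sub>F n in sequentially. 0 \<le> growth_rate p n"
    using eventually_ge_at_top[of 2]
  proof eventually_elim
    case (elim n)
    then have "p n \<ge> 1" using assms by simp
    then show ?case using elim by (auto simp: growth_rate_eq intro!: divide_nonneg_nonneg)
  qed
  then show "0 \<le> liminf (growth_rate p)" by (rule Liminf_bounded)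
  also have "liminf (growth_rate p) \<le> limsup (growth_rate p)"
    by (intro Liminf_le_Limsup) auto
  finally show "0 \<le> limsup (growth_rate p)" .
qed

text \<open>In the variables ln n and ln p the admissibility condition is linear, hence it holds with
  a uniform margin between the liminf and the limsup of the growth rate.\<close>

lemma admissible_margin:
  assumes p: "\<And>n. n \<ge> 1 \<Longrightarrow> p n \<ge> 1"
    and adm: "admissible_scalars \<alpha> \<beta> \<gamma> (limsup (growth_rate p))"
      "admissible_scalars \<alpha> \<beta> \<gamma> (liminf (growth_rate p))"
  obtains \<epsilon> where "\<epsilon> > 0"
    "\<forall>\<^sub>F n in sequentially. \<epsilon> * (ln (real n) + ln (real (p n)))
       \<le> (\<gamma> - 1 - \<beta>) * ln (real (p n)) + (1 / 2 - \<alpha>) * ln (real n)"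
proof -
  define A where "A = \<gamma> - 1 - \<beta>"
  define B where "B = 1 / 2 - \<alpha>"
  define g where "g = (\<lambda>n. ln (real (p n)) / ln (real n))"
  have gr: "\<forall>\<^sub>F n in sequentially. growth_rate p n = ereal (g n)"
    using eventually_ge_at_top[of 2] by eventually_elim (simp add: growth_rate_eq g_def)
  have g0: "\<forall>\<^sub>F n in sequentially. 0 \<le> g n"
    using eventually_ge_at_top[of 2]
  proof eventually_elim
    case (elim n)
    then have "p n \<ge> 1" using p by simp
    then show ?case using elim by (simp add: g_def)
  qed
  have "\<exists>\<epsilon>>0. \<forall>\<^sub>F n in sequentially. \<epsilon> * (1 + g n) \<le> A * g n + B"
  \<comment> \<open>A * g + B is least at small growth rates if A > 0 and at large ones if A \<le>
    0. The first case therefore uses admissibility at the liminf and the second at the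
    limsup.\<close>
  proof (cases "A > 0")
    case True
    have "\<exists>k\<ge>0. A * k + B > 0 \<and> (\<forall>\<^sub>F n in sequentially. k \<le> g n)"
    proof (cases "liminf (growth_rate p)")
      case (real l)
      have l0: "l \<ge> 0" using growth_rate_nonneg(1)[of p, OF p] real by simp
      have pos: "A * l + B > 0"
        using admissible_ereal[of \<alpha> \<beta> \<gamma> l] adm(2) real l0 by (simp add: A_def B_def)
      show ?thesis
      proof (cases "l = 0")
        case True
        then show ?thesis using pos g0 by (intro exI[of _ 0]) auto
      next
        case False
        define \<delta> where "\<delta> = min l ((A * l + B) / (2 * A))"
        have \<delta>: "\<delta> > 0" "\<delta> \<le> l" "A * \<delta> \<le> (A * l + B) / 2"
          using False l0 pos True by (auto simp: \<delta>_def field_simps min_def)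
        have "ereal (l - \<delta>) < liminf (growth_rate p)" using real \<delta> by simp
        then have "\<forall>\<^sub>F n in sequentially. ereal (l - \<delta>) < growth_rate p n" by (rule less_LiminfD)
        with gr have "\<forall>\<^sub>F n in sequentially. l - \<delta> \<le> g n" by eventually_elim simp
        then show ?thesis using \<delta> pos by (intro exI[of _ "l - \<delta>"]) (auto simp: algebra_simps)
      qed
    next
      case PInf
      define k where "k = (\<bar>B\<bar> + 1) / A"
      have k: "k \<ge> 0" "A * k + B > 0" using True by (auto simp: k_def)
      have "ereal k < liminf (growth_rate p)" using PInf by simp
      then have "\<forall>\<^sub>F n in sequentially. ereal k < growth_rate p n" by (rule less_LiminfD)
      with gr have "\<forall>\<^sub>F n in sequentially. k \<le> g n" by eventually_elim simp
      then show ?thesis using k by blast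
    next
      case MInf
      then show ?thesis using growth_rate_nonneg(1)[of p, OF p] by simp
    qed
    then obtain k where k: "k \<ge> 0" "A * k + B > 0" "\<forall>\<^sub>F n in sequentially. k \<le> g n" by blast
    \<comment> \<open>The bound \<epsilon> \<le> A keeps the slope A - \<epsilon> nonnegative, so
      the inequality at k persists for all larger growth rates.\<close>
    define \<epsilon> where "\<epsilon> = min A ((A * k + B) / (k + 1))"
    have \<epsilon>: "\<epsilon> > 0" "\<epsilon> \<le> A" "\<epsilon> * (k + 1) \<le> A * k + B"
    proof -
      have "\<epsilon> \<le> (A * k + B) / (k + 1)" by (simp add: \<epsilon>_def)
      then show "\<epsilon> * (k + 1) \<le> A * k + B" using k by (simp add: pos_le_divide_eq)
    qed (use True k in \<open>auto simp: \<epsilon>_def\<close>)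
    have "\<forall>\<^sub>F n in sequentially. \<epsilon> * (1 + g n) \<le> A * g n + B"
      using k(3)
    proof eventually_elim
      case (elim n)
      then have "(A - \<epsilon>) * k \<le> (A - \<epsilon>) * g n" using \<epsilon> by (intro mult_left_mono) auto
      then show ?case using \<epsilon>(3) by (simp add: algebra_simps)
    qed
    with \<epsilon>(1) show ?thesis by blast
  next
    case False
    have "\<exists>k\<ge>0. A * k + B > 0 \<and> (\<forall>\<^sub>F n in sequentially. g n \<le> k)"
    proof (cases "limsup (growth_rate p)")
      case (real l)
      have l0: "l \<ge> 0" using growth_rate_nonneg(2)[of p, OF p] real by simp
      have pos: "A * l + B > 0"
        using admissible_ereal[of \<alpha> \<beta> \<gamma> l] adm(1) real l0 by (simp add: A_def B_def)
      \<comment> \<open>The denominator has 1 - A in place of - A, because A may be 0 here.\<close>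
      define \<delta> where "\<delta> = (A * l + B) / (2 * (1 - A))"
      have \<delta>: "\<delta> > 0" using pos False by (simp add: \<delta>_def)
      have "- A * \<delta> \<le> (1 - A) * \<delta>" using \<delta> False by (intro mult_right_mono) auto
      also have "\<dots> = (A * l + B) / 2" using False by (simp add: \<delta>_def field_simps)
      also have "\<dots> < A * l + B" using pos by simp
      finally have pos': "A * (l + \<delta>) + B > 0" by (simp add: algebra_simps)
      have "limsup (growth_rate p) < ereal (l + \<delta>)" using real \<delta> by simp
      then have "\<forall>\<^sub>F n in sequentially. growth_rate p n < ereal (l + \<delta>)" by (rule Limsup_lessD)
      with gr have "\<forall>\<^sub>F n in sequentially. g n \<le> l + \<delta>" by eventually_elim simp
      then show ?thesis using \<delta> pos' l0 by (intro exI[of _ "l + \<delta>"]) auto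
    next
      case PInf
      then show ?thesis using admissible_infinity adm(1) False by (simp add: A_def)
    next
      case MInf
      then show ?thesis using growth_rate_nonneg(2)[of p, OF p] by simp
    qed
    then obtain k where k: "k \<ge> 0" "A * k + B > 0" "\<forall>\<^sub>F n in sequentially. g n \<le> k" by blast
    define \<epsilon> where "\<epsilon> = (A * k + B) / (k + 1)"
    have \<epsilon>: "\<epsilon> > 0" "\<epsilon> * (k + 1) = A * k + B" using k by (auto simp: \<epsilon>_def)
    have "\<forall>\<^sub>F n in sequentially. \<epsilon> * (1 + g n) \<le> A * g n + B"
      using k(3)
    proof eventually_elim
      case (elim n)
      then have "\<epsilon> * (1 + g n) \<le> \<epsilon> * (k + 1)" using \<epsilon> by (intro mult_left_mono) auto
      moreover have "A * k \<le> A * g n" using elim False by (intro mult_left_mono_neg) auto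
      ultimately show ?case using \<epsilon>(2) by simp
    qed
    with \<epsilon>(1) show ?thesis by blast
  qed
  then obtain \<epsilon> where \<epsilon>: "\<epsilon> > 0" "\<forall>\<^sub>F n in sequentially. \<epsilon> * (1 + g n) \<le> A * g n + B" by blast
  have "\<forall>\<^sub>F n in sequentially. \<epsilon> * (ln (real n) + ln (real (p n))) \<le> A * ln (real (p n)) + B * ln (real n)"
    using \<epsilon>(2) eventually_ge_at_top[of 2]
  proof eventually_elim
    case (elim n)
    have l: "ln (real n) > 0" using elim by simp
    have "\<epsilon> * (1 + g n) * ln (real n) \<le> (A * g n + B) * ln (real n)"
      using elim l by (intro mult_right_mono) auto
    moreover have "g n * ln (real n) = ln (real (p n))" using l by (simp add: g_def)
    ultimately show ?case by (simp add: algebra_simps)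
  qed
  then show ?thesis using that \<epsilon>(1) unfolding A_def B_def by blast
qed

section \<open>The scale log (n p) and negligible terms on it\<close>

context glm_sequence
begin

definition logsize :: "nat \<Rightarrow> real" where
  "logsize n = ln (real n * real (p n))"

lemma logsize_eq: "n \<ge> 1 \<Longrightarrow> logsize n = ln (real n) + ln (real (p n))"
  using p_pos[of n] by (simp add: logsize_def ln_mult)

lemma logsize_at_top: "filterlim logsize at_top sequentially"
proof (rule filterlim_at_top_mono)
  show "filterlim (\<lambda>n. ln (real n)) at_top sequentially"
    by (rule filterlim_compose[OF ln_at_top filterlim_real_sequentially])
  show "\<forall>\<^sub>F n in sequentially. ln (real n) \<le> logsize n"
    using eventually_ge_at_top[of 1]
    by eventually_elim (use p_pos in \<open>simp add: logsize_eq\<close>)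
qed

lemma logsize_over_n:
  assumes "(\<lambda>n. ln (real (p n))) \<in> o(\<lambda>n. real n)"
  shows "(\<lambda>n. logsize n / real n) \<longlonglongrightarrow> 0"
proof -
  have "(\<lambda>n. ln (real (p n)) / real n) \<longlonglongrightarrow> 0"
    using assms eventually_ge_at_top[of 1] by (intro smalloD_tendsto)
  moreover have "(\<lambda>n. ln (real n) / real n) \<longlonglongrightarrow> 0" by (rule lim_ln_over_n)
  ultimately have "(\<lambda>n. ln (real n) / real n + ln (real (p n)) / real n) \<longlonglongrightarrow> 0"
    using tendsto_add by fastforce
  then show ?thesis
    by (rule Lim_transform_eventually)
      (use eventually_ge_at_top[of 1] in \<open>eventually_elim, simp add: logsize_eq add_divide_distrib\<close>)
qed

end

text \<open>Markov's bound for one superset, split into (1 / p) ^ r, which pays for counting the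
  supersets, and a power of h * p powr (1 - \<gamma>), the quantity that admissibility makes small.
  The logarithms from the radius are collected crudely in L ^ q.\<close>

lemma superset_term_bound:
  fixes p L h c3 F1 C\<rho> \<gamma> :: real
  assumes p: "p \<ge> 1" and L: "L \<ge> 1" and h: "h > 0" and c3: "c3 > 0" and F1: "F1 \<ge> 0" and C\<rho>: "2 * C\<rho> \<ge> 1"
    and kr: "k + r \<le> q"
  shows "F1 * (2 * (C\<rho> * (sqrt L * h))) ^ (k + r) / (c3 * h ^ k * p powr (\<gamma> * real r))
     \<le> F1 * (2 * C\<rho>) ^ q / c3 * L ^ q * (1 / p) ^ r * (h * p powr (1 - \<gamma>)) ^ r"
proof -
  have pg: "p powr (\<gamma> * real r) = (p powr \<gamma>) ^ r"
    using p by (simp add: powr_powr[symmetric] powr_realpow)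
  have pg1: "p powr (1 - \<gamma>) = p / p powr \<gamma>" using p by (simp add: powr_diff)
  have pos: "p powr \<gamma> > 0" using p by simp
  have "F1 * (2 * (C\<rho> * (sqrt L * h))) ^ (k + r) / (c3 * h ^ k * p powr (\<gamma> * real r))
      = F1 * ((2 * C\<rho>) ^ (k + r) * sqrt L ^ (k + r)) / c3 * (h ^ r / (p powr \<gamma>) ^ r)"
    unfolding pg using h pos c3 by (simp add: power_mult_distrib power_add field_simps)
  also have "\<dots> \<le> F1 * ((2 * C\<rho>) ^ q * L ^ q) / c3 * (h ^ r / (p powr \<gamma>) ^ r)"
  proof (intro mult_right_mono divide_right_mono mult_left_mono mult_mono)
    show "(2 * C\<rho>) ^ (k + r) \<le> (2 * C\<rho>) ^ q" using C\<rho> kr by (intro power_increasing)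
    have "sqrt L \<le> L" using L real_sqrt_le_mono[of L "L\<^sup>2"] by (simp add: power2_eq_square)
    then have "sqrt L ^ (k + r) \<le> L ^ (k + r)" using L by (intro power_mono) auto
    also have "\<dots> \<le> L ^ q" using L kr by (intro power_increasing) auto
    finally show "sqrt L ^ (k + r) \<le> L ^ q" .
  qed (use F1 c3 C\<rho> L h pos in auto)
  also have "h ^ r / (p powr \<gamma>) ^ r = (1 / p) ^ r * (h * p powr (1 - \<gamma>)) ^ r"
    unfolding pg1 using p by (simp add: power_mult_distrib power_divide)
  finally show ?thesis by (simp add: mult_ac)
qed

context glm_sequence
begin

lemma exp_neg_logsize_small:
  assumes "z > 0"
  shows "\<forall>\<^sub>F n in sequentially. exp (- logsize n) \<le> z"
proof -
  have "((\<lambda>n. exp (- logsize n)) \<longlongrightarrow> 0) sequentially"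
    using logsize_at_top by (intro filterlim_compose[OF exp_at_bot]) (simp add: filterlim_uminus_at_top[symmetric] filterlim_uminus_at_bot)
  from order_tendstoD(2)[OF this assms] show ?thesis by eventually_elim simp
qed

text \<open>The margin \<epsilon> from admissibility is spent here: a power of n p, however small,
  beats any power of its logarithm.\<close>

lemma logsize_power_exp_small:
  assumes "\<epsilon> > 0" "z > 0"
  shows "\<forall>\<^sub>F n in sequentially. logsize n ^ q * exp (- (\<epsilon> * logsize n)) \<le> z"
proof -
  have "filterlim (\<lambda>n. \<epsilon> * logsize n) at_top sequentially"
    using filterlim_tendsto_pos_mult_at_top[OF tendsto_const assms(1) logsize_at_top] .
  from filterlim_compose[OF tendsto_power_div_exp_0[of q] this]
  have "(\<lambda>n. (\<epsilon> * logsize n) ^ q / exp (\<epsilon> * logsize n)) \<longlonglongrightarrow> 0" .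
  moreover have "z * \<epsilon> ^ q > 0" using assms by simp
  ultimately have "\<forall>\<^sub>F n in sequentially. (\<epsilon> * logsize n) ^ q / exp (\<epsilon> * logsize n) < z * \<epsilon> ^ q"
    by (rule order_tendstoD(2))
  then show ?thesis
  proof eventually_elim
    case (elim n)
    have "\<epsilon> ^ q * (logsize n ^ q * exp (- (\<epsilon> * logsize n))) \<le> \<epsilon> ^ q * z"
      using elim by (simp add: power_mult_distrib exp_minus field_simps)
    then show ?case using assms by simp
  qed
qed

text \<open>All free parameters are multiples of powers of log (n p) and n, with constants chosen so
  that each of the three errors is at most an eighth of n powr (- \<alpha>) * p powr (- \<beta>).
  The half of this rate that is left over is available for the failure of the covariate event under
  the moment condition.\<close>

theorem selection_eventually:
  assumes regime: "sparse_regression_regime M X p \<phi>s q a1 a2 a3" and a1: "a1 > 0" and q: "q \<ge> 1"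
    and \<gamma>: "\<gamma> \<ge> 0" and \<alpha>: "\<alpha> > 0" and \<beta>: "\<beta> > 0"
    and adm: "admissible_scalars \<alpha> \<beta> \<gamma> (limsup (growth_rate p))" "admissible_scalars \<alpha> \<beta> \<gamma> (liminf (growth_rate p))"
    and prior: "prior_conditions p q R f F1 F2 F3" and R: "a3 \<le> R"
    and m4: "m4 \<ge> 0" "\<And>n j. n \<ge> 1 \<Longrightarrow> j \<in> {1..p n} \<Longrightarrow> (\<integral>\<^sup>+\<omega>. ennreal ((X n 1 j \<omega>) ^ 4) \<partial>M n) \<le> ennreal m4"
    and C: "C \<ge> 0" and Gm: "\<And>n. n \<ge> 1 \<Longrightarrow> G n \<in> sets (M n)"
    and G: "\<forall>\<^sub>F n in sequentially. \<forall>\<omega>\<in>G n. \<forall>j\<in>{1..p n}.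
       (\<forall>i\<in>{1..n}. sqrt (logsize n / real n) * \<bar>cov_matrix n \<omega> i j\<bar> \<le> 1) \<and>
       weighted_square_sum n \<omega> j \<le> C * real n"
  shows "\<forall>\<^sub>F n in sequentially. selection_prob q \<gamma> f n
     \<ge> measure (M n) (G n) - real n powr (- \<alpha>) * real (p n) powr (- \<beta>) / 2"
proof -
  have reg:
    "(\<lambda>n. ln (real (p n))) \<in> o(\<lambda>n. real n)"
    "\<And>n. n \<ge> 1 \<Longrightarrow> card (true_support p \<phi>s n) \<le> q"
    "\<And>n J. n \<ge> 1 \<Longrightarrow> J \<subseteq> {1..p n} \<Longrightarrow> card J \<le> 2 * q \<Longrightarrow>
        loewner_le J (\<lambda>j k. if j = k then a1 else 0) (\<lambda>j k. \<integral>\<omega>. X n 1 j \<omega> * X n 1 k \<omega> \<partial>M n)"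
    "\<And>n. n \<ge> 1 \<Longrightarrow> L2_set (\<phi>s n) {1..p n} \<le> a3"
    "\<And>c. c > 0 \<Longrightarrow> \<forall>\<^sub>F n in sequentially. \<forall>j\<in>true_support p \<phi>s n.
        sqrt (ln (real n * real (p n)) / real n) \<le> c * \<bar>\<phi>s n j\<bar>"
    using regime unfolding sparse_regression_regime_def by blast+
  have F: "F1 > 0" "F2 > 0" using prior by (auto simp: prior_conditions_def)
  have a3: "a3 \<ge> 0" using reg(4)[of 1] L2_set_nonneg order_trans by blast
  \<comment> \<open>The summand 1 gives T \<ge> 1, so the requirement, which is linear in T by
    construction, also holds with the square of T.\<close>
  define T where "T = 1 + 4 * real (2 * q) ^ 2 * m4 / a1"
  have T1: "T \<ge> 1" using m4(1) a1 by (simp add: T_def)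
  have T2: "4 * real (2 * q) ^ 2 * m4 \<le> a1 * T\<^sup>2"
  proof -
    have "4 * real (2 * q) ^ 2 * m4 \<le> a1 * T" using a1 by (simp add: T_def field_simps)
    also have "\<dots> \<le> a1 * T\<^sup>2" using T1 a1 by (simp add: power2_eq_square)
    finally show ?thesis .
  qed
  have "a3 * (real q * T) \<ge> 0" using a3 T1 by simp
  then obtain c where c: "c > 0" "\<And>\<theta> h. \<bar>\<theta>\<bar> \<le> a3 * (real q * T) \<Longrightarrow> \<bar>h\<bar> \<le> 1 \<Longrightarrow> bregman \<theta> h \<ge> c * h\<^sup>2"
    using bregman_lower by metis
  \<comment> \<open>The score tail becomes exp (- M0 * L) with L = log (n p). Of the exponent,
    \<alpha> + \<beta> produces the rate, 1 pays for the union over p coordinates and 1 leaves a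
    factor exp (- L).\<close>
  define M0 where "M0 = \<alpha> + \<beta> + 2"
  define C0 where "C0 = C / 2 + M0"
  \<comment> \<open>The far part exp (- Mm * L) must lie below the true marginal of order n^(-k/2)
    p^(-\<gamma> k), k \<le> q; the final 1 leaves a factor exp (- L) for the constants.\<close>
  define Mm where "Mm = \<gamma> * real q + real q + 1"
  \<comment> \<open>Chosen so that on the sphere of radius \<rho> the curvature, quadratic in this
    constant, exceeds the score term, linear in it, by Mm in units of L.\<close>
  define C\<rho> where "C\<rho> = 1 + 2 * (2 * real q * C0 + Mm) / (c * a1)"
  have C0: "C0 \<ge> 0" using C \<alpha> \<beta> by (simp add: C0_def M0_def)
  have Mm: "Mm \<ge> 0" using \<gamma> by (simp add: Mm_def)
  have C\<rho>: "C\<rho> \<ge> 1" using C0 Mm c a1 by (simp add: C\<rho>_def)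
  have C\<rho>': "C0 * (2 * real q) * C\<rho> - c * a1 / 2 * C\<rho>\<^sup>2 \<le> - Mm"
  proof -
    have ca: "c * a1 > 0" using c a1 by simp
    have "w / 2 * (1 + 2 * s / w) = w / 2 + s" if "w > 0" for w s :: real using that by (simp add: field_simps)
    from this[OF ca] have "c * a1 / 2 * C\<rho> = c * a1 / 2 + (2 * real q * C0 + Mm)" unfolding C\<rho>_def .
    then have "2 * real q * C0 + Mm \<le> c * a1 / 2 * C\<rho>" using ca by simp
    then have "(2 * real q * C0 + Mm) * C\<rho> \<le> c * a1 / 2 * C\<rho> * C\<rho>" using C\<rho> by (intro mult_right_mono) auto
    moreover have "Mm * 1 \<le> Mm * C\<rho>" using Mm C\<rho> by (intro mult_left_mono) auto
    ultimately show ?thesis by (simp add: power2_eq_square algebra_simps)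
  qed
  define c2 where "c2 = F2 * exp (- (real q ^ 2 * C / 2))"
  \<comment> \<open>The lower bound for the true model is divided in three: one third for the near
    part, one for the far part, one for strictness. The power of q compensates the constant in
    \<open>choose_powr_le\<close>.\<close>
  define c3 where "c3 = c2 * real q powr (- (real q * \<gamma>)) / 3"
  have c2: "c2 > 0" using F by (simp add: c2_def)
  have c3: "c3 > 0" using c2 q by (simp add: c3_def)
  define cH where "cH = (a1 / (4 * real (2 * q)))\<^sup>2 / (2 * T ^ 4)"
  have cH: "cH > 0" using a1 q T1 by (simp add: cH_def)
  define K2 where "K2 = (real q + 1) * (2 * real (2 * q) ^ 2)"
  have K2: "K2 > 0" using q by (simp add: K2_def)
  define K3 where "K3 = F1 * (2 * C\<rho>) ^ q / c3"
  have K3: "K3 > 0" using F C\<rho> c3 by (simp add: K3_def)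
  obtain \<epsilon> where \<epsilon>: "\<epsilon> > 0" and slack: "\<forall>\<^sub>F n in sequentially. \<epsilon> * (ln (real n) + ln (real (p n)))
       \<le> (\<gamma> - 1 - \<beta>) * ln (real (p n)) + (1 / 2 - \<alpha>) * ln (real n)"
    by (rule admissible_margin[of p, OF p_pos adm])
  have Ln: "\<forall>\<^sub>F n in sequentially. logsize n / real n \<le> z" if "z > 0" for z
    using order_tendstoD(2)[OF logsize_over_n[OF reg(1)] that] by eventually_elim simp
  have Lbig: "\<forall>\<^sub>F n in sequentially. z \<le> logsize n" for z
    using logsize_at_top by (simp add: filterlim_at_top)
  \<comment> \<open>Thresholds for log (n p) / n: z1 makes \<rho> * (2 * q * T) \<le> 1, and z2 lets
    the exponential tail of the Hessian beat the p ^ q models and the rate.\<close>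
  define z1 where "z1 = (1 / (C\<rho> * (real (2 * q) * T)))\<^sup>2"
  define z2 where "z2 = cH / (real q + \<beta> + \<alpha> + 1)"
  have z: "z1 > 0" "z2 > 0" "c2 / 3 > 0" "1 / (8 * K2) > 0" "1 / (8 * (real q * K3)) > 0" "1 / C\<rho> > 0"
    using C\<rho> q T1 cH \<alpha> \<beta> c2 K2 K3 by (auto simp: z1_def z2_def intro!: divide_pos_pos add_nonneg_pos)
  have "\<forall>\<^sub>F n in sequentially. 1 \<le> n \<and> q ^ 2 \<le> n \<and> 1 \<le> logsize n \<and> real q ^ 2 \<le> logsize n
      \<and> logsize n / real n \<le> z1 \<and> logsize n / real n \<le> z2 \<and> exp (- logsize n) \<le> 1 / 16
      \<and> exp (- logsize n) < c2 / 3 \<and> exp (- logsize n) \<le> 1 / (8 * K2)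
      \<and> logsize n ^ q * exp (- (\<epsilon> * logsize n)) \<le> 1 / (8 * (real q * K3))"
  proof (intro eventually_conj Ln Lbig exp_neg_logsize_small logsize_power_exp_small[OF \<epsilon>] eventually_ge_at_top z)
    show "\<forall>\<^sub>F n in sequentially. exp (- logsize n) < c2 / 3"
      using exp_neg_logsize_small[of "c2 / 6"] c2 by (auto elim!: eventually_mono)
  qed simp
  then show ?thesis
    using slack G reg(5)[OF z(6)]
  proof eventually_elim
    case (elim n)
    define a where "a = ln (real n)"
    define b where "b = ln (real (p n))"
    define L where "L = logsize n"
    have n: "n \<ge> 1" "q ^ 2 \<le> n" and L1: "L \<ge> 1" "real q ^ 2 \<le> L"
      and Lz: "L / real n \<le> z1" "L / real n \<le> z2"
      and e: "exp (- L) \<le> 1 / 16" "exp (- L) < c2 / 3" "exp (- L) \<le> 1 / (8 * K2)"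
        "L ^ q * exp (- (\<epsilon> * L)) \<le> 1 / (8 * (real q * K3))"
      using elim(1) by (auto simp: L_def)
    have p: "p n \<ge> 1" using p_pos n by auto
    have n0: "real n > 0" "real n \<ge> 1" and p0: "real (p n) > 0" "real (p n) \<ge> 1" using n p by auto
    have ab: "a \<ge> 0" "b \<ge> 0" "L = a + b" "real n = exp a" "real (p n) = exp b"
      using n p by (auto simp: a_def b_def L_def logsize_eq)
    let ?J0 = "true_support p \<phi>s n"
    define k where "k = card ?J0"
    have kq: "k \<le> q" using reg(2)[OF n(1)] by (simp add: k_def)
    \<comment> \<open>On a cube of side n^(-1/2) the curvature stays bounded, so the lower bound
      loses only a constant. The scale t is larger by sqrt L; there the score has polynomially small
      tails.\<close>
    define h where "h = 1 / sqrt (real n)"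
    define t where "t = sqrt (L / real n)"
    have h0: "h > 0" and hn: "h\<^sup>2 * real n = 1" using n0 by (auto simp: h_def power_divide)
    have th: "t = sqrt L * h" by (simp add: t_def h_def real_sqrt_divide)
    have t0: "t > 0" and tn: "t\<^sup>2 * real n = L" using n0 L1 by (auto simp: t_def)
    define \<rho> where "\<rho> = C\<rho> * t"
    define \<sigma> where "\<sigma> = C0 * (real n * t)"
    define m where "m = Mm * L"
    \<comment> \<open>Up to the constant, the largest near part with which a superset still loses
      after the ratio of the penalties.\<close>
    define U where "U = (\<lambda>J :: nat set. c3 * h ^ k * real (p n) powr (\<gamma> * real (card J - k)))"
    define \<delta> where "\<delta> = real n powr (- \<alpha>) * real (p n) powr (- \<beta>)"
    have \<delta>: "\<delta> = exp (- (\<alpha> * a + \<beta> * b))" "\<delta> > 0"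
      using n0 p0 by (auto simp: \<delta>_def powr_def a_def b_def exp_add[symmetric])
    have hk: "h ^ j = exp (- (real j / 2 * a))" for j
    proof -
      have "sqrt (exp a) = exp (a / 2)"
        by (rule real_sqrt_unique) (simp_all add: power2_eq_square exp_add[symmetric])
      then have "h = exp (- (a / 2))"
        unfolding h_def ab(4) by (simp add: exp_minus inverse_eq_divide)
      then show ?thesis by (simp add: exp_of_nat_mult[symmetric])
    qed
    have small_m: "exp (- m) < c2 / 3 * (h ^ k * real (p n) powr (- (\<gamma> * real k)))"
    proof -
      have "exp (- m) = exp (- ((Mm - 1) * L)) * exp (- L)"
        by (simp add: m_def exp_add[symmetric] algebra_simps)
      also have "\<dots> < exp (- ((Mm - 1) * L)) * (c2 / 3)" using e(2) by (intro mult_strict_left_mono) auto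
      also have "\<dots> \<le> exp (- (real k / 2 * a) - \<gamma> * real k * b) * (c2 / 3)"
      proof (intro mult_right_mono)
        have "real k / 2 * a \<le> real q * a" using kq ab by (intro mult_right_mono) auto
        moreover have "\<gamma> * real k * b \<le> \<gamma> * real q * b" using kq ab \<gamma> by (intro mult_right_mono mult_left_mono) auto
        moreover have "(Mm - 1) * L = \<gamma> * real q * a + real q * a + \<gamma> * real q * b + real q * b"
          unfolding ab(3) by (simp add: Mm_def algebra_simps)
        moreover have "0 \<le> \<gamma> * real q * a" "0 \<le> real q * b" using \<gamma> ab by auto
        ultimately show "exp (- ((Mm - 1) * L)) \<le> exp (- (real k / 2 * a) - \<gamma> * real k * b)" by simp
      qed (use c2 in auto)
      also have "exp (- (real k / 2 * a) - \<gamma> * real k * b) = h ^ k * real (p n) powr (- (\<gamma> * real k))"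
        unfolding hk using p0 by (simp add: powr_def b_def exp_add[symmetric])
      finally show ?thesis by (simp add: mult.commute)
    qed
    define rhs where "rhs = real (p n choose k) powr (- \<gamma>) *
        (F2 * exp (- (real q ^ 2 * h\<^sup>2 * (C * real n) / 2)) * (2 * h) ^ k)"
    have rhs: "c2 * (h ^ k * real (p n) powr (- (\<gamma> * real k))) \<le> rhs"
    proof -
      have kp: "k \<le> p n" using card_mono[OF _ true_support_subset[of n]] by (simp add: k_def)
      have "real q ^ 2 * h\<^sup>2 * (C * real n) / 2 = real q ^ 2 * C * (h\<^sup>2 * real n) / 2" by simp
      also have "\<dots> = real q ^ 2 * C / 2" unfolding hn by simp
      finally have 1: "F2 * exp (- (real q ^ 2 * h\<^sup>2 * (C * real n) / 2)) = c2" by (simp add: c2_def)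
      have "h ^ k \<le> (2 * h) ^ k" using h0 by (intro power_mono) auto
      then have "real (p n) powr (- (\<gamma> * real k)) * (c2 * h ^ k) \<le> real (p n choose k) powr (- \<gamma>) * (c2 * (2 * h) ^ k)"
        using c2 h0 choose_powr_ge[OF \<gamma> kp p] by (intro mult_mono) auto
      then show ?thesis unfolding rhs_def 1 by (simp add: mult_ac)
    qed
    have hp: "h ^ k * real (p n) powr (- (\<gamma> * real k)) > 0" using h0 p0 by simp
    have "real (p n) * (2 * exp (t\<^sup>2 * (C * real n) / 2 - t * \<sigma>)) \<le> \<delta> / 8"
    proof -
      have "t\<^sup>2 * (C * real n) / 2 - t * \<sigma> = (t\<^sup>2 * real n) * (C / 2 - C0)"
        by (simp add: \<sigma>_def power2_eq_square algebra_simps)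
      also have "\<dots> = - (M0 * L)" unfolding tn by (simp add: C0_def algebra_simps)
      finally have "real (p n) * (2 * exp (t\<^sup>2 * (C * real n) / 2 - t * \<sigma>)) = 2 * exp (b - M0 * L)"
        unfolding ab(5) diff_conv_add_uminus[of b] exp_add[of b] by (simp only: mult.left_commute)
      also have "\<dots> \<le> 2 * exp (- (\<alpha> * a + \<beta> * b) - L)"
      proof -
        have "M0 * L = \<alpha> * a + \<beta> * b + (\<alpha> * b + \<beta> * a) + 2 * L" unfolding ab(3) by (simp add: M0_def algebra_simps)
        moreover have "0 \<le> \<alpha> * b" "0 \<le> \<beta> * a" using ab \<alpha> \<beta> by auto
        ultimately show ?thesis using ab by simp
      qed
      also have "\<dots> = 2 * \<delta> * exp (- L)" unfolding \<delta>(1) by (simp add: exp_add[symmetric])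
      also have "\<dots> \<le> 2 * \<delta> * (1 / 16)" using \<delta> e by (intro mult_left_mono) auto
      finally show ?thesis by simp
    qed
    moreover have "(real q + 1) * real (p n) ^ q * (2 * real (2 * q) ^ 2 *
        exp (- (real n * (a1 / (4 * real (2 * q)))\<^sup>2 / (2 * T ^ 4)))) \<le> \<delta> / 8"
    proof -
      have "(real q + 1) * real (p n) ^ q * (2 * real (2 * q) ^ 2 *
        exp (- (real n * (a1 / (4 * real (2 * q)))\<^sup>2 / (2 * T ^ 4)))) = K2 * exp (real q * b - real n * cH)"
      proof -
        have "exp (real q * b - real n * cH) = real (p n) ^ q * exp (- (real n * cH))"
          unfolding ab(5) diff_conv_add_uminus[of "real q * b"] exp_add[of "real q * b"] exp_of_nat_mult ..
        moreover have "real n * cH = real n * (a1 / (4 * real (2 * q)))\<^sup>2 / (2 * T ^ 4)" by (simp add: cH_def)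
        ultimately show ?thesis unfolding K2_def by (simp only: mult_ac)
      qed
      also have "\<dots> \<le> K2 * exp (- (\<alpha> * a + \<beta> * b) - L)"
      proof -
        have "L * (real q + \<beta> + \<alpha> + 1) \<le> real n * cH"
          using Lz(2) n0 \<alpha> \<beta> unfolding z2_def by (simp add: field_simps)
        moreover have "L * (real q + \<beta> + \<alpha> + 1) = real q * b + \<beta> * b + \<alpha> * a + L + (real q * a + \<beta> * a + \<alpha> * b)"
          unfolding ab(3) by (simp add: algebra_simps)
        moreover have "0 \<le> real q * a" "0 \<le> \<beta> * a" "0 \<le> \<alpha> * b" using ab \<alpha> \<beta> by auto
        ultimately have "real q * b - real n * cH \<le> - (\<alpha> * a + \<beta> * b) - L" by linarith
        then show ?thesis using K2 by (intro mult_left_mono) auto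
      qed
      also have "\<dots> = K2 * \<delta> * exp (- L)" unfolding \<delta>(1) by (simp add: exp_add[symmetric])
      also have "\<dots> \<le> K2 * \<delta> * (1 / (8 * K2))" using \<delta> K2 e by (intro mult_left_mono) auto
      finally show ?thesis using K2 by simp
    qed
    moreover have "(\<Sum>J\<in>{J. J \<subseteq> {1..p n} \<and> ?J0 \<subset> J \<and> card J \<le> q}. F1 * (2 * \<rho>) ^ card J / U J) \<le> \<delta> / 8"
    proof -
      \<comment> \<open>The price of one additional covariate. Since x \<le> 1, every power r \<ge>
        1 is bounded by x itself, so supersets with a single extra covariate set the rate.\<close>
      define x where "x = h * real (p n) powr (1 - \<gamma>)"
      have x0: "x \<ge> 0" using h0 by (simp add: x_def)
      have "x = exp (- (a / 2) + (1 - \<gamma>) * b)"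
        using hk[of 1] p0 by (simp add: x_def powr_def b_def exp_add[symmetric])
      also have "\<dots> \<le> exp (- (\<alpha> * a + \<beta> * b) - \<epsilon> * L)"
        using elim(2) unfolding ab(3) a_def[symmetric] b_def[symmetric] by (simp add: algebra_simps)
      also have "\<dots> = \<delta> * exp (- (\<epsilon> * L))" unfolding \<delta>(1) by (simp add: exp_add[symmetric])
      finally have x: "x \<le> \<delta> * exp (- (\<epsilon> * L))" .
      also have "\<dots> \<le> 1 * 1"
      proof (intro mult_mono)
        have "0 \<le> \<alpha> * a" "0 \<le> \<beta> * b" using ab \<alpha> \<beta> by auto
        then show "\<delta> \<le> 1" unfolding \<delta>(1) by simp
      qed (use \<delta> \<epsilon> L1 in auto)
      finally have x1: "x \<le> 1" by simp
      have tb: "F1 * (2 * \<rho>) ^ card J / U J \<le> K3 * L ^ q * x * (1 / real (p n)) ^ (card J - k)"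
        if J: "J \<subseteq> {1..p n}" "?J0 \<subset> J" "card J \<le> q" for J
      proof -
        have "card ?J0 < card J" using J finite_subset[OF J(1)] by (intro psubset_card_mono) auto
        then have "k < card J" by (simp add: k_def)
        then obtain r where r: "card J = k + r" "r \<ge> 1" "card J - k = r"
          by (intro that[of "card J - k"]) auto
        have "F1 * (2 * \<rho>) ^ card J / U J
          = F1 * (2 * (C\<rho> * (sqrt L * h))) ^ (k + r) / (c3 * h ^ k * real (p n) powr (\<gamma> * real r))"
          by (simp add: \<rho>_def th U_def r)
        also have "\<dots> \<le> F1 * (2 * C\<rho>) ^ q / c3 * L ^ q * (1 / real (p n)) ^ r * (h * real (p n) powr (1 - \<gamma>)) ^ r"
          using p0 L1 h0 c3 F C\<rho> r(1) J(3) by (intro superset_term_bound) auto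
        also have "\<dots> = K3 * L ^ q * (1 / real (p n)) ^ r * x ^ r" by (simp add: K3_def x_def)
        also have "\<dots> \<le> K3 * L ^ q * (1 / real (p n)) ^ r * x"
          using power_decreasing[OF r(2) x0 x1] K3 L1 by (intro mult_left_mono) auto
        finally show ?thesis unfolding r(3) by (simp add: mult_ac)
      qed
      have "(\<Sum>J\<in>{J. J \<subseteq> {1..p n} \<and> ?J0 \<subset> J \<and> card J \<le> q}. F1 * (2 * \<rho>) ^ card J / U J)
        \<le> (\<Sum>J\<in>{J. J \<subseteq> {1..p n} \<and> ?J0 \<subset> J \<and> card J \<le> q}. K3 * L ^ q * x * (1 / real (p n)) ^ (card J - k))"
        using tb by (intro sum_mono) auto
      also have "\<dots> \<le> K3 * L ^ q * x * real q"
        unfolding sum_distrib_left[symmetric] k_def using K3 L1 x0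
        by (intro mult_left_mono sum_supersets_le p true_support_subset) auto
      also have "\<dots> \<le> K3 * L ^ q * (\<delta> * exp (- (\<epsilon> * L))) * real q"
        using x K3 L1 by (intro mult_right_mono mult_left_mono) auto
      also have "\<dots> = real q * K3 * \<delta> * (L ^ q * exp (- (\<epsilon> * L)))" by (simp add: mult_ac)
      also have "\<dots> \<le> real q * K3 * \<delta> * (1 / (8 * (real q * K3)))"
        using e(4) K3 \<delta> by (intro mult_left_mono) auto
      also have "\<dots> = \<delta> / 8" using q K3 by simp
      finally show ?thesis .
    qed
    moreover have "measure (M n) (G n)
      - (real (p n) * (2 * exp (t\<^sup>2 * (C * real n) / 2 - t * \<sigma>))
       + (real q + 1) * real (p n) ^ q *
         (2 * real (2 * q) ^ 2 * exp (- (real n * (a1 / (4 * real (2 * q)))\<^sup>2 / (2 * T ^ 4))))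
       + (\<Sum>J\<in>{J. J \<subseteq> {1..p n} \<and> ?J0 \<subset> J \<and> card J \<le> q}. F1 * (2 * \<rho>) ^ card J / U J))
      \<le> selection_prob q \<gamma> f n"
    proof (rule selection_probability[OF n(1) q reg(2)[OF n(1)] reg(4)[OF n(1)] R a1 reg(3)[OF n(1)] m4(1) m4(2)[OF n(1)]
          _ T2 c Gm[OF n(1)] _ _ C prior t0, where \<rho> = \<rho> and \<sigma> = \<sigma> and m = m and h = h and U = U])
      show "T > 0" using T1 by simp
      show "t * \<bar>cov_matrix n \<omega> i j\<bar> \<le> 1" if "\<omega> \<in> G n" "i \<in> {1..n}" "j \<in> {1..p n}" for \<omega> i j
        using elim(3) that unfolding t_def L_def by blast
      show "weighted_square_sum n \<omega> j \<le> C * real n"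
        if "\<omega> \<in> G n" "j \<in> {1..p n}" for \<omega> j
        using elim(3) that by blast
      show "\<rho> > 0" using C\<rho> t0 by (simp add: \<rho>_def)
      show "\<sigma> \<ge> 0" using C0 n0 t0 by (simp add: \<sigma>_def)
      show "m \<ge> 0" using Mm L1 by (simp add: m_def)
      show "h \<ge> 0" using h0 by simp
      show "real q * h \<le> t"
      proof -
        have "real q \<le> sqrt L" using L1(2) by (intro real_le_rsqrt)
        then show ?thesis unfolding th using h0 by (intro mult_right_mono) auto
      qed
      show "real q * h \<le> 1"
      proof -
        have "real q ^ 2 \<le> real n" using n(2) by (metis of_nat_le_iff of_nat_power)
        then have "real q \<le> sqrt (real n)" by (intro real_le_rsqrt)
        then show ?thesis using n0 by (simp add: h_def)
      qed
      show "\<rho> * (real (2 * q) * T) \<le> 1"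
      proof -
        define w where "w = C\<rho> * (real (2 * q) * T)"
        have w: "w > 0" using C\<rho> q T1 by (simp add: w_def)
        have "t \<le> sqrt z1" unfolding t_def using Lz by (intro real_sqrt_le_mono)
        also have "sqrt z1 = 1 / w" using w unfolding z1_def w_def[symmetric] by simp
        finally have "t * w \<le> 1" using w by (simp add: field_simps)
        then show ?thesis by (simp add: \<rho>_def w_def mult_ac)
      qed
      show "\<rho> \<le> \<bar>\<phi>s n j\<bar>" if "j \<in> ?J0" for j
      proof -
        have "t \<le> 1 / C\<rho> * \<bar>\<phi>s n j\<bar>" using elim(4) that unfolding t_def L_def logsize_def by blast
        then show ?thesis using C\<rho> by (simp add: \<rho>_def field_simps)
      qed
      show "\<sigma> * (real (2 * q) * \<rho>) - c * a1 / 2 * real n * \<rho>\<^sup>2 \<le> - m"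
      proof -
        have "\<sigma> * (real (2 * q) * \<rho>) - c * a1 / 2 * real n * \<rho>\<^sup>2
           = (t\<^sup>2 * real n) * (C0 * (2 * real q) * C\<rho> - c * a1 / 2 * C\<rho>\<^sup>2)"
          by (simp add: \<sigma>_def \<rho>_def power2_eq_square algebra_simps)
        also have "\<dots> \<le> L * (- Mm)" unfolding tn using C\<rho>' L1 by (intro mult_left_mono) auto
        finally show ?thesis by (simp add: m_def mult.commute)
      qed
      show "U J > 0" for J using c3 h0 p0 by (simp add: U_def)
      show "real (p n choose card J) powr (- \<gamma>) * exp (- m) < real (p n choose card ?J0) powr (- \<gamma>) *
        (F2 * exp (- (real q ^ 2 * h\<^sup>2 * (C * real n) / 2)) * (2 * h) ^ card ?J0)"
        if J: "J \<subseteq> {1..p n}" for J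
      proof -
        have "card J \<le> p n" using card_mono[OF _ J] by simp
        then have "real (p n choose card J) \<ge> 1" using zero_less_binomial[of "card J" "p n"] by linarith
        then have "real (p n choose card J) powr (- \<gamma>) \<le> 1"
          using \<gamma> by (simp add: powr_minus ge_one_powr_ge_zero inverse_le_1_iff)
        then have "real (p n choose card J) powr (- \<gamma>) * exp (- m) \<le> 1 * exp (- m)" by (intro mult_right_mono) auto
        also have "1 * exp (- m) < c2 / 3 * (h ^ k * real (p n) powr (- (\<gamma> * real k)))" using small_m by simp
        also have "\<dots> \<le> c2 * (h ^ k * real (p n) powr (- (\<gamma> * real k)))"
          using c2 hp by (intro mult_right_mono) auto
        also note rhs
        finally show ?thesis unfolding rhs_def k_def .
      qed
      show "real (p n choose card J) powr (- \<gamma>) * (U J + exp (- m)) < real (p n choose card ?J0) powr (- \<gamma>) *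
        (F2 * exp (- (real q ^ 2 * h\<^sup>2 * (C * real n) / 2)) * (2 * h) ^ card ?J0)"
        if J: "J \<subseteq> {1..p n}" "?J0 \<subset> J" "card J \<le> q" for J
      proof -
        define H where "H = h ^ k * real (p n) powr (- (\<gamma> * real k))"
        have kJ: "k \<le> card J" unfolding k_def using J finite_subset[OF J(1)] by (intro card_mono) auto
        have Jp: "card J \<le> p n" using card_mono[OF _ J(1)] by simp
        have "real (p n choose card J) \<ge> 1" using zero_less_binomial[OF Jp] by linarith
        then have b1: "real (p n choose card J) powr (- \<gamma>) \<le> 1"
          using \<gamma> by (simp add: powr_minus ge_one_powr_ge_zero inverse_le_1_iff)
        have U0: "U J > 0" using c3 h0 p0 by (simp add: U_def)
        have "real (p n choose card J) powr (- \<gamma>) * U J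
          \<le> real q powr (real q * \<gamma>) * real (p n) powr (- (\<gamma> * real (card J))) * U J"
          using choose_powr_le[OF \<gamma> J(3) Jp q p] U0 by (intro mult_right_mono) auto
        also have "\<dots> = (real q powr (real q * \<gamma>) * real q powr (- (real q * \<gamma>))) * (c2 / 3) * h ^ k *
            (real (p n) powr (- (\<gamma> * real (card J))) * real (p n) powr (\<gamma> * real (card J - k)))"
          by (simp add: U_def c3_def mult_ac)
        also have "real q powr (real q * \<gamma>) * real q powr (- (real q * \<gamma>)) = 1"
          using q by (simp add: powr_add[symmetric])
        also have "real (p n) powr (- (\<gamma> * real (card J))) * real (p n) powr (\<gamma> * real (card J - k)) = real (p n) powr (- (\<gamma> * real k))"
          using kJ by (simp add: powr_add[symmetric] of_nat_diff algebra_simps)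
        finally have "real (p n choose card J) powr (- \<gamma>) * U J \<le> c2 / 3 * H" by (simp add: H_def mult_ac)
        moreover have "real (p n choose card J) powr (- \<gamma>) * exp (- m) \<le> 1 * exp (- m)"
          using b1 by (intro mult_right_mono) auto
        moreover have "exp (- m) < c2 / 3 * H" using small_m by (simp add: H_def)
        ultimately have "real (p n choose card J) powr (- \<gamma>) * (U J + exp (- m)) < c2 / 3 * H + c2 / 3 * H"
          unfolding distrib_left by linarith
        also have "\<dots> \<le> c2 * H" using c2 hp by (simp add: H_def)
        also note rhs[folded H_def]
        finally show ?thesis unfolding rhs_def k_def .
      qed
    qed
    ultimately show ?case using \<delta>(2) unfolding \<delta>_def[symmetric] by linarith
  qed
qed

end

section \<open>Good covariate events\<close>

lemma pow4_le_one_plus: "x ^ 4 \<le> 1 + \<bar>x\<bar> ^ m" if "m \<ge> 4" for x :: real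
proof (cases "\<bar>x\<bar> \<le> 1")
  case True
  then have "\<bar>x\<bar> ^ 4 \<le> 1" by (intro power_le_one) auto
  moreover have "0 \<le> \<bar>x\<bar> ^ m" by simp
  ultimately have "\<bar>x\<bar> ^ 4 \<le> 1 + \<bar>x\<bar> ^ m" by linarith
  then show ?thesis by (simp add: power_even_abs)
next
  case False
  then have "\<bar>x\<bar> ^ 4 \<le> \<bar>x\<bar> ^ m" using that by (intro power_increasing) auto
  then show ?thesis by (simp add: power_even_abs)
qed

context glm_sequence
begin

lemma true_support_coeff_le:
  assumes "L2_set (\<phi>s n) {1..p n} \<le> a3" "j \<in> {1..p n}"
  shows "\<bar>\<phi>s n j\<bar> \<le> a3"
  using L2_set_member_abs[of "{1..p n}" j "\<phi>s n"] assms by simp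

lemma linear_predictor_le:
  assumes "L2_set (\<phi>s n) {1..p n} \<le> a3"
  shows "\<bar>dot (p n) x (\<phi>s n)\<bar> \<le> a3 * (\<Sum>j\<in>true_support p \<phi>s n. \<bar>x j\<bar>)"
  using true_support_coeff_le[OF assms] true_support_subset[of n]
  by (intro abs_dot_le) (auto simp: true_support_def)

text \<open>The good event is that all entries are bounded; it has probability one. The assumption
  concerns the first row, and identical distribution transfers it to the others.\<close>

lemma selection_bounded:
  assumes regime: "sparse_regression_regime M X p \<phi>s q a1 a2 a3" and a1: "a1 > 0" and q: "q \<ge> 1"
    and \<gamma>: "\<gamma> \<ge> 0" and \<alpha>: "\<alpha> > 0" and \<beta>: "\<beta> > 0"
    and adm: "admissible_scalars \<alpha> \<beta> \<gamma> (limsup (growth_rate p))" "admissible_scalars \<alpha> \<beta> \<gamma> (liminf (growth_rate p))"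
    and prior: "prior_conditions p q R f F1 F2 F3" and R: "a3 \<le> R"
    and bounded: "bounded_covariates M X p A"
  shows "\<forall>\<^sub>F n in sequentially. selection_prob q \<gamma> f n
     \<ge> 1 - real n powr (- \<alpha>) * real (p n) powr (- \<beta>)"
proof -
  \<comment> \<open>A may be 0 or negative; the proof divides by the bound.\<close>
  define A' where "A' = \<bar>A\<bar> + 1"
  have A': "A' \<ge> 1" "A \<le> A'" by (auto simp: A'_def)
  have card: "card (true_support p \<phi>s n) \<le> q" and norm: "L2_set (\<phi>s n) {1..p n} \<le> a3" if "n \<ge> 1" for n
    using regime that unfolding sparse_regression_regime_def by auto
  have a3: "a3 \<ge> 0" using norm[of 1] L2_set_nonneg order_trans by blast
  have logp: "(\<lambda>n. ln (real (p n))) \<in> o(\<lambda>n. real n)"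
    using regime unfolding sparse_regression_regime_def by blast
  have AE: "AE \<omega> in M n. \<bar>X n 1 j \<omega>\<bar> \<le> A" if "n \<ge> 1" "j \<in> {1..p n}" for n j
    using bounded that unfolding bounded_covariates_def by blast
  define Bad where "Bad = (\<lambda>n. {r \<in> space (PiM {1..p n} (\<lambda>_. borel)). \<exists>j\<in>{1..p n}. \<bar>r j\<bar> > A'})"
  define G where "G = (\<lambda>n. space (M n) - {\<omega> \<in> space (M n). \<exists>i\<in>{1..n}. covariate_row X p n i \<omega> \<in> Bad n})"
  define W where "W = sup_cgf'' (a3 * (real q * A'))"
  define C where "C = A'\<^sup>2 * W"
  have W: "W > 0" unfolding W_def by (rule sup_cgf''_pos)
  have Bm: "Bad n \<in> sets (PiM {1..p n} (\<lambda>_. borel))" for n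
    unfolding Bad_def by measurable
  have B0: "measure (M n) {\<omega> \<in> space (M n). covariate_row X p n 1 \<omega> \<in> Bad n} \<le> 0" if n: "n \<ge> 1" for n
  proof -
    have "AE \<omega> in M n. \<forall>j\<in>{1..p n}. \<bar>X n 1 j \<omega>\<bar> \<le> A" using AE[OF n] by (intro AE_finite_allI) auto
    then have "AE \<omega> in M n. covariate_row X p n 1 \<omega> \<notin> Bad n"
      by eventually_elim (use A' in \<open>fastforce simp: Bad_def covariate_row_def\<close>)
    then have "emeasure (M n) {\<omega> \<in> space (M n). covariate_row X p n 1 \<omega> \<in> Bad n} = 0"
      using measurable_row[OF n, of 1] Bm[of n] n by (subst (asm) AE_iff_measurable[OF _ refl]) auto
    then show ?thesis by (simp add: measure_def)
  qed
  have Gm: "G n \<in> sets (M n)" and Gp: "measure (M n) (G n) \<ge> 1" if n: "n \<ge> 1" for n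
  proof -
    interpret prob_space "M n" by (rule prob[OF n])
    note s = measure_some_row[OF n Bm B0[OF n]]
    show "G n \<in> sets (M n)" unfolding G_def using s(1) by auto
    show "measure (M n) (G n) \<ge> 1" unfolding G_def using s prob_compl[OF s(1)] by simp
  qed
  have bound: "\<bar>cov_matrix n \<omega> i j\<bar> \<le> A'" if n: "n \<ge> 1" and \<omega>: "\<omega> \<in> G n" and ij: "i \<in> {1..n}" "j \<in> {1..p n}" for n \<omega> i j
  proof -
    have sp: "covariate_row X p n i \<omega> \<in> space (PiM {1..p n} (\<lambda>_. borel))"
      using measurable_space[OF measurable_row[OF n ij(1)]] \<omega> by (auto simp: G_def)
    have "covariate_row X p n i \<omega> \<notin> Bad n" using \<omega> ij unfolding G_def by blast
    then show ?thesis using sp ij unfolding Bad_def cov_matrix_row[OF ij(1)] by (auto simp: not_less)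
  qed
  have "\<forall>\<^sub>F n in sequentially. selection_prob q \<gamma> f n
     \<ge> measure (M n) (G n) - real n powr (- \<alpha>) * real (p n) powr (- \<beta>) / 2"
  proof (rule selection_eventually[OF regime a1 q \<gamma> \<alpha> \<beta> adm prior R])
    show "0 \<le> A' ^ 4" by simp
    show "(\<integral>\<^sup>+\<omega>. ennreal ((X n 1 j \<omega>) ^ 4) \<partial>M n) \<le> ennreal (A' ^ 4)" if n: "n \<ge> 1" and j: "j \<in> {1..p n}" for n j
    proof -
      interpret prob_space "M n" by (rule prob[OF n])
      have "(\<integral>\<^sup>+\<omega>. ennreal ((X n 1 j \<omega>) ^ 4) \<partial>M n) \<le> (\<integral>\<^sup>+\<omega>. ennreal (A' ^ 4) \<partial>M n)"
      proof (rule nn_integral_mono_AE)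
        show "AE \<omega> in M n. ennreal ((X n 1 j \<omega>) ^ 4) \<le> ennreal (A' ^ 4)"
          using AE[OF n j]
        proof eventually_elim
          case (elim \<omega>)
          then have "\<bar>X n 1 j \<omega>\<bar> ^ 4 \<le> A' ^ 4" using A' by (intro power_mono) auto
          then show ?case by (intro ennreal_leI) (simp add: power_even_abs)
        qed
      qed
      then show ?thesis by (simp add: emeasure_space_1)
    qed
    show "0 \<le> C" using W by (simp add: C_def)
    show "G n \<in> sets (M n)" if "n \<ge> 1" for n by (rule Gm[OF that])
    have "(1 / A')\<^sup>2 > 0" using A' by simp
    then have "\<forall>\<^sub>F n in sequentially. logsize n / real n < (1 / A')\<^sup>2"
      by (rule order_tendstoD(2)[OF logsize_over_n[OF logp]])
    then show "\<forall>\<^sub>F n in sequentially. \<forall>\<omega>\<in>G n. \<forall>j\<in>{1..p n}.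
       (\<forall>i\<in>{1..n}. sqrt (logsize n / real n) * \<bar>cov_matrix n \<omega> i j\<bar> \<le> 1) \<and>
       weighted_square_sum n \<omega> j \<le> C * real n"
      using eventually_ge_at_top[of 1]
    proof eventually_elim
      case (elim n)
      show ?case
      proof (intro ballI conjI)
        fix \<omega> i j assume \<omega>: "\<omega> \<in> G n" and ij: "j \<in> {1..p n}" "i \<in> {1..n}"
        have "sqrt (logsize n / real n) \<le> 1 / A'"
          using real_sqrt_le_mono[OF less_imp_le[OF elim(1)]] A' by simp
        then have "sqrt (logsize n / real n) * \<bar>cov_matrix n \<omega> i j\<bar> \<le> 1 / A' * A'"
          using bound[OF elim(2) \<omega> ij(2,1)] A' by (intro mult_mono) auto
        then show "sqrt (logsize n / real n) * \<bar>cov_matrix n \<omega> i j\<bar> \<le> 1" using A' by simp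
      next
        fix \<omega> j assume \<omega>: "\<omega> \<in> G n" and j: "j \<in> {1..p n}"
        have "weighted_square_sum n \<omega> j \<le> (\<Sum>i\<in>{1..n}. C)"
        proof (rule sum_mono)
          fix i assume i: "i \<in> {1..n}"
          have "\<bar>dot (p n) (cov_matrix n \<omega> i) (\<phi>s n)\<bar> \<le> a3 * (\<Sum>j\<in>true_support p \<phi>s n. \<bar>cov_matrix n \<omega> i j\<bar>)"
            by (rule linear_predictor_le[OF norm[OF elim(2)]])
          also have "(\<Sum>j\<in>true_support p \<phi>s n. \<bar>cov_matrix n \<omega> i j\<bar>) \<le> real (card (true_support p \<phi>s n)) * A'"
            using bound[OF elim(2) \<omega> i] true_support_subset[of n]
              sum_bounded_above[of "true_support p \<phi>s n" "\<lambda>j. \<bar>cov_matrix n \<omega> i j\<bar>" A'] by blast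
          also have "\<dots> \<le> real q * A'" using card[OF elim(2)] A' by (intro mult_right_mono) auto
          finally have "\<bar>dot (p n) (cov_matrix n \<omega> i) (\<phi>s n)\<bar> \<le> a3 * (real q * A')" using a3 by (simp add: mult_left_mono)
          then have "sup_cgf'' (dot (p n) (cov_matrix n \<omega> i) (\<phi>s n)) \<le> W"
            unfolding W_def by (intro sup_cgf''_mono) simp
          moreover have "(cov_matrix n \<omega> i j)\<^sup>2 \<le> A'\<^sup>2"
            using bound[OF elim(2) \<omega> i j] A' by (intro iffD1[OF abs_le_square_iff]) auto
          ultimately show "(cov_matrix n \<omega> i j)\<^sup>2 * sup_cgf'' (dot (p n) (cov_matrix n \<omega> i) (\<phi>s n)) \<le> C"
            unfolding C_def by (intro mult_mono less_imp_le[OF sup_cgf''_pos]) auto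
        qed
        then show "weighted_square_sum n \<omega> j \<le> C * real n"
          by (simp add: mult.commute)
      qed
    qed
  qed
  then show ?thesis
    using eventually_ge_at_top[of 1]
  proof eventually_elim
    case (elim n)
    have "real n powr (- \<alpha>) * real (p n) powr (- \<beta>) \<ge> 0" by simp
    then show ?case using elim Gp[of n] by linarith
  qed
qed

text \<open>The curvature weight at the linear predictor depends on the covariates in the true support only,
  so no union bound over all p covariates is paid for its tail. This is what makes K = 2 suffice.\<close>

definition weight_bound :: "real \<Rightarrow> real \<Rightarrow> real" where
  "weight_bound \<tau> s = \<tau> * \<bar>s\<bar> * sup_cgf''' (\<tau> * s)"

lemma weight_bound_nonneg: "\<tau> \<ge> 0 \<Longrightarrow> weight_bound \<tau> s \<ge> 0"
  unfolding weight_bound_def by (intro mult_nonneg_nonneg sup_cgf'''_nonneg) auto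

lemma measurable_weight_bound [measurable]: "weight_bound \<tau> \<in> borel_measurable borel"
  unfolding weight_bound_def [abs_def] by measurable

text \<open>The predictor is at most a3 * q times the largest covariate in the true support, so the
  weight is a function of that single covariate, and the maximum is bounded by the sum. In \<tau>
  the factor 2 comes from \<open>sup_cgf''_le\<close>, and the 1 keeps \<tau> positive, as the
  moment condition requires.\<close>

lemma sup_cgf''_predictor_le:
  assumes norm: "L2_set (\<phi>s n) {1..p n} \<le> a3" and card: "card (true_support p \<phi>s n) \<le> q"
    and \<tau>: "\<tau> = 2 * (a3 * real q) + 1"
  shows "sup_cgf'' (dot (p n) x (\<phi>s n)) \<le> sup_cgf'' 1 + (\<Sum>k\<in>true_support p \<phi>s n. weight_bound \<tau> (x k))"
proof -
  let ?J = "true_support p \<phi>s n" and ?\<theta> = "dot (p n) x (\<phi>s n)"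
  have fin: "finite ?J" using true_support_subset finite_subset by blast
  have a3: "a3 \<ge> 0" using norm L2_set_nonneg order_trans by blast
  have \<tau>0: "\<tau> \<ge> 0" using a3 \<tau> by simp
  show ?thesis
  proof (cases "?J = {}")
    case True
    then have "?\<theta> = 0" using linear_predictor_le[OF norm, of x] by simp
    then show ?thesis using True sup_cgf''_mono[of 0 1] by simp
  next
    case False
    have "Max ((\<lambda>k. \<bar>x k\<bar>) ` ?J) \<in> (\<lambda>k. \<bar>x k\<bar>) ` ?J" using fin False by (intro Max_in) auto
    then obtain l where lJ: "l \<in> ?J" and lM: "Max ((\<lambda>k. \<bar>x k\<bar>) ` ?J) = \<bar>x l\<bar>" by auto
    have l: "l \<in> ?J" "\<And>k. k \<in> ?J \<Longrightarrow> \<bar>x k\<bar> \<le> \<bar>x l\<bar>"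
      unfolding lM[symmetric] using fin lJ by (auto intro!: Max_ge)
    have "\<bar>?\<theta>\<bar> \<le> a3 * (\<Sum>j\<in>?J. \<bar>x j\<bar>)" by (rule linear_predictor_le[OF norm])
    also have "(\<Sum>j\<in>?J. \<bar>x j\<bar>) \<le> real (card ?J) * \<bar>x l\<bar>" using l(2) by (rule sum_bounded_above)
    also have "\<dots> \<le> real q * \<bar>x l\<bar>" using card by (intro mult_right_mono) auto
    finally have "\<bar>?\<theta>\<bar> \<le> a3 * (real q * \<bar>x l\<bar>)" using a3 by (simp add: mult_left_mono)
    then have \<theta>: "2 * \<bar>?\<theta>\<bar> \<le> \<tau> * \<bar>x l\<bar>" using \<tau> by (simp add: algebra_simps)
    have "sup_cgf'' ?\<theta> \<le> sup_cgf'' 1 + 2 * \<bar>?\<theta>\<bar> * sup_cgf''' (2 * ?\<theta>)" by (rule sup_cgf''_le)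
    also have "2 * \<bar>?\<theta>\<bar> * sup_cgf''' (2 * ?\<theta>) \<le> weight_bound \<tau> (x l)"
    proof -
      have "sup_cgf''' (2 * ?\<theta>) \<le> sup_cgf''' (\<tau> * x l)"
        using \<theta> \<tau>0 by (intro sup_cgf'''_mono) (simp add: abs_mult)
      moreover have "0 \<le> \<tau> * \<bar>x l\<bar>" using \<tau>0 by simp
      ultimately show ?thesis
        unfolding weight_bound_def using mult_mono[OF \<theta> _ _ sup_cgf'''_nonneg] by blast
    qed
    also have "weight_bound \<tau> (x l) \<le> (\<Sum>k\<in>?J. weight_bound \<tau> (x k))"
      using l(1) fin weight_bound_nonneg[OF \<tau>0] by (intro member_le_sum) auto
    finally show ?thesis by simp
  qed
qed

lemma moment_sup_cgf''':
  assumes "moment_covariates \<mu> M X p K AK B" and n: "n \<ge> 1" and j: "j \<in> {1..p n}" and t: "t > 0"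
  shows "(\<integral>\<^sup>+\<omega>. ennreal (sup_cgf''' (t * X n 1 j \<omega>) ^ (2 * K)) \<partial>M n) \<le> ennreal (B t)"
proof -
  have "(\<integral>\<^sup>+\<omega>. ennreal (sup_cgf''' (t * X n 1 j \<omega>) ^ (2 * K)) \<partial>M n)
    \<le> (\<integral>\<^sup>+\<omega>. (SUP \<theta>\<in>{\<theta>. \<bar>\<theta>\<bar> \<le> t * \<bar>X n 1 j \<omega>\<bar>}. ennreal (\<bar>cgf''' \<theta>\<bar> ^ (2 * K))) \<partial>M n)"
  proof (rule nn_integral_mono)
    fix \<omega>
    obtain x where "\<bar>x\<bar> \<le> \<bar>t * X n 1 j \<omega>\<bar>" "sup_cgf''' (t * X n 1 j \<omega>) = \<bar>cgf''' x\<bar>"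
      using sup_cgf'''_attained by blast
    then show "ennreal (sup_cgf''' (t * X n 1 j \<omega>) ^ (2 * K))
       \<le> (SUP \<theta>\<in>{\<theta>. \<bar>\<theta>\<bar> \<le> t * \<bar>X n 1 j \<omega>\<bar>}. ennreal (\<bar>cgf''' \<theta>\<bar> ^ (2 * K)))"
      using t by (intro SUP_upper2[of x]) (auto simp: abs_mult)
  qed
  also have "\<dots> \<le> ennreal (B t)" using assms unfolding moment_covariates_def by blast
  finally show ?thesis .
qed

text \<open>The weighted squares have heavy tails, so they are truncated at m and their sum is
  handled by \<open>row_sum_Chernoff\<close>. Two further bad events make the truncation inactive:
  an entry beyond s, with a union over all p covariates, and a weight beyond y ^ 4, with a union
  over the true support only. The latter being cheaper, y may be chosen smaller than s.\<close>

lemma moment_event: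
  assumes regime: "card (true_support p \<phi>s n) \<le> q" "L2_set (\<phi>s n) {1..p n} \<le> a3"
    and moment: "moment_covariates \<mu> M X p K AK B" and K: "K \<ge> 2" and n: "n \<ge> 1"
    and \<tau>: "\<tau> = 2 * (a3 * real q) + 1"
    and bds: "AK \<le> A'" "B \<tau> \<le> B'" "A' \<ge> 0" "B' \<ge> 0"
    and z: "z = sup_cgf'' 1 * (1 + A') + real q * ((1 + A') + \<tau>\<^sup>2 * ((1 + A') + (1 + B')))"
    and s: "s > 0" and y: "y > 0" and m: "s\<^sup>2 * (sup_cgf'' 1 + real q * y ^ 4) \<le> m"
  obtains G where "G \<in> sets (M n)"
    "measure (M n) G \<ge> 1 - (real n * (real (p n) * (A' / s ^ (6 * K)))
        + real n * (real q * ((A' * \<tau> ^ (6 * K) + B') / y ^ (6 * K)))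
        + real (p n) * exp (- (real n / m)))"
    "\<And>\<omega> i j. \<omega> \<in> G \<Longrightarrow> i \<in> {1..n} \<Longrightarrow> j \<in> {1..p n} \<Longrightarrow> \<bar>cov_matrix n \<omega> i j\<bar> \<le> s"
    "\<And>\<omega> j. \<omega> \<in> G \<Longrightarrow> j \<in> {1..p n} \<Longrightarrow>
      weighted_square_sum n \<omega> j \<le> (2 * z + 1) * real n"
proof -
  interpret prob_space "M n" by (rule prob[OF n])
  let ?J = "true_support p \<phi>s n" and ?P = "PiM {1..p n} (\<lambda>_. borel :: real measure)"
  let ?r = "covariate_row X p n"
  let ?w = "weight_bound \<tau>"
  have fin: "finite ?J" using true_support_subset finite_subset by blast
  have Jp: "k \<in> {1..p n}" if "k \<in> ?J" for k using true_support_subset that by blast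
  have a3: "a3 \<ge> 0" using regime(2) L2_set_nonneg order_trans by blast
  have \<tau>1: "\<tau> \<ge> 1" using a3 \<tau> by simp
  have w1: "sup_cgf'' 1 > 0" by (rule sup_cgf''_pos)
  have m0: "m > 0"
  proof -
    have "0 < s\<^sup>2 * (sup_cgf'' 1 + real q * y ^ 4)" using s y w1 by (intro mult_pos_pos add_pos_nonneg) auto
    then show ?thesis using m by linarith
  qed
  have Xm [measurable]: "X n 1 j \<in> borel_measurable (M n)" if "j \<in> {1..p n}" for j
    using that n by (intro measurable_X) auto
  have row1: "?r 1 \<omega> j = X n 1 j \<omega>" if "j \<in> {1..p n}" for j \<omega> using that by (simp add: covariate_row_def)
  have IX: "(\<integral>\<^sup>+\<omega>. ennreal (\<bar>X n 1 j \<omega>\<bar> ^ (6 * K)) \<partial>M n) \<le> ennreal A'" if "j \<in> {1..p n}" for j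
  proof -
    have "(\<integral>\<^sup>+\<omega>. ennreal (\<bar>X n 1 j \<omega>\<bar> ^ (6 * K)) \<partial>M n) \<le> ennreal AK"
      using moment n that unfolding moment_covariates_def by blast
    then show ?thesis using ennreal_leI[OF bds(1)] by (rule order_trans)
  qed
  have IV: "(\<integral>\<^sup>+\<omega>. ennreal (sup_cgf''' (\<tau> * X n 1 j \<omega>) ^ (2 * K)) \<partial>M n) \<le> ennreal B'" if "j \<in> {1..p n}" for j
  proof -
    have "\<tau> > 0" using \<tau>1 by simp
    from moment_sup_cgf'''[OF moment n that this] show ?thesis using ennreal_leI[OF bds(2)] by (rule order_trans)
  qed
  have PX: "prob {\<omega> \<in> space (M n). \<bar>X n 1 j \<omega>\<bar> > c} \<le> A' / c ^ (6 * K)" if j: "j \<in> {1..p n}" and c: "c > 0" for j c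
  proof (rule prob_le_nn_integral[OF _ _ bds(3) _ IX[OF j]])
    show "{\<omega> \<in> space (M n). \<bar>X n 1 j \<omega>\<bar> > c} \<in> events" using Xm[OF j] by measurable
    show "ennreal (c ^ (6 * K)) \<le> ennreal (\<bar>X n 1 j \<omega>\<bar> ^ (6 * K))" if "\<omega> \<in> {\<omega> \<in> space (M n). \<bar>X n 1 j \<omega>\<bar> > c}" for \<omega>
      using that c by (intro ennreal_leI power_mono) auto
  qed (use c in simp)
  have PV: "prob {\<omega> \<in> space (M n). sup_cgf''' (\<tau> * X n 1 j \<omega>) > c} \<le> B' / c ^ (2 * K)" if j: "j \<in> {1..p n}" and c: "c > 0" for j c
  proof (rule prob_le_nn_integral[OF _ _ bds(4) _ IV[OF j]])
    show "{\<omega> \<in> space (M n). sup_cgf''' (\<tau> * X n 1 j \<omega>) > c} \<in> events" using Xm[OF j] by measurable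
    show "ennreal (c ^ (2 * K)) \<le> ennreal (sup_cgf''' (\<tau> * X n 1 j \<omega>) ^ (2 * K))"
      if "\<omega> \<in> {\<omega> \<in> space (M n). sup_cgf''' (\<tau> * X n 1 j \<omega>) > c}" for \<omega>
      using that c by (intro ennreal_leI power_mono) auto
  qed (use c in simp)

  define A1 where "A1 = {r \<in> space ?P. \<exists>j\<in>{1..p n}. \<bar>r j\<bar> > s}"
  define A2 where "A2 = {r \<in> space ?P. \<exists>k\<in>?J. ?w (r k) > y ^ 4}"
  have A1m: "A1 \<in> sets ?P" unfolding A1_def by measurable
  have A2m: "A2 \<in> sets ?P"
  proof -
    have "Measurable.pred ?P (\<lambda>r. \<exists>k\<in>?J. ?w (r k) > y ^ 4)"
    proof (intro pred_intros_finite fin)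
      fix k assume "k \<in> ?J"
      from Jp[OF this] show "Measurable.pred ?P (\<lambda>r. ?w (r k) > y ^ 4)" by measurable
    qed
    then show ?thesis unfolding A2_def by measurable
  qed
  have sp1: "?r 1 \<omega> \<in> space ?P" if "\<omega> \<in> space (M n)" for \<omega>
    using measurable_space[OF measurable_row[OF n, of 1]] that n by auto
  have P1: "prob {\<omega> \<in> space (M n). ?r 1 \<omega> \<in> A1} \<le> real (p n) * (A' / s ^ (6 * K))"
  proof -
    have "{\<omega> \<in> space (M n). ?r 1 \<omega> \<in> A1} = (\<Union>j\<in>{1..p n}. {\<omega> \<in> space (M n). \<bar>X n 1 j \<omega>\<bar> > s})"
      using sp1 by (auto simp: A1_def row1)
    then show ?thesis
      using PX[OF _ s] bds s Xm by (simp only:) (intro prob_UN_le_card, auto)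
  qed
  have P2: "prob {\<omega> \<in> space (M n). ?r 1 \<omega> \<in> A2} \<le> real q * ((A' * \<tau> ^ (6 * K) + B') / y ^ (6 * K))"
  proof -
    have eq: "{\<omega> \<in> space (M n). ?r 1 \<omega> \<in> A2} = (\<Union>k\<in>?J. {\<omega> \<in> space (M n). ?w (X n 1 k \<omega>) > y ^ 4})"
      using sp1 Jp by (auto simp: A2_def row1)
    have Em: "{\<omega> \<in> space (M n). ?w (X n 1 k \<omega>) > y ^ 4} \<in> events" if "k \<in> ?J" for k
      using Xm[OF Jp[OF that]] by measurable
    have "prob {\<omega> \<in> space (M n). ?w (X n 1 k \<omega>) > y ^ 4} \<le> (A' * \<tau> ^ (6 * K) + B') / y ^ (6 * K)" if k: "k \<in> ?J" for k
    proof -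
      note [measurable] = Xm[OF Jp[OF k]]
      \<comment> \<open>The two thresholds are balanced: moments of order 6 * K at y / \<tau> and of
        order 2 * K at y ^ 3 both give tails of order y ^ (- 6 * K), and a product beyond y ^ 4
        needs one of them exceeded.\<close>
      have yt: "y / \<tau> > 0" "y ^ 3 > 0" using y \<tau>1 by auto
      have "{\<omega> \<in> space (M n). ?w (X n 1 k \<omega>) > y ^ 4}
        \<subseteq> {\<omega> \<in> space (M n). \<bar>X n 1 k \<omega>\<bar> > y / \<tau>} \<union> {\<omega> \<in> space (M n). sup_cgf''' (\<tau> * X n 1 k \<omega>) > y ^ 3}"
      proof (rule subsetI, rule ccontr)
        fix \<omega> assume a: "\<omega> \<in> {\<omega> \<in> space (M n). ?w (X n 1 k \<omega>) > y ^ 4}"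
          and b: "\<omega> \<notin> {\<omega> \<in> space (M n). \<bar>X n 1 k \<omega>\<bar> > y / \<tau>} \<union> {\<omega> \<in> space (M n). sup_cgf''' (\<tau> * X n 1 k \<omega>) > y ^ 3}"
        then have "\<bar>X n 1 k \<omega>\<bar> \<le> y / \<tau>" "sup_cgf''' (\<tau> * X n 1 k \<omega>) \<le> y ^ 3" by auto
        then have "\<tau> * \<bar>X n 1 k \<omega>\<bar> * sup_cgf''' (\<tau> * X n 1 k \<omega>) \<le> y * y ^ 3"
          using \<tau>1 y by (intro mult_mono sup_cgf'''_nonneg) (auto simp: field_simps)
        also have "y * y ^ 3 = y ^ 4" by (simp add: power4_eq_xxxx power3_eq_cube)
        finally show False using a by (simp add: weight_bound_def)
      qed
      then have "prob {\<omega> \<in> space (M n). ?w (X n 1 k \<omega>) > y ^ 4}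
        \<le> prob ({\<omega> \<in> space (M n). \<bar>X n 1 k \<omega>\<bar> > y / \<tau>} \<union> {\<omega> \<in> space (M n). sup_cgf''' (\<tau> * X n 1 k \<omega>) > y ^ 3})"
        by (intro finite_measure_mono) measurable
      also have "\<dots> \<le> prob {\<omega> \<in> space (M n). \<bar>X n 1 k \<omega>\<bar> > y / \<tau>} + prob {\<omega> \<in> space (M n). sup_cgf''' (\<tau> * X n 1 k \<omega>) > y ^ 3}"
        by (intro measure_Un_le) measurable
      also have "\<dots> \<le> A' / (y / \<tau>) ^ (6 * K) + B' / (y ^ 3) ^ (2 * K)"
        by (intro add_mono PX PV Jp k yt)
      also have "\<dots> = (A' * \<tau> ^ (6 * K) + B') / y ^ (6 * K)"
        by (simp add: power_divide power_mult[symmetric] add_divide_distrib)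
      finally show ?thesis .
    qed
    then show ?thesis
      unfolding eq using regime(1) bds \<tau>1 y Em fin by (intro prob_UN_le_card) auto
  qed

  \<comment> \<open>Truncation applies to each row's term as a whole, which keeps the terms i.i.d.
    and between 0 and m.\<close>
  define g where "g = (\<lambda>j r. min ((r j)\<^sup>2 * (sup_cgf'' 1 + (\<Sum>k\<in>?J. ?w (r k)))) m)"
  have w0: "?w t \<ge> 0" for t using \<tau>1 by (intro weight_bound_nonneg) auto
  have sw0: "(\<Sum>k\<in>?J. ?w (r k)) \<ge> 0" for r using w0 by (intro sum_nonneg) auto
  have gm: "g j \<in> borel_measurable ?P" if "j \<in> {1..p n}" for j
  proof -
    have "(\<lambda>r. \<Sum>k\<in>?J. ?w (r k)) \<in> borel_measurable ?P"
    proof (rule borel_measurable_sum)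
      fix k assume "k \<in> ?J"
      from Jp[OF this] show "(\<lambda>r. ?w (r k)) \<in> borel_measurable ?P" by measurable
    qed
    with that show ?thesis unfolding g_def by measurable
  qed
  have g0: "0 \<le> g j r" for j r using sw0[of r] w1 m0 by (auto simp: g_def)
  have z0: "z \<ge> 0" unfolding z using w1 bds by (intro add_nonneg_nonneg mult_nonneg_nonneg) auto
  have gz: "(\<integral>\<^sup>+\<omega>. ennreal (g j (?r 1 \<omega>)) \<partial>M n) \<le> ennreal z" if j: "j \<in> {1..p n}" for j
  proof -
    define U where "U = (\<lambda>j \<omega>. \<bar>X n 1 j \<omega>\<bar> ^ (6 * K))"
    define V where "V = (\<lambda>j \<omega>. sup_cgf''' (\<tau> * X n 1 j \<omega>) ^ (2 * K))"
    have [measurable]: "U j \<in> borel_measurable (M n)" "V j \<in> borel_measurable (M n)" if "j \<in> {1..p n}" for j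
      using Xm[OF that] unfolding U_def V_def by measurable
    have U0: "U j \<omega> \<ge> 0" "V j \<omega> \<ge> 0" for j \<omega> using sup_cgf'''_nonneg by (auto simp: U_def V_def)
    \<comment> \<open>Young's inequality separates the product of the square and the weights into
      fourth powers of covariates and of \<open>sup_cgf'''\<close>. The assumed moments bound these
      because 4 \<le> 2 * K, so z depends on neither n nor j.\<close>
    have pt: "g j (?r 1 \<omega>) \<le> sup_cgf'' 1 * (1 + U j \<omega>) + (\<Sum>k\<in>?J. (1 + U j \<omega>) + \<tau>\<^sup>2 * ((1 + U k \<omega>) + (1 + V k \<omega>)))" for \<omega>
    proof -
      have X4: "(X n 1 k \<omega>) ^ 4 \<le> 1 + U k \<omega>" for k unfolding U_def using K by (intro pow4_le_one_plus) auto
      have V4: "(sup_cgf''' (\<tau> * X n 1 k \<omega>)) ^ 4 \<le> 1 + V k \<omega>" for k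
        using pow4_le_one_plus[of "2 * K" "sup_cgf''' (\<tau> * X n 1 k \<omega>)"] K sup_cgf'''_nonneg unfolding V_def by simp
      have ab: "2 * (a * b) \<le> a\<^sup>2 + b\<^sup>2" for a b :: real using sum_squares_bound[of a b] by simp
      have X2: "(X n 1 j \<omega>)\<^sup>2 \<le> 1 + U j \<omega>"
      proof -
        have "(X n 1 j \<omega>)\<^sup>2 \<le> 1 + \<bar>X n 1 j \<omega>\<bar> ^ (6 * K)"
        proof (cases "\<bar>X n 1 j \<omega>\<bar> \<le> 1")
          case True
          then have "\<bar>X n 1 j \<omega>\<bar> ^ 2 \<le> 1" by (intro power_le_one) auto
          then show ?thesis by (simp add: add_increasing2)
        next
          case False
          then have "\<bar>X n 1 j \<omega>\<bar> ^ 2 \<le> \<bar>X n 1 j \<omega>\<bar> ^ (6 * K)" using K by (intro power_increasing) auto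
          then show ?thesis by simp
        qed
        then show ?thesis by (simp add: U_def)
      qed
      have tb: "(X n 1 j \<omega>)\<^sup>2 * ?w (X n 1 k \<omega>) \<le> (1 + U j \<omega>) + \<tau>\<^sup>2 * ((1 + U k \<omega>) + (1 + V k \<omega>))" for k
      proof -
        define v where "v = sup_cgf''' (\<tau> * X n 1 k \<omega>)"
        have "2 * ((X n 1 j \<omega>)\<^sup>2 * ?w (X n 1 k \<omega>)) \<le> ((X n 1 j \<omega>)\<^sup>2)\<^sup>2 + (?w (X n 1 k \<omega>))\<^sup>2" by (rule ab)
        also have "((X n 1 j \<omega>)\<^sup>2)\<^sup>2 = (X n 1 j \<omega>) ^ 4" by simp
        also have "(?w (X n 1 k \<omega>))\<^sup>2 = \<tau>\<^sup>2 * ((X n 1 k \<omega>)\<^sup>2 * v\<^sup>2)"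
          by (simp add: weight_bound_def v_def power_mult_distrib mult_ac)
        also have "(X n 1 k \<omega>)\<^sup>2 * v\<^sup>2 \<le> (X n 1 k \<omega>) ^ 4 + v ^ 4"
        proof -
          have "2 * ((X n 1 k \<omega>)\<^sup>2 * v\<^sup>2) \<le> ((X n 1 k \<omega>)\<^sup>2)\<^sup>2 + (v\<^sup>2)\<^sup>2" by (rule ab)
          moreover have "0 \<le> (X n 1 k \<omega>)\<^sup>2 * v\<^sup>2" by (intro mult_nonneg_nonneg) auto
          moreover have "((X n 1 k \<omega>)\<^sup>2)\<^sup>2 = (X n 1 k \<omega>) ^ 4" "(v\<^sup>2)\<^sup>2 = v ^ 4" by simp_all
          ultimately show ?thesis by linarith
        qed
        also have "(X n 1 k \<omega>) ^ 4 + v ^ 4 \<le> (1 + U k \<omega>) + (1 + V k \<omega>)"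
          unfolding v_def by (intro add_mono X4 V4)
        finally have "2 * ((X n 1 j \<omega>)\<^sup>2 * ?w (X n 1 k \<omega>)) \<le> (1 + U j \<omega>) + \<tau>\<^sup>2 * ((1 + U k \<omega>) + (1 + V k \<omega>))"
          using X4[of j] by (simp add: mult_left_mono)
        moreover have "0 \<le> (X n 1 j \<omega>)\<^sup>2 * ?w (X n 1 k \<omega>)" using w0 by simp
        ultimately show ?thesis by linarith
      qed
      have "g j (?r 1 \<omega>) \<le> (?r 1 \<omega> j)\<^sup>2 * (sup_cgf'' 1 + (\<Sum>k\<in>?J. ?w (?r 1 \<omega> k)))" by (simp add: g_def)
      also have "\<dots> = sup_cgf'' 1 * (X n 1 j \<omega>)\<^sup>2 + (\<Sum>k\<in>?J. (X n 1 j \<omega>)\<^sup>2 * ?w (X n 1 k \<omega>))"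
        using Jp by (simp add: row1[OF j] row1 distrib_left sum_distrib_left mult.commute cong: sum.cong)
      also have "\<dots> \<le> sup_cgf'' 1 * (1 + U j \<omega>) + (\<Sum>k\<in>?J. (1 + U j \<omega>) + \<tau>\<^sup>2 * ((1 + U k \<omega>) + (1 + V k \<omega>)))"
        using X2 w1 by (intro add_mono mult_left_mono sum_mono tb) auto
      finally show ?thesis .
    qed
    have iU: "integrable (M n) (U j)" "expectation (U j) \<le> A'" if "j \<in> {1..p n}" for j
    proof -
      have I: "(\<integral>\<^sup>+\<omega>. ennreal (U j \<omega>) \<partial>M n) \<le> ennreal A'"
        unfolding U_def by (rule IX[OF that])
      show i: "integrable (M n) (U j)"
        using that U0 le_less_trans[OF I ennreal_less_top] by (intro integrableI_nonneg) (auto simp: less_top)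
      show "expectation (U j) \<le> A'"
        using I bds U0 by (subst (asm) nn_integral_eq_integral[OF i]) auto
    qed
    have iV: "integrable (M n) (V j)" "expectation (V j) \<le> B'" if "j \<in> {1..p n}" for j
    proof -
      have I: "(\<integral>\<^sup>+\<omega>. ennreal (V j \<omega>) \<partial>M n) \<le> ennreal B'"
        unfolding V_def by (rule IV[OF that])
      show i: "integrable (M n) (V j)"
        using that U0 le_less_trans[OF I ennreal_less_top] by (intro integrableI_nonneg) (auto simp: less_top)
      show "expectation (V j) \<le> B'"
        using I bds U0 by (subst (asm) nn_integral_eq_integral[OF i]) auto
    qed
    let ?rhs = "\<lambda>\<omega>. sup_cgf'' 1 * (1 + U j \<omega>) + (\<Sum>k\<in>?J. (1 + U j \<omega>) + \<tau>\<^sup>2 * ((1 + U k \<omega>) + (1 + V k \<omega>)))"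
    have irhs: "integrable (M n) ?rhs" using iU iV j Jp by auto
    have "(\<integral>\<^sup>+\<omega>. ennreal (g j (?r 1 \<omega>)) \<partial>M n) \<le> (\<integral>\<^sup>+\<omega>. ennreal (?rhs \<omega>) \<partial>M n)"
      by (intro nn_integral_mono ennreal_leI pt)
    also have "\<dots> = ennreal (expectation ?rhs)"
      using U0 w1 by (intro nn_integral_eq_integral irhs AE_I2 add_nonneg_nonneg mult_nonneg_nonneg sum_nonneg) auto
    also have "expectation ?rhs = sup_cgf'' 1 * (1 + expectation (U j))
       + (\<Sum>k\<in>?J. (1 + expectation (U j)) + \<tau>\<^sup>2 * ((1 + expectation (U k)) + (1 + expectation (V k))))"
      using iU iV j Jp by (simp add: Bochner_Integration.integral_sum prob_space)
    also have "\<dots> \<le> sup_cgf'' 1 * (1 + A') + (\<Sum>k\<in>?J. (1 + A') + \<tau>\<^sup>2 * ((1 + A') + (1 + B')))"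
      using iU iV j Jp w1 by (intro add_mono mult_left_mono sum_mono order_refl) auto
    also have "\<dots> \<le> z"
      unfolding z using regime(1) bds by (simp add: mult_right_mono)
    finally show ?thesis using z0 by (simp add: ennreal_leI)
  qed
  define E1 where "E1 = {\<omega> \<in> space (M n). \<exists>i\<in>{1..n}. ?r i \<omega> \<in> A1}"
  define E2 where "E2 = {\<omega> \<in> space (M n). \<exists>i\<in>{1..n}. ?r i \<omega> \<in> A2}"
  define E3 where "E3 = (\<lambda>j. {\<omega> \<in> space (M n). (\<Sum>i\<in>{1..n}. g j (?r i \<omega>)) \<ge> (2 * z + 1) * real n})"
  have E1: "E1 \<in> events" "prob E1 \<le> real n * (real (p n) * (A' / s ^ (6 * K)))"
    unfolding E1_def using measure_some_row[OF n A1m P1] by auto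
  have E2: "E2 \<in> events" "prob E2 \<le> real n * (real q * ((A' * \<tau> ^ (6 * K) + B') / y ^ (6 * K)))"
    unfolding E2_def using measure_some_row[OF n A2m P2] by auto
  have E3m: "E3 j \<in> events" if "j \<in> {1..p n}" for j
    using measurable_row_fun[OF n _ gm[OF that]] unfolding E3_def by measurable
  have E3p: "prob (E3 j) \<le> exp (- (real n / m))" if "j \<in> {1..p n}" for j
    unfolding E3_def using g0 m0 by (intro row_sum_Chernoff n gm gz that z0) (auto simp: g_def)
  define E where "E = E1 \<union> E2 \<union> (\<Union>j\<in>{1..p n}. E3 j)"
  have E3: "(\<Union>j\<in>{1..p n}. E3 j) \<in> events" "prob (\<Union>j\<in>{1..p n}. E3 j) \<le> real (p n) * exp (- (real n / m))"
    using E3m E3p by (auto intro!: prob_UN_le_card)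
  have E: "E \<in> events" unfolding E_def using E1 E2 E3 by auto
  have "prob E \<le> prob E1 + prob E2 + prob (\<Union>j\<in>{1..p n}. E3 j)"
    unfolding E_def using measure_Un_le[OF E1(1) E2(1)] measure_Un_le[OF sets.Un[OF E1(1) E2(1)] E3(1)] by linarith
  then have PE: "1 - prob E \<ge> 1 - (real n * (real (p n) * (A' / s ^ (6 * K)))
        + real n * (real q * ((A' * \<tau> ^ (6 * K) + B') / y ^ (6 * K)))
        + real (p n) * exp (- (real n / m)))"
    using E1(2) E2(2) E3(2) by linarith
  have small: "\<bar>cov_matrix n \<omega> i j\<bar> \<le> s" if \<omega>: "\<omega> \<in> space (M n) - E" and ij: "i \<in> {1..n}" "j \<in> {1..p n}" for \<omega> i j
  proof -
    have "?r i \<omega> \<in> space ?P" using measurable_space[OF measurable_row[OF n ij(1)]] \<omega> by auto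
    moreover have "?r i \<omega> \<notin> A1" using \<omega> ij unfolding E_def E1_def by blast
    ultimately show ?thesis using ij unfolding A1_def cov_matrix_row[OF ij(1)] by (auto simp: not_less)
  qed
  have small2: "?w (cov_matrix n \<omega> i k) \<le> y ^ 4" if \<omega>: "\<omega> \<in> space (M n) - E" and ik: "i \<in> {1..n}" "k \<in> ?J" for \<omega> i k
  proof -
    have "?r i \<omega> \<in> space ?P" using measurable_space[OF measurable_row[OF n ik(1)]] \<omega> by auto
    moreover have "?r i \<omega> \<notin> A2" using \<omega> ik unfolding E_def E2_def by blast
    ultimately show ?thesis using ik unfolding A2_def cov_matrix_row[OF ik(1)] by (auto simp: not_less)
  qed
  show ?thesis
  proof (rule that[of "space (M n) - E"])
    show "space (M n) - E \<in> sets (M n)" using E by auto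
    show "prob (space (M n) - E) \<ge> 1 - (real n * (real (p n) * (A' / s ^ (6 * K)))
        + real n * (real q * ((A' * \<tau> ^ (6 * K) + B') / y ^ (6 * K)))
        + real (p n) * exp (- (real n / m)))"
      using PE prob_compl[OF E] by simp
    show "\<bar>cov_matrix n \<omega> i j\<bar> \<le> s" if "\<omega> \<in> space (M n) - E" "i \<in> {1..n}" "j \<in> {1..p n}" for \<omega> i j
      using small that by blast
    fix \<omega> j assume \<omega>: "\<omega> \<in> space (M n) - E" and j: "j \<in> {1..p n}"
    have "weighted_square_sum n \<omega> j
       \<le> (\<Sum>i\<in>{1..n}. g j (?r i \<omega>))"
    proof (rule sum_mono)
      fix i assume i: "i \<in> {1..n}"
      let ?x = "cov_matrix n \<omega> i"
      have "(?x j)\<^sup>2 * sup_cgf'' (dot (p n) ?x (\<phi>s n)) \<le> (?x j)\<^sup>2 * (sup_cgf'' 1 + (\<Sum>k\<in>?J. ?w (?x k)))"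
        by (intro mult_left_mono sup_cgf''_predictor_le[OF regime(2,1) \<tau>]) auto
      \<comment> \<open>On the good event the argument of the minimum is at most s^2 * (sup_cgf'' 1
        + q * y^4) \<le> m, so truncation changes nothing.\<close>
      also have "\<dots> = g j ?x"
      proof -
        have "(?x j)\<^sup>2 \<le> s\<^sup>2" using small[OF \<omega> i j] s by (intro iffD1[OF abs_le_square_iff]) auto
        moreover have "(\<Sum>k\<in>?J. ?w (?x k)) \<le> real q * y ^ 4"
        proof -
          have "(\<Sum>k\<in>?J. ?w (?x k)) \<le> real (card ?J) * y ^ 4"
            using small2[OF \<omega> i] by (rule sum_bounded_above)
          also have "\<dots> \<le> real q * y ^ 4" using regime(1) y by (intro mult_right_mono) auto
          finally show ?thesis .
        qed
        ultimately have "(?x j)\<^sup>2 * (sup_cgf'' 1 + (\<Sum>k\<in>?J. ?w (?x k))) \<le> s\<^sup>2 * (sup_cgf'' 1 + real q * y ^ 4)"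
          using w1 sw0[of ?x] by (intro mult_mono) auto
        then show ?thesis using m by (simp add: g_def)
      qed
      finally show "(?x j)\<^sup>2 * sup_cgf'' (dot (p n) ?x (\<phi>s n)) \<le> g j (?r i \<omega>)"
        by (simp add: cov_matrix_row[OF i])
    qed
    also have "\<dots> \<le> (2 * z + 1) * real n"
      using \<omega> j unfolding E_def E3_def by (auto simp: not_le less_imp_le)
    finally show "weighted_square_sum n \<omega> j \<le> (2 * z + 1) * real n" .
  qed
qed

end

section \<open>Rates in powers of n when the growth rate of p is bounded\<close>

lemma eventually_powr_neg_le:
  assumes "c > 0" "z > 0"
  shows "\<forall>\<^sub>F n in sequentially. real n powr (- c) \<le> z"
proof -
  have "((\<lambda>n. real n powr (- c)) \<longlongrightarrow> 0) sequentially"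
    using assms(1) by (intro tendsto_neg_powr filterlim_real_sequentially) auto
  from order_tendstoD(2)[OF this assms(2)] show ?thesis by eventually_elim simp
qed

lemma eventually_ln_le_powr:
  assumes "c > 0" "z > 0"
  shows "\<forall>\<^sub>F n in sequentially. ln (real n) \<le> z * real n powr c"
proof -
  have "\<forall>\<^sub>F n in sequentially. ln (real n) / real n powr c < z"
    using order_tendstoD(2)[OF lim_ln_over_power[OF assms(1)] assms(2)] .
  then show ?thesis
    using eventually_ge_at_top[of 1]
  proof eventually_elim
    case (elim n)
    then have "real n powr c > 0" by simp
    then show ?case using elim(1) by (simp add: field_simps)
  qed
qed

lemma growth_rate_upper:
  assumes lim: "limsup (growth_rate p) = ereal \<kappa>" and \<eta>: "\<eta> > 0"
  shows "\<forall>\<^sub>F n in sequentially. ln (real (p n)) \<le> (\<kappa> + \<eta>) * ln (real n)"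
proof -
  have "limsup (growth_rate p) < ereal (\<kappa> + \<eta>)" using lim \<eta> by simp
  then have "\<forall>\<^sub>F n in sequentially. growth_rate p n < ereal (\<kappa> + \<eta>)" by (rule Limsup_lessD)
  then show ?thesis
    using eventually_ge_at_top[of 2]
  proof eventually_elim
    case (elim n)
    have l: "ln (real n) > 0" using elim(2) by simp
    have "ln (real (p n)) / ln (real n) < \<kappa> + \<eta>" using elim by (simp add: growth_rate_eq)
    then show ?case using l by (simp add: field_simps)
  qed
qed

context glm_sequence
begin

text \<open>The growth rate is nonnegative, so K > 2 * \<kappa> makes K positive, and an even
  positive number is at least 2.\<close>

lemma moment_covariates_growth:
  assumes "moment_covariates \<mu> M X p K AK B"
  obtains \<kappa> where "limsup (growth_rate p) = ereal \<kappa>" "0 \<le> \<kappa>" "2 * \<kappa> < real K" "K \<ge> 2"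
proof -
  have K: "even K" "ereal (real K) > 2 * limsup (growth_rate p)"
    using assms unfolding moment_covariates_def by auto
  have nn: "0 \<le> limsup (growth_rate p)" by (rule growth_rate_nonneg(2)[of p, OF p_pos])
  show ?thesis
  proof (cases "limsup (growth_rate p)")
    case (real \<kappa>)
    have "2 * \<kappa> < real K" "0 \<le> \<kappa>" using K(2) nn real by auto
    moreover have "K \<ge> 2"
    proof -
      have "real K > 0" using calculation by linarith
      then show ?thesis using K(1) by (cases "K = 1") auto
    qed
    ultimately show ?thesis using that real by blast
  qed (use K nn in auto)
qed

text \<open>The failure probability \<open>err n\<close> of the covariate event is paid for by n
  powr (\<kappa> - K / 2) and by the half rate that \<open>selection_eventually\<close> leaves free.
  For K = 2 the exponents 1 + \<kappa> - K and \<kappa> - K / 2 coincide; the only slack is the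
  shift by e between the two thresholds.\<close>

theorem selection_moment:
  assumes regime: "sparse_regression_regime M X p \<phi>s q a1 a2 a3" and a1: "a1 > 0" and q: "q \<ge> 1"
    and \<gamma>: "\<gamma> \<ge> 0" and \<alpha>: "\<alpha> > 0" and \<beta>: "\<beta> > 0"
    and adm: "admissible_scalars \<alpha> \<beta> \<gamma> (limsup (growth_rate p))" "admissible_scalars \<alpha> \<beta> \<gamma> (liminf (growth_rate p))"
    and prior: "prior_conditions p q R f F1 F2 F3" and R: "a3 \<le> R"
    and moment: "moment_covariates \<mu> M X p K AK B"
  shows "\<forall>\<^sub>F n in sequentially. selection_prob q \<gamma> f n
     \<ge> 1 - 4 * real K ^ (K + 1) * real n powr (- (real K - 2 * real_of_ereal (limsup (growth_rate p))) / 2)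
         - real n powr (- \<alpha>) * real (p n) powr (- \<beta>)"
proof -
  obtain \<kappa> where \<kappa>: "limsup (growth_rate p) = ereal \<kappa>" "0 \<le> \<kappa>" "2 * \<kappa> < real K" and K: "K \<ge> 2"
    by (rule moment_covariates_growth[OF moment])
  have K2: "real K \<ge> 2" using K by simp
  have card: "card (true_support p \<phi>s n) \<le> q" and norm: "L2_set (\<phi>s n) {1..p n} \<le> a3" if "n \<ge> 1" for n
    using regime that unfolding sparse_regression_regime_def by auto
  define \<tau> where "\<tau> = 2 * (a3 * real q) + 1"
  define A' where "A' = max AK 0"
  define B' where "B' = max (B \<tau>) 0"
  have AB: "AK \<le> A'" "B \<tau> \<le> B'" "A' \<ge> 0" "B' \<ge> 0" by (auto simp: A'_def B'_def)
  define w1 where "w1 = sup_cgf'' 1"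
  have w1: "w1 > 0" unfolding w1_def by (rule sup_cgf''_pos)
  define z where "z = sup_cgf'' 1 * (1 + A') + real q * ((1 + A') + \<tau>\<^sup>2 * ((1 + A') + (1 + B')))"
  define Dd where "Dd = real q * (A' * \<tau> ^ (6 * K) + B')"
  \<comment> \<open>The gain d in the exponent of the first error covers p \<le> n powr (\<kappa> +
    d / 2). The second error loses the same d, which must stay below \<kappa> when \<kappa> >
    0.\<close>
  define d where "d = (if \<kappa> > 0 then min (\<kappa> / 2) (1 / 4) else 1 / 4)"
  have d: "d > 0" "d \<le> 1 / 4" "\<kappa> > 0 \<Longrightarrow> d \<le> \<kappa> / 2" by (auto simp: d_def)
  define e where "e = d / (6 * real K)"
  have e: "e > 0" "e \<le> 1 / 48" "6 * real K * e = d"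
  proof -
    show "e > 0" "6 * real K * e = d" using d K2 by (auto simp: e_def)
    have "d / (6 * real K) \<le> (1 / 4) / (6 * 2)" using d K2 by (intro frac_le) auto
    then show "e \<le> 1 / 48" by (simp add: e_def)
  qed
  \<comment> \<open>The thresholds satisfy s^2 y^4 = n^(1 - 2e) < n, so the truncation at m is inactive on the good
    event, while the three error terms are of order p n^(1 - K - d), n^(1 - K + d) and p exp(- n^(2e)).\<close>
  define s where "s = (\<lambda>n. real n powr (1 / 6 + e))"
  define y where "y = (\<lambda>n. real n powr (1 / 6 - e))"
  define m where "m = (\<lambda>n. (w1 + real q) * real n powr (1 - 2 * e))"
  have powr_pow: "(real n powr x) ^ k = real n powr (x * real k)" if "n \<ge> 1" for n k x
    using that by (simp add: powr_powr[symmetric] powr_realpow)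
  have sy: "(s n)\<^sup>2 * (sup_cgf'' 1 + real q * y n ^ 4) \<le> m n" if n: "n \<ge> 1" for n
  proof -
    have "(s n)\<^sup>2 = real n powr (1 / 3 + 2 * e)" "y n ^ 4 = real n powr (2 / 3 - 4 * e)"
      unfolding s_def y_def powr_pow[OF n] by (simp_all add: algebra_simps)
    then have "(s n)\<^sup>2 * (sup_cgf'' 1 + real q * y n ^ 4)
        = w1 * real n powr (1 / 3 + 2 * e) + real q * (real n powr (1 / 3 + 2 * e) * real n powr (2 / 3 - 4 * e))"
      by (simp add: w1_def algebra_simps)
    also have "real n powr (1 / 3 + 2 * e) * real n powr (2 / 3 - 4 * e) = real n powr (1 - 2 * e)"
      by (simp add: powr_add[symmetric])
    also have "w1 * real n powr (1 / 3 + 2 * e) \<le> w1 * real n powr (1 - 2 * e)"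
      using w1 n e by (intro mult_left_mono powr_mono) auto
    finally show ?thesis by (simp add: m_def algebra_simps)
  qed
  define err where "err = (\<lambda>n. real n * (real (p n) * (A' / s n ^ (6 * K)))
        + real n * (real q * ((A' * \<tau> ^ (6 * K) + B') / y n ^ (6 * K)))
        + real (p n) * exp (- (real n / m n)))"
  define P where "P = (\<lambda>n G. G \<in> sets (M n) \<and> measure (M n) G \<ge> 1 - err n \<and>
    (\<forall>\<omega>\<in>G. \<forall>j\<in>{1..p n}. (\<forall>i\<in>{1..n}. \<bar>cov_matrix n \<omega> i j\<bar> \<le> s n) \<and>
      weighted_square_sum n \<omega> j \<le> (2 * z + 1) * real n))"
  have "\<exists>G. n \<ge> 1 \<longrightarrow> P n G" for n
  proof (cases "n \<ge> 1")
    case True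
    have pos: "s n > 0" "y n > 0" using True by (auto simp: s_def y_def)
    have "\<exists>G. P n G"
    proof (rule moment_event[OF card[OF True] norm[OF True] moment K True \<tau>_def AB z_def pos sy[OF True]])
      fix G assume "G \<in> sets (M n)"
        "measure (M n) G \<ge> 1 - (real n * (real (p n) * (A' / s n ^ (6 * K)))
        + real n * (real q * ((A' * \<tau> ^ (6 * K) + B') / y n ^ (6 * K)))
        + real (p n) * exp (- (real n / m n)))"
        "\<And>\<omega> i j. \<omega> \<in> G \<Longrightarrow> i \<in> {1..n} \<Longrightarrow> j \<in> {1..p n} \<Longrightarrow> \<bar>cov_matrix n \<omega> i j\<bar> \<le> s n"
        "\<And>\<omega> j. \<omega> \<in> G \<Longrightarrow> j \<in> {1..p n} \<Longrightarrow>
          weighted_square_sum n \<omega> j \<le> (2 * z + 1) * real n"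
      then have "P n G" unfolding P_def err_def by blast
      then show "\<exists>G. P n G" by blast
    qed
    then show ?thesis by blast
  qed simp
  then obtain G where G: "\<And>n. n \<ge> 1 \<Longrightarrow> P n (G n)" by metis
  have z0: "z \<ge> 0"
    unfolding z_def using AB sup_cgf''_pos[of 1] by (intro add_nonneg_nonneg mult_nonneg_nonneg) auto
  have "\<forall>\<^sub>F n in sequentially. selection_prob q \<gamma> f n
     \<ge> measure (M n) (G n) - real n powr (- \<alpha>) * real (p n) powr (- \<beta>) / 2"
  proof (rule selection_eventually[OF regime a1 q \<gamma> \<alpha> \<beta> adm prior R])
    show "0 \<le> 1 + A'" "0 \<le> 2 * z + 1" using AB z0 by auto
    show "(\<integral>\<^sup>+\<omega>. ennreal ((X n 1 j \<omega>) ^ 4) \<partial>M n) \<le> ennreal (1 + A')" if n: "n \<ge> 1" and j: "j \<in> {1..p n}" for n j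
    proof -
      interpret prob_space "M n" by (rule prob[OF n])
      have [measurable]: "X n 1 j \<in> borel_measurable (M n)" using n j by (intro measurable_X) auto
      have "(\<integral>\<^sup>+\<omega>. ennreal ((X n 1 j \<omega>) ^ 4) \<partial>M n) \<le> (\<integral>\<^sup>+\<omega>. 1 + ennreal (\<bar>X n 1 j \<omega>\<bar> ^ (6 * K)) \<partial>M n)"
      proof (rule nn_integral_mono)
        fix \<omega>
        have "(X n 1 j \<omega>) ^ 4 \<le> 1 + \<bar>X n 1 j \<omega>\<bar> ^ (6 * K)" using K by (intro pow4_le_one_plus) auto
        then have "ennreal ((X n 1 j \<omega>) ^ 4) \<le> ennreal (1 + \<bar>X n 1 j \<omega>\<bar> ^ (6 * K))" by (rule ennreal_leI)
        also have "\<dots> = 1 + ennreal (\<bar>X n 1 j \<omega>\<bar> ^ (6 * K))" by (simp add: ennreal_plus)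
        finally show "ennreal ((X n 1 j \<omega>) ^ 4) \<le> 1 + ennreal (\<bar>X n 1 j \<omega>\<bar> ^ (6 * K))" .
      qed
      also have "\<dots> = 1 + (\<integral>\<^sup>+\<omega>. ennreal (\<bar>X n 1 j \<omega>\<bar> ^ (6 * K)) \<partial>M n)"
        by (subst nn_integral_add) (auto simp: emeasure_space_1)
      also have "\<dots> \<le> 1 + ennreal AK"
        using moment n j unfolding moment_covariates_def by (intro add_left_mono) blast
      also have "\<dots> \<le> 1 + ennreal A'" using AB by (intro add_left_mono ennreal_leI)
      also have "\<dots> = ennreal (1 + A')" using AB by (simp add: ennreal_plus)
      finally show ?thesis .
    qed
    show "G n \<in> sets (M n)" if "n \<ge> 1" for n using G[OF that] by (simp add: P_def)
    have "\<forall>\<^sub>F n in sequentially. ln (real (p n)) \<le> (\<kappa> + 1) * ln (real n)"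
      by (rule growth_rate_upper[OF \<kappa>(1)]) simp
    moreover have "\<forall>\<^sub>F n in sequentially. ln (real n) \<le> 1 / (\<kappa> + 2) * real n powr (1 / 2)"
      using \<kappa> by (intro eventually_ln_le_powr) auto
    ultimately show "\<forall>\<^sub>F n in sequentially. \<forall>\<omega>\<in>G n. \<forall>j\<in>{1..p n}.
       (\<forall>i\<in>{1..n}. sqrt (logsize n / real n) * \<bar>cov_matrix n \<omega> i j\<bar> \<le> 1) \<and>
       weighted_square_sum n \<omega> j \<le> (2 * z + 1) * real n"
      using eventually_ge_at_top[of 1]
    proof eventually_elim
      case (elim n)
      have n0: "real n > 0" "real n \<ge> 1" using elim(3) by auto
      \<comment> \<open>As log (n p) is of order log n here, sqrt (log (n p) / n) is at most
        n^(-1/4), while entries are bounded by n^(1/6 + e) with 1/6 + e < 1/4.\<close>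
      have "logsize n \<le> (\<kappa> + 2) * ln (real n)" using elim by (simp add: logsize_eq algebra_simps)
      also have "\<dots> \<le> (\<kappa> + 2) * (1 / (\<kappa> + 2) * real n powr (1 / 2))"
        using elim(2) \<kappa>(2) by (intro mult_left_mono) auto
      also have "\<dots> = real n powr (1 / 2)" using \<kappa>(2) by simp
      finally have "logsize n / real n \<le> real n powr (1 / 2) / real n" using n0 by (intro divide_right_mono) auto
      also have "\<dots> = real n powr (- (1 / 2))" using n0 powr_diff[of "real n" "1 / 2" 1] by simp
      finally have "sqrt (logsize n / real n) \<le> sqrt (real n powr (- (1 / 2)))" by (rule real_sqrt_le_mono)
      also have "\<dots> = real n powr (- (1 / 4))"
        using n0 by (simp add: powr_half_sqrt[symmetric] powr_powr)
      finally have sq: "sqrt (logsize n / real n) \<le> real n powr (- (1 / 4))" .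
      have "sqrt (logsize n / real n) * s n \<le> 1"
      proof -
        have "sqrt (logsize n / real n) * s n \<le> real n powr (- (1 / 4)) * s n"
          using sq by (intro mult_right_mono) (auto simp: s_def)
        also have "\<dots> = real n powr (- (1 / 4) + (1 / 6 + e))" unfolding s_def by (rule powr_add[symmetric])
        also have "\<dots> \<le> real n powr 0" using n0 e by (intro powr_mono) auto
        finally show ?thesis using n0 by simp
      qed
      moreover have "0 \<le> sqrt (logsize n / real n)"
        using elim(3) p_pos[of n] n0 by (simp add: logsize_eq)
      ultimately have "sqrt (logsize n / real n) * \<bar>x\<bar> \<le> 1" if "\<bar>x\<bar> \<le> s n" for x
        using mult_left_mono[OF that] by fastforce
      then show ?case using G[OF elim(3)] unfolding P_def by blast
    qed
  qed
  moreover have "\<forall>\<^sub>F n in sequentially. err n \<le> 4 * real K ^ (K + 1) * real n powr (\<kappa> - real K / 2)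
      + real n powr (- \<alpha>) * real (p n) powr (- \<beta>) / 2"
  proof -
    have E13: "\<forall>\<^sub>F n in sequentially. ln (real (p n)) \<le> (\<kappa> + d / 2) * ln (real n)"
      by (rule growth_rate_upper[OF \<kappa>(1)]) (use d in simp)
    have E1: "\<forall>\<^sub>F n in sequentially. real n powr (- (d / 2)) \<le> 1 / (A' + 1)"
      using d AB by (intro eventually_powr_neg_le) auto
    have wq: "w1 + real q > 0" using w1 by simp
    have E3: "\<forall>\<^sub>F n in sequentially. ln (real n) \<le> 1 / ((w1 + real q) * (real K + \<kappa> + 1)) * real n powr (2 * e)"
      using wq \<kappa> e by (intro eventually_ln_le_powr) auto
    have Dd0: "Dd \<ge> 0"
    proof -
      have "0 \<le> a3" using norm[of 1] L2_set_nonneg order_trans by blast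
      then show ?thesis using AB by (auto simp: Dd_def \<tau>_def intro!: mult_nonneg_nonneg add_nonneg_nonneg zero_le_power)
    qed
    \<comment> \<open>For \<kappa> > 0 the exponent 1 - K + d lies strictly below \<kappa> - K / 2.
      For \<kappa> = 0 and K = 2 it lies above, and the error is charged to half of n powr (-
      \<alpha>) * p powr (- \<beta>).\<close>
    have E2: "\<forall>\<^sub>F n in sequentially. Dd * real n powr (1 - real K + d)
        \<le> real n powr (\<kappa> - real K / 2) + real n powr (- \<alpha>) * real (p n) powr (- \<beta>) / 2"
    proof (cases "\<kappa> > 0")
      case True
      have "\<forall>\<^sub>F n in sequentially. real n powr (- (\<kappa> / 2)) \<le> 1 / (Dd + 1)"
        using True Dd0 by (intro eventually_powr_neg_le) auto
      then show ?thesis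
        using eventually_ge_at_top[of 1]
      proof eventually_elim
        case (elim n)
        have n0: "real n \<ge> 1" using elim(2) by simp
        have "real n powr (1 - real K + d) \<le> real n powr (- (\<kappa> / 2) + (\<kappa> - real K / 2))"
          using n0 K2 d True by (intro powr_mono) auto
        also have "\<dots> = real n powr (- (\<kappa> / 2)) * real n powr (\<kappa> - real K / 2)" by (rule powr_add)
        also have "\<dots> \<le> 1 / (Dd + 1) * real n powr (\<kappa> - real K / 2)" using elim by (intro mult_right_mono) auto
        finally have "Dd * real n powr (1 - real K + d) \<le> Dd * (1 / (Dd + 1) * real n powr (\<kappa> - real K / 2))"
          using Dd0 by (intro mult_left_mono)
        also have "\<dots> = Dd / (Dd + 1) * real n powr (\<kappa> - real K / 2)" by simp
        also have "\<dots> \<le> 1 * real n powr (\<kappa> - real K / 2)" using Dd0 by (intro mult_right_mono) auto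
        finally show ?case by (simp add: add_increasing2)
      qed
    next
      case False
      then have \<kappa>0: "\<kappa> = 0" using \<kappa>(2) by simp
      then have \<alpha>2: "\<alpha> < 1 / 2" using adm(1) \<kappa>(1) by (simp add: admissible_scalars_def zero_ereal_def)
      \<comment> \<open>With \<alpha> < 1/2 and p powr \<beta> \<le> n powr (1/8) the rate is at
        least n^(-5/8), whereas the error has exponent at most -1 + 1/4 = -5/8 - 1/8; the last 1/8
        absorbs the constant.\<close>
      have d4: "d = 1 / 4" using False by (simp add: d_def)
      have "\<forall>\<^sub>F n in sequentially. ln (real (p n)) \<le> (\<kappa> + 1 / (8 * \<beta>)) * ln (real n)"
        using \<beta> by (intro growth_rate_upper[OF \<kappa>(1)]) simp
      moreover have "\<forall>\<^sub>F n in sequentially. real n powr (- (1 / 8)) \<le> 1 / (2 * (Dd + 1))"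
        using Dd0 by (intro eventually_powr_neg_le) auto
      ultimately show ?thesis
        using eventually_ge_at_top[of 1]
      proof eventually_elim
        case (elim n)
        have n0: "real n \<ge> 1" "ln (real n) \<ge> 0" using elim(3) by auto
        have p0: "real (p n) > 0" using p_pos[of n] elim(3) by simp
        have "\<beta> * ln (real (p n)) \<le> \<beta> * ((\<kappa> + 1 / (8 * \<beta>)) * ln (real n))"
          using elim(1) \<beta> by (intro mult_left_mono) auto
        also have "\<dots> = 1 / 8 * ln (real n)" using \<beta> \<kappa>0 by simp
        finally have b: "\<beta> * ln (real (p n)) \<le> 1 / 8 * ln (real n)" .
        have a: "\<alpha> * ln (real n) \<le> 1 / 2 * ln (real n)" using \<alpha>2 n0 by (intro mult_right_mono) auto
        have "real n powr (- (5 / 8)) = exp (- (5 / 8 * ln (real n)))" using n0 by (simp add: powr_def)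
        also have "\<dots> \<le> exp (- (\<alpha> * ln (real n) + \<beta> * ln (real (p n))))" using a b by simp
        also have "\<dots> = real n powr (- \<alpha>) * real (p n) powr (- \<beta>)"
          using n0 p0 by (simp add: powr_def exp_add[symmetric])
        finally have low: "real n powr (- (5 / 8)) \<le> real n powr (- \<alpha>) * real (p n) powr (- \<beta>)" .
        have "real n powr (1 - real K + d) \<le> real n powr (- (1 / 8) + - (5 / 8))"
          using n0 K2 d4 by (intro powr_mono) auto
        also have "\<dots> = real n powr (- (1 / 8)) * real n powr (- (5 / 8))" by (rule powr_add)
        also have "\<dots> \<le> 1 / (2 * (Dd + 1)) * real n powr (- (5 / 8))" using elim by (intro mult_right_mono) auto
        finally have "Dd * real n powr (1 - real K + d) \<le> Dd * (1 / (2 * (Dd + 1)) * real n powr (- (5 / 8)))"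
          using Dd0 by (intro mult_left_mono)
        also have "\<dots> = Dd / (Dd + 1) * (real n powr (- (5 / 8)) / 2)" by simp
        also have "\<dots> \<le> 1 * (real n powr (- (5 / 8)) / 2)" using Dd0 by (intro mult_right_mono) auto
        also have "\<dots> \<le> real n powr (- \<alpha>) * real (p n) powr (- \<beta>) / 2" using low by simp
        finally show ?case by (simp add: add_increasing)
      qed
    qed
    show ?thesis
      using E13 E1 E3 E2 eventually_ge_at_top[of 1]
    proof eventually_elim
      case (elim n)
      have n: "n \<ge> 1" and n0: "real n \<ge> 1" "real n > 0" "ln (real n) \<ge> 0" using elim(5) by auto
      have p0: "real (p n) > 0" using p_pos[of n] n by simp
      let ?e = "real n powr (\<kappa> - real K / 2)"
      have pn: "real (p n) \<le> real n powr (\<kappa> + d / 2)"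
      proof -
        have "real (p n) = exp (ln (real (p n)))" using p0 by simp
        also have "\<dots> \<le> exp ((\<kappa> + d / 2) * ln (real n))" using elim(1) by simp
        also have "\<dots> = real n powr (\<kappa> + d / 2)" using n0 by (simp add: powr_def)
        finally show ?thesis .
      qed
      have s6: "s n ^ (6 * K) = real n powr (real K + d)"
        unfolding s_def powr_pow[OF n] e(3)[symmetric] by (simp add: algebra_simps)
      have y6: "y n ^ (6 * K) = real n powr (real K - d)"
        unfolding y_def powr_pow[OF n] e(3)[symmetric] by (simp add: algebra_simps)
      have 1: "real n * (real (p n) * (A' / s n ^ (6 * K))) \<le> ?e"
      proof -
        have "real n * (real (p n) * (A' / s n ^ (6 * K))) = A' * (real n powr 1 * real (p n) * real n powr (- (real K + d)))"
          unfolding s6 powr_minus_divide using n0 by simp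
        also have "\<dots> \<le> A' * (real n powr 1 * real n powr (\<kappa> + d / 2) * real n powr (- (real K + d)))"
          using pn AB by (intro mult_left_mono mult_right_mono) auto
        also have "\<dots> = A' * real n powr (1 + (\<kappa> + d / 2) + - (real K + d))" by (simp only: powr_add)
        also have "\<dots> \<le> A' * real n powr (- (d / 2) + (\<kappa> - real K / 2))"
          using n0 K2 AB by (intro mult_left_mono powr_mono) auto
        also have "\<dots> = A' * real n powr (- (d / 2)) * ?e" by (simp only: powr_add mult.assoc)
        also have "\<dots> \<le> 1 * ?e"
        proof (intro mult_right_mono)
          have "A' * real n powr (- (d / 2)) \<le> A' * (1 / (A' + 1))" using elim(2) AB by (intro mult_left_mono) auto
          also have "\<dots> \<le> 1" using AB by simp
          finally show "A' * real n powr (- (d / 2)) \<le> 1" .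
        qed simp
        finally show ?thesis by simp
      qed
      have 2: "real n * (real q * ((A' * \<tau> ^ (6 * K) + B') / y n ^ (6 * K)))
          \<le> ?e + real n powr (- \<alpha>) * real (p n) powr (- \<beta>) / 2"
      proof -
        have "real n * (real q * ((A' * \<tau> ^ (6 * K) + B') / y n ^ (6 * K))) = Dd * (real n powr 1 * real n powr (- (real K - d)))"
          unfolding y6 Dd_def powr_minus_divide using n0 by simp
        also have "\<dots> = Dd * real n powr (1 + - (real K - d))" by (simp only: powr_add)
        also have "1 + - (real K - d) = 1 - real K + d" by simp
        finally show ?thesis using elim(4) by simp
      qed
      have 3: "real (p n) * exp (- (real n / m n)) \<le> ?e"
      proof -
        have "real n / m n = real n powr 1 / real n powr (1 - 2 * e) / (w1 + real q)"
          unfolding m_def using n0 by (simp add: mult.commute)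
        also have "real n powr 1 / real n powr (1 - 2 * e) = real n powr (2 * e)"
          by (simp only: powr_diff[symmetric]) simp
        finally have nm: "real n / m n = real n powr (2 * e) / (w1 + real q)" .
        have "ln (real n) * ((w1 + real q) * (real K + \<kappa> + 1)) \<le> real n powr (2 * e)"
          using elim(3) wq \<kappa>(2) K2 by (simp add: pos_le_divide_eq)
        then have big: "(real K + \<kappa> + 1) * ln (real n) \<le> real n / m n"
          unfolding nm using wq by (simp add: pos_le_divide_eq mult_ac)
        have "real (p n) * exp (- (real n / m n)) \<le> real n powr (\<kappa> + d / 2) * exp (- ((real K + \<kappa> + 1) * ln (real n)))"
          using pn big by (intro mult_mono) auto
        also have "exp (- ((real K + \<kappa> + 1) * ln (real n))) = real n powr (- (real K + \<kappa> + 1))"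
          using n0 by (simp add: powr_def algebra_simps)
        also have "real n powr (\<kappa> + d / 2) * real n powr (- (real K + \<kappa> + 1)) = real n powr (\<kappa> + d / 2 + - (real K + \<kappa> + 1))"
          by (rule powr_add[symmetric])
        also have "\<dots> \<le> ?e" using n0 K2 d \<kappa>(2) by (intro powr_mono) auto
        finally show ?thesis .
      qed
      have "1 \<le> real K ^ (K + 1)" using K2 by (intro one_le_power) auto
      then have "3 * ?e \<le> 4 * real K ^ (K + 1) * ?e" by (intro mult_right_mono) auto
      then show ?case using 1 2 3 unfolding err_def by linarith
    qed
  qed
  ultimately show ?thesis
    using eventually_ge_at_top[of 1]
  proof eventually_elim
    case (elim n)
    have "1 - err n \<le> measure (M n) (G n)" using G[OF elim(3)] by (simp add: P_def)
    moreover have ex: "- (real K - 2 * real_of_ereal (limsup (growth_rate p))) / 2 = \<kappa> - real K / 2"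
      using \<kappa>(1) by (simp add: field_simps)
    ultimately show ?case using elim(1,2) unfolding ex by linarith
  qed
qed

end

section \<open>Consistency\<close>

context glm_sequence
begin

text \<open>For q = 0 the empty model is the only candidate. The case is separate because the
  asymptotic bounds are proved for q \<ge> 1.\<close>

lemma selection_no_covariates:
  assumes n: "n \<ge> 1" and card: "card (true_support p \<phi>s n) \<le> 0"
  shows "measure (M n) (bayes_selects_truth \<mu> M X Y p \<phi>s 0 \<gamma> f n) = 1"
proof -
  have "J = {}" if "J \<subseteq> {1..p n}" "card J \<le> 0" for J
    using that finite_subset[OF that(1)] by simp
  then have "bayes_selects_truth \<mu> M X Y p \<phi>s 0 \<gamma> f n = space (M n)"
    unfolding bayes_selects_truth_eq using card true_support_subset[of n] by auto
  then show ?thesis using prob_space.prob_space[OF prob[OF n]] by simp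
qed

lemma selection_lower_bounds:
  assumes regime: "sparse_regression_regime M X p \<phi>s q a1 a2 a3" and a1: "a1 > 0"
    and \<gamma>: "\<gamma> \<ge> 0" and \<alpha>: "\<alpha> > 0" and \<beta>: "\<beta> > 0"
    and adm: "admissible_scalars \<alpha> \<beta> \<gamma> (limsup (growth_rate p))" "admissible_scalars \<alpha> \<beta> \<gamma> (liminf (growth_rate p))"
    and prior: "prior_conditions p q R f F1 F2 F3" and R: "a3 \<le> R"
  shows "bounded_covariates M X p A \<Longrightarrow> \<forall>\<^sub>F n in sequentially.
      selection_prob q \<gamma> f n
        \<ge> 1 - real n powr (- \<alpha>) * real (p n) powr (- \<beta>)" (is "_ \<Longrightarrow> eventually ?P sequentially")
    and "moment_covariates \<mu> M X p K AK B \<Longrightarrow> \<forall>\<^sub>F n in sequentially.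
      selection_prob q \<gamma> f n
        \<ge> 1 - 4 * real K ^ (K + 1) * real n powr (- (real K - 2 * real_of_ereal (limsup (growth_rate p))) / 2)
            - real n powr (- \<alpha>) * real (p n) powr (- \<beta>)" (is "_ \<Longrightarrow> eventually ?Q sequentially")
proof -
  have "eventually (\<lambda>n. ?P n \<and> ?Q n) sequentially" if "q = 0"
    using eventually_ge_at_top[of 1]
  proof eventually_elim
    case (elim n)
    have "card (true_support p \<phi>s n) \<le> 0"
      using regime elim that unfolding sparse_regression_regime_def by auto
    then have one: "selection_prob q \<gamma> f n = 1"
      using selection_no_covariates[OF elim] that by simp
    have "0 \<le> real n powr (- \<alpha>) * real (p n) powr (- \<beta>)"
      "0 \<le> 4 * real K ^ (K + 1) * real n powr (- (real K - 2 * real_of_ereal (limsup (growth_rate p))) / 2)"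
      by auto
    then show ?case unfolding one by linarith
  qed
  then have q0: "eventually ?P sequentially" "eventually ?Q sequentially" if "q = 0"
    using that by (auto elim: eventually_mono)
  show "eventually ?P sequentially" if "bounded_covariates M X p A"
  proof (cases "q = 0")
    case False
    then have "q \<ge> 1" by simp
    then show ?thesis by (rule selection_bounded[OF regime a1 _ \<gamma> \<alpha> \<beta> adm prior R that])
  qed (rule q0)
  show "eventually ?Q sequentially" if "moment_covariates \<mu> M X p K AK B"
  proof (cases "q = 0")
    case False
    then have "q \<ge> 1" by simp
    then show ?thesis by (rule selection_moment[OF regime a1 _ \<gamma> \<alpha> \<beta> adm prior R that])
  qed (rule q0)
qed

end

text \<open>For finite \<kappa> > 0, a quarter of the slack in the inequality for \<gamma> becomes
  \<beta> and at most another quarter becomes \<alpha> / \<kappa>. Keeping \<alpha> below 1/2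
  permits \<open>admissible_scalars_mono\<close>.\<close>

lemma admissible_scalars_exist:
  assumes "0 \<le> \<kappa>" "ereal \<gamma> > 1 - 1 / (2 * \<kappa>)"
  obtains \<alpha> \<beta> where "\<alpha> > 0" "\<beta> > 0" "\<alpha> < 1 / 2" "admissible_scalars \<alpha> \<beta> \<gamma> \<kappa>"
proof (cases \<kappa>)
  case (real k)
  show ?thesis
  proof (cases "k = 0")
    case True
    then show ?thesis using real that[of "1 / 4" 1] by (simp add: admissible_scalars_def zero_ereal_def)
  next
    case False
    then have k: "k > 0" using assms(1) real by simp
    have "\<gamma> > 1 - 1 / (2 * k)" using assms(2) real k by (simp add: one_ereal_def)
    define g where "g = \<gamma> - 1 + 1 / (2 * k)"
    have g: "g > 0" using \<open>\<gamma> > 1 - 1 / (2 * k)\<close> by (simp add: g_def)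
    define \<alpha> where "\<alpha> = min (1 / 4) (g / 4 * k)"
    have \<alpha>: "\<alpha> > 0" "\<alpha> < 1 / 2" "\<alpha> \<le> g / 4 * k" using g k by (auto simp: \<alpha>_def)
    have "\<alpha> / k \<le> g / 4" using \<alpha>(3) k by (simp add: pos_divide_le_eq)
    moreover have "1 - 1 / (2 * k) = \<gamma> - g" by (simp add: g_def)
    ultimately have "\<gamma> > 1 - 1 / (2 * k) + g / 4 + \<alpha> / k" using g by linarith
    then have "admissible_scalars \<alpha> (g / 4) \<gamma> \<kappa>"
      using real k by (simp add: admissible_scalars_def one_ereal_def)
    then show ?thesis using that[of \<alpha> "g / 4"] \<alpha> g by simp
  qed
next
  case PInf
  then have "\<gamma> > 1" using assms(2) by (simp add: one_ereal_def)
  then show ?thesis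
    using PInf that[of "1 / 4" "(\<gamma> - 1) / 2"] by (simp add: admissible_scalars_def one_ereal_def field_simps)
next
  case MInf
  then show ?thesis using assms(1) by simp
qed

lemma (in glm_sequence) selection_consistent:
  assumes regime: "sparse_regression_regime M X p \<phi>s q a1 a2 a3" and a1: "a1 > 0" and \<gamma>: "\<gamma> \<ge> 0"
    and \<kappa>: "ereal \<gamma> > 1 - 1 / (2 * limsup (growth_rate p))"
    and cov: "bounded_covariates M X p A \<or> moment_covariates \<mu> M X p K AK B"
    and prior: "prior_conditions p q R f F1 F2 F3" and R: "a3 \<le> R"
  shows "(\<lambda>n. selection_prob q \<gamma> f n) \<longlonglongrightarrow> 1"
proof -
  note gr = growth_rate_nonneg[of p, OF p_pos]
  obtain \<alpha> \<beta> where ab: "\<alpha> > 0" "\<beta> > 0" "\<alpha> < 1 / 2" and adm: "admissible_scalars \<alpha> \<beta> \<gamma> (limsup (growth_rate p))"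
    by (rule admissible_scalars_exist[OF gr(2) \<kappa>])
  \<comment> \<open>Consistency assumes nothing at the liminf; there admissibility is inherited from
    the limsup since \<alpha> < 1/2.\<close>
  have "liminf (growth_rate p) \<le> limsup (growth_rate p)" by (intro Liminf_le_Limsup) auto
  then have adm': "admissible_scalars \<alpha> \<beta> \<gamma> (liminf (growth_rate p))"
    using admissible_scalars_mono[OF adm gr(1) _ ab(3)] by blast
  note bounds = selection_lower_bounds[OF regime a1 \<gamma> ab(1,2) adm adm' prior R]
  have pz: "((\<lambda>n. real n powr (- c)) \<longlonglongrightarrow> 0)" if "c > 0" for c
    using that by (intro tendsto_neg_powr filterlim_real_sequentially) auto
  have pe: "\<forall>\<^sub>F n in sequentially. real n powr (- \<alpha>) * real (p n) powr (- \<beta>) \<le> real n powr (- \<alpha>)"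
    using eventually_ge_at_top[of 1]
  proof eventually_elim
    case (elim n)
    have "real (p n) powr (- \<beta>) \<le> real (p n) powr 0" using p_pos[OF elim] ab by (intro powr_mono) auto
    also have "\<dots> = 1" using p_pos[OF elim] by simp
    finally show ?case using mult_left_mono[of "real (p n) powr (- \<beta>)" 1 "real n powr (- \<alpha>)"] by simp
  qed
  have "\<exists>c\<ge>0. \<exists>k>0. \<forall>\<^sub>F n in sequentially.
      1 - (c * real n powr (- k) + real n powr (- \<alpha>)) \<le> selection_prob q \<gamma> f n"
    using cov
  proof
    assume "bounded_covariates M X p A"
    from bounds(1)[OF this] pe have "\<forall>\<^sub>F n in sequentially.
      1 - (0 * real n powr (- 1) + real n powr (- \<alpha>)) \<le> selection_prob q \<gamma> f n"
      by eventually_elim simp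
    then show ?thesis by (intro exI[of _ 0] conjI exI[of _ 1]) auto
  next
    assume mc: "moment_covariates \<mu> M X p K AK B"
    obtain k where k: "limsup (growth_rate p) = ereal k" "0 \<le> k" "2 * k < real K" "K \<ge> 2"
      by (rule moment_covariates_growth[OF mc])
    have ex: "- (real K - 2 * real_of_ereal (limsup (growth_rate p))) / 2 = - ((real K - 2 * k) / 2)"
      using k(1) by (simp add: field_simps)
    from bounds(2)[OF mc] pe have "\<forall>\<^sub>F n in sequentially.
      1 - (4 * real K ^ (K + 1) * real n powr (- ((real K - 2 * k) / 2)) + real n powr (- \<alpha>))
        \<le> selection_prob q \<gamma> f n"
      unfolding ex by eventually_elim linarith
    then show ?thesis using k(3) by (intro exI[of _ "4 * real K ^ (K + 1)"] conjI exI[of _ "(real K - 2 * k) / 2"]) auto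
  qed
  then obtain c k where k: "k > 0" and low: "\<forall>\<^sub>F n in sequentially.
      1 - (c * real n powr (- k) + real n powr (- \<alpha>)) \<le> selection_prob q \<gamma> f n"
    by blast
  have "(\<lambda>n. 1 - (c * real n powr (- k) + real n powr (- \<alpha>))) \<longlonglongrightarrow> 1 - (c * 0 + 0)"
    by (intro tendsto_intros pz k ab(1))
  then have lim: "(\<lambda>n. 1 - (c * real n powr (- k) + real n powr (- \<alpha>))) \<longlonglongrightarrow> 1" by simp
  have up: "\<forall>\<^sub>F n in sequentially. selection_prob q \<gamma> f n \<le> 1"
    using eventually_ge_at_top[of 1] by eventually_elim (rule prob_space.prob_le_1[OF prob])
  show ?thesis by (rule tendsto_sandwich[OF low up lim tendsto_const])
qed

theorem corollary1:
  fixes \<mu> :: "real measure"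
    and A AK a1 a2 a3 \<alpha> \<beta> :: real
    and B :: "real \<Rightarrow> real"
    and K q :: nat
  assumes "exponential_family \<mu>"
    and "a1 > 0" and "a2 > 0" and "a3 > 0"
    and "\<alpha> > 0" and "\<beta> > 0"
  shows "(\<exists>R>0. \<forall>(M :: nat \<Rightarrow> 'w measure) X Y p \<phi>s \<gamma> f F1 F2 F3.
           glm_sequence \<mu> M X Y p \<phi>s \<longrightarrow>
           sparse_regression_regime M X p \<phi>s q a1 a2 a3 \<longrightarrow>
           \<gamma> \<ge> 0 \<longrightarrow>
           admissible_scalars \<alpha> \<beta> \<gamma> (limsup (growth_rate p)) \<longrightarrow>
           admissible_scalars \<alpha> \<beta> \<gamma> (liminf (growth_rate p)) \<longrightarrow>
           prior_conditions p q R f F1 F2 F3 \<longrightarrow>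
           (bounded_covariates M X p A \<longrightarrow>
             (\<forall>\<^sub>F n in sequentially.
               measure (M n) (bayes_selects_truth \<mu> M X Y p \<phi>s q \<gamma> f n)
                 \<ge> 1 - real n powr (- \<alpha>) * real (p n) powr (- \<beta>))) \<and>
           (moment_covariates \<mu> M X p K AK B \<longrightarrow>
             (\<forall>\<^sub>F n in sequentially.
               measure (M n) (bayes_selects_truth \<mu> M X Y p \<phi>s q \<gamma> f n)
                 \<ge> 1 - 4 * real K ^ (K + 1)
                         * real n powr (- (real K - 2 * real_of_ereal (limsup (growth_rate p))) / 2)
                     - real n powr (- \<alpha>) * real (p n) powr (- \<beta>))))
       \<and> (\<forall>\<gamma> \<kappa>. \<gamma> \<ge> 0 \<longrightarrow> ereal \<gamma> > 1 - 1 / (2 * \<kappa>) \<longrightarrow>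
           (\<exists>R>0. \<forall>(M :: nat \<Rightarrow> 'w measure) X Y p \<phi>s f F1 F2 F3.
             glm_sequence \<mu> M X Y p \<phi>s \<longrightarrow>
             sparse_regression_regime M X p \<phi>s q a1 a2 a3 \<longrightarrow>
             limsup (growth_rate p) = \<kappa> \<longrightarrow>
             bounded_covariates M X p A \<or> moment_covariates \<mu> M X p K AK B \<longrightarrow>
             prior_conditions p q R f F1 F2 F3 \<longrightarrow>
             (\<lambda>n. measure (M n) (bayes_selects_truth \<mu> M X Y p \<phi>s q \<gamma> f n)) \<longlonglongrightarrow> 1))"
proof (intro conjI allI impI)
  show "\<exists>R>0. \<forall>(M :: nat \<Rightarrow> 'w measure) X Y p \<phi>s \<gamma> f F1 F2 F3.
           glm_sequence \<mu> M X Y p \<phi>s \<longrightarrow>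
           sparse_regression_regime M X p \<phi>s q a1 a2 a3 \<longrightarrow>
           \<gamma> \<ge> 0 \<longrightarrow>
           admissible_scalars \<alpha> \<beta> \<gamma> (limsup (growth_rate p)) \<longrightarrow>
           admissible_scalars \<alpha> \<beta> \<gamma> (liminf (growth_rate p)) \<longrightarrow>
           prior_conditions p q R f F1 F2 F3 \<longrightarrow>
           (bounded_covariates M X p A \<longrightarrow>
             (\<forall>\<^sub>F n in sequentially.
               measure (M n) (bayes_selects_truth \<mu> M X Y p \<phi>s q \<gamma> f n)
                 \<ge> 1 - real n powr (- \<alpha>) * real (p n) powr (- \<beta>))) \<and>
           (moment_covariates \<mu> M X p K AK B \<longrightarrow>
             (\<forall>\<^sub>F n in sequentially.
               measure (M n) (bayes_selects_truth \<mu> M X Y p \<phi>s q \<gamma> f n)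
                 \<ge> 1 - 4 * real K ^ (K + 1)
                         * real n powr (- (real K - 2 * real_of_ereal (limsup (growth_rate p))) / 2)
                     - real n powr (- \<alpha>) * real (p n) powr (- \<beta>)))"
  \<comment> \<open>The radius must only reach the true parameter, of norm at most a3: the prior is
    bounded below on a small cube around it.\<close>
  proof (intro exI[of _ "a3 + 1"] conjI allI impI)
    fix M :: "nat \<Rightarrow> 'w measure" and X Y p \<phi>s f and \<gamma> F1 F2 F3 :: real
    assume glm: "glm_sequence \<mu> M X Y p \<phi>s" and regime: "sparse_regression_regime M X p \<phi>s q a1 a2 a3"
      and \<gamma>: "\<gamma> \<ge> 0" and adm: "admissible_scalars \<alpha> \<beta> \<gamma> (limsup (growth_rate p))"
        "admissible_scalars \<alpha> \<beta> \<gamma> (liminf (growth_rate p))"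
      and prior: "prior_conditions p q (a3 + 1) f F1 F2 F3"
    have R: "a3 \<le> a3 + 1" by simp
    note bounds = glm_sequence.selection_lower_bounds[OF glm regime assms(2) \<gamma> assms(5,6) adm prior R]
    show "\<forall>\<^sub>F n in sequentially. measure (M n) (bayes_selects_truth \<mu> M X Y p \<phi>s q \<gamma> f n)
        \<ge> 1 - real n powr (- \<alpha>) * real (p n) powr (- \<beta>)"
      if "bounded_covariates M X p A" by (rule bounds(1)[OF that])
    show "\<forall>\<^sub>F n in sequentially. measure (M n) (bayes_selects_truth \<mu> M X Y p \<phi>s q \<gamma> f n)
        \<ge> 1 - 4 * real K ^ (K + 1) * real n powr (- (real K - 2 * real_of_ereal (limsup (growth_rate p))) / 2)
          - real n powr (- \<alpha>) * real (p n) powr (- \<beta>)"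
      if "moment_covariates \<mu> M X p K AK B" by (rule bounds(2)[OF that])
  qed (use assms in simp)
next
  fix \<gamma> :: real and \<kappa> :: ereal
  assume \<gamma>: "\<gamma> \<ge> 0" and \<kappa>: "ereal \<gamma> > 1 - 1 / (2 * \<kappa>)"
  show "\<exists>R>0. \<forall>(M :: nat \<Rightarrow> 'w measure) X Y p \<phi>s f F1 F2 F3.
             glm_sequence \<mu> M X Y p \<phi>s \<longrightarrow>
             sparse_regression_regime M X p \<phi>s q a1 a2 a3 \<longrightarrow>
             limsup (growth_rate p) = \<kappa> \<longrightarrow>
             bounded_covariates M X p A \<or> moment_covariates \<mu> M X p K AK B \<longrightarrow>
             prior_conditions p q R f F1 F2 F3 \<longrightarrow>
             (\<lambda>n. measure (M n) (bayes_selects_truth \<mu> M X Y p \<phi>s q \<gamma> f n)) \<longlonglongrightarrow> 1"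
  proof (intro exI[of _ "a3 + 1"] conjI allI impI)
    fix M :: "nat \<Rightarrow> 'w measure" and X Y p \<phi>s f and F1 F2 F3 :: real
    assume glm: "glm_sequence \<mu> M X Y p \<phi>s" and regime: "sparse_regression_regime M X p \<phi>s q a1 a2 a3"
      and lim: "limsup (growth_rate p) = \<kappa>"
      and cov: "bounded_covariates M X p A \<or> moment_covariates \<mu> M X p K AK B"
      and prior: "prior_conditions p q (a3 + 1) f F1 F2 F3"
    have R: "a3 \<le> a3 + 1" by simp
    show "(\<lambda>n. measure (M n) (bayes_selects_truth \<mu> M X Y p \<phi>s q \<gamma> f n)) \<longlonglongrightarrow> 1"
      by (rule glm_sequence.selection_consistent[OF glm regime assms(2) \<gamma> \<kappa>[folded lim] cov prior R])
  qed (use assms in simp)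
qed

end
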